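(* Let $(\hat M^{2n},\hat g,J)$ be an almost Hermitian manifold and $f\colon\hat M\to\mathbb R$ a strictly positive smooth function, and equip the warped product $M=\hat M\times_f\mathbb R$ with its induced almost contact metric structure. Then: (i) The induced almost contact structure on $M$ is harmonic if and only if the almost Hermitian structure on $\hat M$ satisfies $$[\hat\nabla^*\hat\nabla J,J]+2f^{-1}J\,\hat\nabla_{\nabla f}J=0.$$ (ii) If $\hat M$ is a Kähler manifold then the almost contact structure on $M$ is harmonic for all warping functions $f$. (iii) If the almost Hermitian structure on $\hat M$ is harmonic (for example, if $\hat M$ is a nearly Kähler manifold) then the almost contact structure on $M$ is harmonic if and only if $\nabla f$ is Kähler null.
   Context: An almost contact metric structure on a Riemannian manifold $(M^{2n+1},g)$ consists of a $(1,1)$-tensor $\phi$, a unit vector field $\xi$ and its dual $1$-form $\eta=g(\xi,\cdot)$, with $\phi^2=-I+\eta\otimes\xi$ and $g(\phi X,\phi Y)=g(X,Y)-\eta(X)\eta(Y)$. Everything is smooth. $\nabla$ is the Levi-Civita connection; $\mathcal{D}=\operatorname{im}\phi=\ker\eta$; $J=\phi|_{\mathcal D}$; $\bar\nabla$ is the connection in $\mathcal{D}\to M$ given by $\bar\nabla_XY=(\nabla_XY)_{\mathcal D}$ (orthogonal projection), $X\in TM$, $Y$ a section of $\mathcal D$. $\nabla^2_{X,Y}=\nabla_X\nabla_Y-\nabla_{\nabla_XY}$ and $\bar\nabla^2_{X,Y}=\bar\nabla_X\bar\nabla_Y-\bar\nabla_{\nabla_XY}$. For a local orthonormal frame $(E_i)$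 of $TM$ (sums over repeated indices): $\nabla^*\nabla\xi=-\nabla^2_{E_i,E_i}\xi$, $\bar\nabla^*\bar\nabla J=-\bar\nabla^2_{E_i,E_i}J$, and $$\tau(\xi)=\nabla^*\nabla\xi-|\nabla\xi|^2\xi,\quad \tau(J)=[\bar\nabla^*\bar\nabla J,J],\quad T(\phi)=(\bar\nabla_{E_i}J)\big(\nabla_{E_i}\xi\big),$$ where $[\cdot,\cdot]$ is the commutator of endomorphisms of $\mathcal D$ (note that $\nabla_X\xi\in\mathcal D$). The almost contact metric structure is harmonic if it is given by a harmonic section of the associated bundle with fibre $SO(2n+1)/U(n)$; equivalently (known result, used here as the definition), if both $\tau(\xi)+\tfrac12 J\,T(\phi)=0$ and $\tau(J)=0$ hold. The warped product $\hat M\times_f\mathbb R$ is $\hat M\times\mathbb R$ with metric $g=\hat g+f^2dt^2$. Its induced almost contact metric structure is given by $\xi=f^{-1}\partial_t$, $\mathcal D=T\hat M$ equipped with the almost Hermitian structure $J$ of $\hat M$ (so $\phi\xi=0$ and $\phi|_{\mathcal D}=J$). $\hat\nabla$ is the Levi-Civita connection of $(\hat M,\hat g)$, $\hat\nabla^*\hat\nabla=-\operatorname{tr}\hat\nabla^2$, and $\nabla f$ is the gradient of $f$ (on $\hat M$). The almost Hermitian structure on $\hat M$ is harmonic if $[\hat\nabla^*\hat\nabla J,J]=0$. A vector field $X$ on $\hat M$ is Kähler null if $\hat\nabla_XJ=0$. $\hat M$ is nearly Kähler if $(\hat\nabla_XJ)X=0$ for all $X$, and Kähler if $\hat\nabla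 J=0$. *)

theory Defs
  imports "HOL-Analysis.Analysis"
begin

section \<open>Smooth maps between Euclidean spaces\<close>

primrec Ck_on :: "nat \<Rightarrow> 'a::euclidean_space set \<Rightarrow> ('a \<Rightarrow> 'b::real_normed_vector) \<Rightarrow> bool" where
  "Ck_on 0 S f \<longleftrightarrow> continuous_on S f"
| "Ck_on (Suc k) S f \<longleftrightarrow> (\<forall>x\<in>S. f differentiable (at x)) \<and>
     (\<forall>v. Ck_on k S (\<lambda>x. frechet_derivative f (at x) v))"

text \<open>Only used for open \<open>S\<close>.\<close>

definition smooth_on :: "'a::euclidean_space set \<Rightarrow> ('a \<Rightarrow> 'b::real_normed_vector) \<Rightarrow> bool" where
  "smooth_on S f \<longleftrightarrow> (\<forall>k. Ck_on k S f)"


section \<open>Smooth manifolds, tangent vectors, vector fields\<close>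

text \<open>
  The manifold is the whole type \<open>'m\<close>, with its topology, modelled on \<open>'e\<close>.  The smooth
  structure is given by an atlas indexed by the points: \<open>chart_map M p\<close> is a chart defined on the
  neighbourhood \<open>chart_dom M p\<close> of \<open>p\<close>.  (Every smooth structure has such an atlas: choose a chart
  around each point.)

  The tangent space \<open>T\<^sub>p M\<close> is \<open>'e\<close>, a vector being represented by its coordinates in
  the chart indexed by \<open>p\<close>.  So a vector field is a function \<open>'m \<Rightarrow> 'e\<close>, a (1,1)-tensor field a
  function \<open>'m \<Rightarrow> 'e \<Rightarrow> 'e\<close> and a metric a function \<open>'m \<Rightarrow> 'e \<Rightarrow> 'e \<Rightarrow> real\<close>.  The assignment
  \<open>p \<mapsto> chart_map M p\<close> is not required to be continuous in any sense: smoothness of a field is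
  always expressed in a fixed chart, after transforming its values by \<open>dchart\<close>.
\<close>

record ('m, 'e) manifold =
  chart_dom :: "'m \<Rightarrow> 'm set"
  chart_map :: "'m \<Rightarrow> 'm \<Rightarrow> 'e"

definition chart_inv :: "('m, 'e) manifold \<Rightarrow> 'm \<Rightarrow> 'e \<Rightarrow> 'm" where
  "chart_inv M p = inv_into (chart_dom M p) (chart_map M p)"

definition smooth_manifold ::
  "('m::{t2_space,second_countable_topology}, 'e::euclidean_space) manifold \<Rightarrow> bool" where
  "smooth_manifold M \<longleftrightarrow>
     (\<forall>p. p \<in> chart_dom M p \<and> open (chart_dom M p) \<and> open (chart_map M p ` chart_dom M p) \<and>
        homeomorphism (chart_dom M p) (chart_map M p ` chart_dom M p)
          (chart_map M p) (chart_inv M p)) \<and>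
     (\<forall>p q. smooth_on (chart_map M p ` (chart_dom M p \<inter> chart_dom M q))
        (chart_map M q \<circ> chart_inv M p))"

definition smooth_fun ::
  "('m::topological_space, 'e::euclidean_space) manifold \<Rightarrow> 'm set \<Rightarrow> ('m \<Rightarrow> real) \<Rightarrow> bool" where
  "smooth_fun M U h \<longleftrightarrow>
     (\<forall>q. smooth_on (chart_map M q ` (U \<inter> chart_dom M q)) (h \<circ> chart_inv M q))"

text \<open>The differential at \<open>p\<close> of a real function: \<open>dfun M h p v\<close> is \<open>v h\<close> for \<open>v \<in> T\<^sub>p M\<close>.\<close>

definition dfun ::
  "('m, 'e::euclidean_space) manifold \<Rightarrow> ('m \<Rightarrow> real) \<Rightarrow> 'm \<Rightarrow> 'e \<Rightarrow> real" where
  "dfun M h p v = frechet_derivative (h \<circ> chart_inv M p) (at (chart_map M p p)) v"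

text \<open>The differential at \<open>p\<close> of the chart indexed by \<open>q\<close>, i.e. the coordinates in that chart of
  a vector in \<open>T\<^sub>p M\<close>.\<close>

definition dchart ::
  "('m, 'e::euclidean_space) manifold \<Rightarrow> 'm \<Rightarrow> 'm \<Rightarrow> 'e \<Rightarrow> 'e" where
  "dchart M q p v = frechet_derivative (chart_map M q \<circ> chart_inv M p) (at (chart_map M p p)) v"

text \<open>Fields on an open set \<open>U\<close> are total functions whose values outside \<open>U\<close> are irrelevant.\<close>

definition vector_field ::
  "('m::topological_space, 'e::euclidean_space) manifold \<Rightarrow> 'm set \<Rightarrow> ('m \<Rightarrow> 'e) \<Rightarrow> bool" where
  "vector_field M U X \<longleftrightarrow>
     (\<forall>q. smooth_on (chart_map M q ` (U \<inter> chart_dom M q))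
        (\<lambda>x. dchart M q (chart_inv M q x) (X (chart_inv M q x))))"

definition tensor11 ::
  "('m::topological_space, 'e::euclidean_space) manifold \<Rightarrow> ('m \<Rightarrow> 'e \<Rightarrow> 'e) \<Rightarrow> bool" where
  "tensor11 M A \<longleftrightarrow> (\<forall>p. linear (A p)) \<and>
     (\<forall>U X. open U \<longrightarrow> vector_field M U X \<longrightarrow> vector_field M U (\<lambda>p. A p (X p)))"


section \<open>Riemannian metrics and the Levi-Civita connection\<close>

definition riemannian_manifold ::
  "('m::{t2_space,second_countable_topology}, 'e::euclidean_space) manifold \<Rightarrow>
     ('m \<Rightarrow> 'e \<Rightarrow> 'e \<Rightarrow> real) \<Rightarrow> bool" where
  "riemannian_manifold M g \<longleftrightarrow> smooth_manifold M \<and>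
     (\<forall>p. bilinear (g p) \<and> (\<forall>u v. g p u v = g p v u) \<and> (\<forall>u. u \<noteq> 0 \<longrightarrow> 0 < g p u u)) \<and>
     (\<forall>U X Y. open U \<longrightarrow> vector_field M U X \<longrightarrow> vector_field M U Y \<longrightarrow>
        smooth_fun M U (\<lambda>p. g p (X p) (Y p)))"

definition gradient ::
  "('m, 'e::euclidean_space) manifold \<Rightarrow> ('m \<Rightarrow> 'e \<Rightarrow> 'e \<Rightarrow> real) \<Rightarrow> ('m \<Rightarrow> real) \<Rightarrow> 'm \<Rightarrow> 'e" where
  "gradient M g f p = (THE w. \<forall>v. g p w v = dfun M f p v)"

text \<open>
  A connection in \<open>TM\<close>, acting on vector fields defined on open sets: \<open>D p v Y\<close> is
  \<open>\<nabla>\<^sub>v Y \<in> T\<^sub>p M\<close> for \<open>v \<in> T\<^sub>p M\<close> and \<open>Y\<close> a smooth vector field near \<open>p\<close>.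
  It is constrained only on such \<open>Y\<close>; the third clause says that it is local in \<open>Y\<close>.
\<close>

type_synonym ('m, 'e) connection = "'m \<Rightarrow> 'e \<Rightarrow> ('m \<Rightarrow> 'e) \<Rightarrow> 'e"

definition affine_connection ::
  "('m::topological_space, 'e::euclidean_space) manifold \<Rightarrow> ('m, 'e) connection \<Rightarrow> bool" where
  "affine_connection M D \<longleftrightarrow>
     (\<forall>U Y. open U \<longrightarrow> vector_field M U Y \<longrightarrow>
        (\<forall>X. vector_field M U X \<longrightarrow> vector_field M U (\<lambda>p. D p (X p) Y)) \<and>
        (\<forall>p\<in>U. linear (\<lambda>v. D p v Y)) \<and>
        (\<forall>Z. (\<forall>q\<in>U. Z q = Y q) \<longrightarrow> (\<forall>p\<in>U. \<forall>v. D p v Z = D p v Y)) \<and>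
        (\<forall>Z. vector_field M U Z \<longrightarrow>
           (\<forall>p\<in>U. \<forall>v. D p v (\<lambda>q. Y q + Z q) = D p v Y + D p v Z)) \<and>
        (\<forall>h. smooth_fun M U h \<longrightarrow>
           (\<forall>p\<in>U. \<forall>v. D p v (\<lambda>q. h q *\<^sub>R Y q) = dfun M h p v *\<^sub>R Y p + h p *\<^sub>R D p v Y)))"

text \<open>\<open>nab D X Y\<close> is the vector field \<open>\<nabla>\<^sub>X Y\<close>.\<close>

definition nab :: "('m, 'e) connection \<Rightarrow> ('m \<Rightarrow> 'e) \<Rightarrow> ('m \<Rightarrow> 'e) \<Rightarrow> 'm \<Rightarrow> 'e" where
  "nab D X Y = (\<lambda>p. D p (X p) Y)"

text \<open>\<open>\<nabla>\<^sub>X Y - \<nabla>\<^sub>Y X = [X, Y]\<close>, both sides acting as derivations on smooth functions.\<close>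

definition torsion_free ::
  "('m::topological_space, 'e::euclidean_space) manifold \<Rightarrow> ('m, 'e) connection \<Rightarrow> bool" where
  "torsion_free M D \<longleftrightarrow>
     (\<forall>U X Y h. open U \<longrightarrow> vector_field M U X \<longrightarrow> vector_field M U Y \<longrightarrow> smooth_fun M U h \<longrightarrow>
        (\<forall>p\<in>U. dfun M h p (nab D X Y p - nab D Y X p) =
           dfun M (\<lambda>q. dfun M h q (Y q)) p (X p) - dfun M (\<lambda>q. dfun M h q (X q)) p (Y p)))"

definition metric_connection ::
  "('m::topological_space, 'e::euclidean_space) manifold \<Rightarrow> ('m \<Rightarrow> 'e \<Rightarrow> 'e \<Rightarrow> real) \<Rightarrow>
     ('m, 'e) connection \<Rightarrow> bool" where
  "metric_connection M g D \<longleftrightarrow>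
     (\<forall>U Y Z. open U \<longrightarrow> vector_field M U Y \<longrightarrow> vector_field M U Z \<longrightarrow>
        (\<forall>p\<in>U. \<forall>v. dfun M (\<lambda>q. g q (Y q) (Z q)) p v = g p (D p v Y) (Z p) + g p (Y p) (D p v Z)))"

text \<open>By the fundamental theorem of Riemannian geometry there is exactly one such connection on a
  Riemannian manifold (up to irrelevant values at functions \<open>Y\<close> that are not smooth near \<open>p\<close>).\<close>

definition levi_civita ::
  "('m::topological_space, 'e::euclidean_space) manifold \<Rightarrow> ('m \<Rightarrow> 'e \<Rightarrow> 'e \<Rightarrow> real) \<Rightarrow>
     ('m, 'e) connection \<Rightarrow> bool" where
  "levi_civita M g D \<longleftrightarrow> affine_connection M D \<and> torsion_free M D \<and> metric_connection M g D"

text \<open>The set \<open>Basis\<close> of the model space only serves as an index set with \<open>dim M\<close> elements.\<close>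

definition orthonormal_frame ::
  "('m::topological_space, 'e::euclidean_space) manifold \<Rightarrow> ('m \<Rightarrow> 'e \<Rightarrow> 'e \<Rightarrow> real) \<Rightarrow>
     'm set \<Rightarrow> ('e \<Rightarrow> 'm \<Rightarrow> 'e) \<Rightarrow> bool" where
  "orthonormal_frame M g U E \<longleftrightarrow> (\<forall>i\<in>Basis. vector_field M U (E i)) \<and>
     (\<forall>p\<in>U. \<forall>i\<in>Basis. \<forall>j\<in>Basis. g p (E i p) (E j p) = (if i = j then 1 else 0))"


section \<open>Second covariant derivatives and rough Laplacians\<close>

definition nab2 ::
  "('m, 'e) connection \<Rightarrow> ('m \<Rightarrow> 'e) \<Rightarrow> ('m \<Rightarrow> 'e) \<Rightarrow> ('m \<Rightarrow> 'e) \<Rightarrow> 'm \<Rightarrow> 'e::euclidean_space" where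
  "nab2 D X Y Z = (\<lambda>p. nab D X (nab D Y Z) p - nab D (nab D X Y) Z p)"

definition rough_laplacian ::
  "('m, 'e) connection \<Rightarrow> ('e \<Rightarrow> 'm \<Rightarrow> 'e) \<Rightarrow> ('m \<Rightarrow> 'e) \<Rightarrow> 'm \<Rightarrow> 'e::euclidean_space" where
  "rough_laplacian D E Z = (\<lambda>p. - (\<Sum>i\<in>Basis. nab2 D (E i) (E i) Z p))"

text \<open>
  Endomorphism fields of a vector bundle (\<open>TM\<close> or the subbundle \<open>\<D>\<close>) are treated
  as operators on its sections.  In what follows \<open>C X W\<close> stands for the covariant derivative of the
  section \<open>W\<close> in the direction \<open>X\<close> in that bundle, \<open>D\<close> for the Levi-Civita connection; \<open>nab_end\<close> is
  the induced covariant derivative of endomorphism fields,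
  \<open>(C\<^sub>X A) W = C\<^sub>X (A W) - A (C\<^sub>X W)\<close>.
\<close>

type_synonym ('m, 'e) endo = "('m \<Rightarrow> 'e) \<Rightarrow> ('m \<Rightarrow> 'e)"

definition endo_of :: "('m \<Rightarrow> 'e \<Rightarrow> 'e) \<Rightarrow> ('m, 'e) endo" where
  "endo_of A = (\<lambda>W p. A p (W p))"

definition nab_end ::
  "(('m \<Rightarrow> 'e) \<Rightarrow> ('m, 'e) endo) \<Rightarrow> ('m \<Rightarrow> 'e) \<Rightarrow> ('m, 'e) endo \<Rightarrow> ('m, 'e::euclidean_space) endo" where
  "nab_end C X A = (\<lambda>W p. C X (A W) p - A (C X W) p)"

definition nab2_end ::
  "('m, 'e) connection \<Rightarrow> (('m \<Rightarrow> 'e) \<Rightarrow> ('m, 'e) endo) \<Rightarrow> ('m \<Rightarrow> 'e) \<Rightarrow> ('m \<Rightarrow> 'e) \<Rightarrow>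
     ('m, 'e) endo \<Rightarrow> ('m, 'e::euclidean_space) endo" where
  "nab2_end D C X Y A =
     (\<lambda>W p. nab_end C X (nab_end C Y A) W p - nab_end C (nab D X Y) A W p)"

definition rough_laplacian_end ::
  "('m, 'e) connection \<Rightarrow> (('m \<Rightarrow> 'e) \<Rightarrow> ('m, 'e) endo) \<Rightarrow> ('e \<Rightarrow> 'm \<Rightarrow> 'e) \<Rightarrow>
     ('m, 'e) endo \<Rightarrow> ('m, 'e::euclidean_space) endo" where
  "rough_laplacian_end D C E A = (\<lambda>W p. - (\<Sum>i\<in>Basis. nab2_end D C (E i) (E i) A W p))"

definition commutator ::
  "('m, 'e) endo \<Rightarrow> ('m, 'e) endo \<Rightarrow> ('m, 'e::euclidean_space) endo" where
  "commutator A B = (\<lambda>W p. A (B W) p - B (A W) p)"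


section \<open>Almost Hermitian structures\<close>

definition almost_hermitian ::
  "('m::{t2_space,second_countable_topology}, 'e::euclidean_space) manifold \<Rightarrow>
     ('m \<Rightarrow> 'e \<Rightarrow> 'e \<Rightarrow> real) \<Rightarrow> ('m \<Rightarrow> 'e \<Rightarrow> 'e) \<Rightarrow> bool" where
  "almost_hermitian M g J \<longleftrightarrow> riemannian_manifold M g \<and> tensor11 M J \<and>
     (\<forall>p u. J p (J p u) = - u) \<and> (\<forall>p u v. g p (J p u) (J p v) = g p u v)"

definition harmonic_almost_hermitian ::
  "('m::topological_space, 'e::euclidean_space) manifold \<Rightarrow> ('m \<Rightarrow> 'e \<Rightarrow> 'e \<Rightarrow> real) \<Rightarrow>
     ('m, 'e) connection \<Rightarrow> ('m \<Rightarrow> 'e \<Rightarrow> 'e) \<Rightarrow> bool" where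
  "harmonic_almost_hermitian M g D J \<longleftrightarrow>
     (\<forall>U E W. open U \<longrightarrow> orthonormal_frame M g U E \<longrightarrow> vector_field M U W \<longrightarrow>
        (\<forall>p\<in>U. commutator (rough_laplacian_end D (nab D) E (endo_of J)) (endo_of J) W p = 0))"

definition kahler_null ::
  "('m::topological_space, 'e::euclidean_space) manifold \<Rightarrow> ('m, 'e) connection \<Rightarrow>
     ('m \<Rightarrow> 'e \<Rightarrow> 'e) \<Rightarrow> ('m \<Rightarrow> 'e) \<Rightarrow> bool" where
  "kahler_null M D J X \<longleftrightarrow>
     (\<forall>U W. open U \<longrightarrow> vector_field M U W \<longrightarrow> (\<forall>p\<in>U. nab_end (nab D) X (endo_of J) W p = 0))"

definition nearly_kahler ::
  "('m::topological_space, 'e::euclidean_space) manifold \<Rightarrow> ('m, 'e) connection \<Rightarrow>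
     ('m \<Rightarrow> 'e \<Rightarrow> 'e) \<Rightarrow> bool" where
  "nearly_kahler M D J \<longleftrightarrow>
     (\<forall>U X. open U \<longrightarrow> vector_field M U X \<longrightarrow> (\<forall>p\<in>U. nab_end (nab D) X (endo_of J) X p = 0))"

definition kahler ::
  "('m::topological_space, 'e::euclidean_space) manifold \<Rightarrow> ('m, 'e) connection \<Rightarrow>
     ('m \<Rightarrow> 'e \<Rightarrow> 'e) \<Rightarrow> bool" where
  "kahler M D J \<longleftrightarrow>
     (\<forall>U X W. open U \<longrightarrow> vector_field M U X \<longrightarrow> vector_field M U W \<longrightarrow>
        (\<forall>p\<in>U. nab_end (nab D) X (endo_of J) W p = 0))"


section \<open>Almost contact metric structures\<close>

text \<open>The 1-form \<open>\<eta>\<close> is \<open>g p (\<xi> p)\<close>.\<close>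

definition almost_contact_metric ::
  "('m::{t2_space,second_countable_topology}, 'e::euclidean_space) manifold \<Rightarrow>
     ('m \<Rightarrow> 'e \<Rightarrow> 'e \<Rightarrow> real) \<Rightarrow> ('m \<Rightarrow> 'e \<Rightarrow> 'e) \<Rightarrow> ('m \<Rightarrow> 'e) \<Rightarrow> bool" where
  "almost_contact_metric M g \<phi> \<xi> \<longleftrightarrow> riemannian_manifold M g \<and>
     tensor11 M \<phi> \<and> vector_field M UNIV \<xi> \<and>
     (\<forall>p. g p (\<xi> p) (\<xi> p) = 1) \<and>
     (\<forall>p u. \<phi> p (\<phi> p u) = - u + g p (\<xi> p) u *\<^sub>R \<xi> p) \<and>
     (\<forall>p u v. g p (\<phi> p u) (\<phi> p v) = g p u v - g p (\<xi> p) u * g p (\<xi> p) v)"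

text \<open>Sections over \<open>U\<close> of \<open>\<D> = ker \<eta>\<close>, and the connection
  \<open>\<nabla>\<close>-bar in \<open>\<D>\<close>.\<close>

definition D_section ::
  "('m::topological_space, 'e::euclidean_space) manifold \<Rightarrow> ('m \<Rightarrow> 'e \<Rightarrow> 'e \<Rightarrow> real) \<Rightarrow>
     ('m \<Rightarrow> 'e) \<Rightarrow> 'm set \<Rightarrow> ('m \<Rightarrow> 'e) \<Rightarrow> bool" where
  "D_section M g \<xi> U W \<longleftrightarrow> vector_field M U W \<and> (\<forall>p\<in>U. g p (\<xi> p) (W p) = 0)"

definition nab_bar ::
  "('m \<Rightarrow> 'e \<Rightarrow> 'e \<Rightarrow> real) \<Rightarrow> ('m, 'e) connection \<Rightarrow> ('m \<Rightarrow> 'e) \<Rightarrow>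
     ('m \<Rightarrow> 'e) \<Rightarrow> ('m \<Rightarrow> 'e) \<Rightarrow> 'm \<Rightarrow> 'e::euclidean_space" where
  "nab_bar g D \<xi> X W = (\<lambda>p. nab D X W p - g p (\<xi> p) (nab D X W p) *\<^sub>R \<xi> p)"

text \<open>The tension fields \<open>\<tau>(\<xi>)\<close>, \<open>\<tau>(J)\<close> and the term \<open>T(\<phi>)\<close>, computed
  in a local orthonormal frame \<open>E\<close> (they do not depend on the choice of \<open>E\<close>).  On sections of \<open>\<D>\<close> the operator \<open>endo_of \<phi>\<close> is
  \<open>J\<close>.\<close>

definition tau_xi ::
  "('m \<Rightarrow> 'e \<Rightarrow> 'e \<Rightarrow> real) \<Rightarrow> ('m, 'e) connection \<Rightarrow> ('e \<Rightarrow> 'm \<Rightarrow> 'e) \<Rightarrow>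
     ('m \<Rightarrow> 'e) \<Rightarrow> 'm \<Rightarrow> 'e::euclidean_space" where
  "tau_xi g D E \<xi> = (\<lambda>p. rough_laplacian D E \<xi> p -
     (\<Sum>i\<in>Basis. g p (nab D (E i) \<xi> p) (nab D (E i) \<xi> p)) *\<^sub>R \<xi> p)"

definition tau_J ::
  "('m \<Rightarrow> 'e \<Rightarrow> 'e \<Rightarrow> real) \<Rightarrow> ('m, 'e) connection \<Rightarrow> ('e \<Rightarrow> 'm \<Rightarrow> 'e) \<Rightarrow>
     ('m \<Rightarrow> 'e \<Rightarrow> 'e) \<Rightarrow> ('m \<Rightarrow> 'e) \<Rightarrow> ('m, 'e::euclidean_space) endo" where
  "tau_J g D E \<phi> \<xi> =
     commutator (rough_laplacian_end D (nab_bar g D \<xi>) E (endo_of \<phi>)) (endo_of \<phi>)"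

definition T_phi ::
  "('m \<Rightarrow> 'e \<Rightarrow> 'e \<Rightarrow> real) \<Rightarrow> ('m, 'e) connection \<Rightarrow> ('e \<Rightarrow> 'm \<Rightarrow> 'e) \<Rightarrow>
     ('m \<Rightarrow> 'e \<Rightarrow> 'e) \<Rightarrow> ('m \<Rightarrow> 'e) \<Rightarrow> 'm \<Rightarrow> 'e::euclidean_space" where
  "T_phi g D E \<phi> \<xi> =
     (\<lambda>p. \<Sum>i\<in>Basis. nab_end (nab_bar g D \<xi>) (E i) (endo_of \<phi>) (nab D (E i) \<xi>) p)"

definition harmonic_almost_contact ::
  "('m::{t2_space,second_countable_topology}, 'e::euclidean_space) manifold \<Rightarrow>
     ('m \<Rightarrow> 'e \<Rightarrow> 'e \<Rightarrow> real) \<Rightarrow> ('m, 'e) connection \<Rightarrow>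
     ('m \<Rightarrow> 'e \<Rightarrow> 'e) \<Rightarrow> ('m \<Rightarrow> 'e) \<Rightarrow> bool" where
  "harmonic_almost_contact M g D \<phi> \<xi> \<longleftrightarrow> almost_contact_metric M g \<phi> \<xi> \<and>
     (\<forall>U E. open U \<longrightarrow> orthonormal_frame M g U E \<longrightarrow>
        (\<forall>p\<in>U. tau_xi g D E \<xi> p + (1/2) *\<^sub>R \<phi> p (T_phi g D E \<phi> \<xi> p) = 0) \<and>
        (\<forall>W. D_section M g \<xi> U W \<longrightarrow> (\<forall>p\<in>U. tau_J g D E \<phi> \<xi> W p = 0)))"


section \<open>Warped products with the real line\<close>

text \<open>The chart on the factor \<open>\<real>\<close> is the identity, so the tangent space at \<open>(p, t)\<close> is
  \<open>T\<^sub>p M \<times> \<real>\<close> and \<open>(0, 1)\<close> represents \<open>\<partial>\<^sub>t\<close>.\<close>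

definition times_line :: "('m, 'e) manifold \<Rightarrow> ('m \<times> real, 'e \<times> real) manifold" where
  "times_line M =
     \<lparr> chart_dom = (\<lambda>(p, t). chart_dom M p \<times> UNIV),
       chart_map = (\<lambda>(p, t) (q, s). (chart_map M p q, s)) \<rparr>"

definition warped_metric ::
  "('m \<Rightarrow> 'e \<Rightarrow> 'e \<Rightarrow> real) \<Rightarrow> ('m \<Rightarrow> real) \<Rightarrow>
     'm \<times> real \<Rightarrow> 'e \<times> real \<Rightarrow> 'e \<times> real \<Rightarrow> real" where
  "warped_metric g f = (\<lambda>(p, t) (u, a) (v, b). g p u v + (f p)\<^sup>2 * (a * b))"

definition induced_xi :: "('m \<Rightarrow> real) \<Rightarrow> 'm \<times> real \<Rightarrow> 'e::euclidean_space \<times> real" where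
  "induced_xi f = (\<lambda>(p, t). (0, 1 / f p))"

definition induced_phi ::
  "('m \<Rightarrow> 'e \<Rightarrow> 'e) \<Rightarrow> 'm \<times> real \<Rightarrow> 'e \<times> real \<Rightarrow> 'e::euclidean_space \<times> real" where
  "induced_phi J = (\<lambda>(p, t) (u, a). (J p u, 0))"

end

theory Submission
  imports Defs
begin

text \<open>
  On the warped product the horizontal lifts \<open>X\<close>, \<open>Y\<close> of fields of the base satisfy \<open>\<nabla>\<^sub>X Y = lift (\<nabla>\<^sub>X Y)\<close>,
  \<open>\<nabla>\<^sub>X \<partial>\<^sub>t = \<nabla>\<^sub>\<partial>\<^sub>t X = (X f / f) \<partial>\<^sub>t\<close> and \<open>\<nabla>\<^sub>\<partial>\<^sub>t \<partial>\<^sub>t = - f grad f\<close>, by the Koszul formula.  Hence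
  \<open>\<nabla>\<^sub>V \<xi> = - \<eta>(V) grad f / f\<close>, from which \<open>\<tau>(\<xi>) = 0\<close> and \<open>T(\<phi>) = 0\<close>, while \<open>\<nabla>\<close>-bar differentiates lifts
  as the base does along horizontal vectors and kills them along \<open>\<xi>\<close>.  In the rough Laplacian of \<open>J\<close> the
  direction \<open>\<xi>\<close> therefore contributes only through \<open>\<nabla>\<^sub>\<xi> \<xi> = - grad f / f\<close>, which yields the additional first order
  term.  All expressions are tensorial, so they may be computed in a frame consisting of lifts and \<open>\<xi>\<close>.

  For a nearly Kaehler base put \<open>L = \<Sum> \<nabla>\<^sup>2\<^sub>i\<^sub>i J\<close> and \<open>L' = \<Sum> \<nabla>\<^sup>2 J (e\<^sub>i, J e\<^sub>i)\<close>.  Differentiating the symmetries of \<open>\<nabla> J\<close>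
  gives \<open>[L, J] = 2 L'\<close>; the first Bianchi identity turns \<open>2 L' = [\<Sum> R(e\<^sub>i, J e\<^sub>i), J]\<close> into
  \<open>3 L' = - (Ric + J Ric J)\<close>, which is symmetric, whereas \<open>L'\<close> is skew.
\<close>

section \<open>Calculus of smooth maps\<close>

text \<open>The connection of the product is not constructed: \<open>D'\<close> is any operator
  satisfying the axioms of a Levi-Civita connection, so everything about it is extracted by pairing
  with lifts and \<partial>_t. The second obstacle is that harmonicity speaks of all open subsets of
  the product, all orthonormal frames on them and all sections of \<D>, which may depend on t. The
  equation for \<xi> can be checked in an arbitrary frame, because the sums collapse to the metric
  dual of dt. The equation for J cannot, and there tensoriality is used to shrink to a cylinder, to
  change the frame and to expand a section in lifts with function coefficients. The constant 2 in
  (i) arises because \<nabla>J anticommutes with J, as follows from J^2 = -1, so that the commutator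
  doubles the first order term of the Laplacian.\<close>

lemma frechet_derivative_eqI:
  "(f has_derivative f') (at x) \<Longrightarrow> frechet_derivative f (at x) = f'"
  using frechet_derivative_at by metis

lemma frechet_derivative_cong_open:
  assumes "open S" "x \<in> S" "\<And>y. y \<in> S \<Longrightarrow> f y = g y"
  shows "frechet_derivative f (at x) = frechet_derivative g (at x)"
proof -
  have "(f has_derivative f') (at x) \<longleftrightarrow> (g has_derivative f') (at x)" for f'
    using has_derivative_transform_within_open[of f f' x UNIV S g]
      has_derivative_transform_within_open[of g f' x UNIV S f] assms by auto
  then show ?thesis by (simp add: frechet_derivative_def)
qed

lemma differentiable_cong_open:
  assumes "open S" "x \<in> S" "\<And>y. y \<in> S \<Longrightarrow> f y = g y" "f differentiable (at x)"
  shows "g differentiable (at x)"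
proof -
  obtain f' where "(f has_derivative f') (at x)"
    using assms(4) by (auto simp: differentiable_def)
  then have "(g has_derivative f') (at x)"
    using has_derivative_transform_within_open[of f f' x UNIV S g] assms by auto
  then show ?thesis by (auto simp: differentiable_def)
qed

text \<open>A derivative at a point of an open set depends only on nearby values, so agreement on
  \<open>S\<close> passes to all derivatives; the induction therefore lets both functions
  vary.\<close>

lemma Ck_on_cong:
  assumes "open S" "\<And>x. x \<in> S \<Longrightarrow> f x = g x" "Ck_on k S f"
  shows "Ck_on k S g"
  using assms(2,3)
proof (induction k arbitrary: f g)
  case 0
  then show ?case by (simp cong: continuous_on_cong)
next
  case (Suc k)
  have eq: "frechet_derivative f (at x) = frechet_derivative g (at x)" if "x \<in> S" for x
    using frechet_derivative_cong_open[OF assms(1) that Suc.prems(1)] .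
  have "Ck_on k S (\<lambda>x. frechet_derivative g (at x) v)" for v
    by (rule Suc.IH[of "\<lambda>x. frechet_derivative f (at x) v"]) (use Suc.prems eq in auto)
  moreover have "g differentiable (at x)" if "x \<in> S" for x
    by (rule differentiable_cong_open[OF assms(1) that Suc.prems(1)]) (use Suc.prems that in auto)
  ultimately show ?case by simp
qed

lemma Ck_on_subset: "Ck_on k S f \<Longrightarrow> T \<subseteq> S \<Longrightarrow> Ck_on k T f"
  by (induction k arbitrary: f) (auto intro: continuous_on_subset)

lemma Ck_on_SucD: "Ck_on (Suc k) S f \<Longrightarrow> Ck_on k S f"
proof (induction k arbitrary: f)
  case 0
  then show ?case
    by (auto simp: continuous_at_imp_continuous_on differentiable_imp_continuous_within)
next
  case (Suc k)
  then show ?case by auto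
qed

lemma Ck_on_local:
  assumes "\<And>x. x \<in> S \<Longrightarrow> \<exists>T. open T \<and> x \<in> T \<and> Ck_on k T f"
  shows "Ck_on k S f"
  using assms
proof (induction k arbitrary: f)
  case 0
  have "isCont f x" if "x \<in> S" for x
    using 0[OF that] by (auto simp: continuous_on_eq_continuous_at)
  then show ?case by (simp add: continuous_at_imp_continuous_on)
next
  case (Suc k)
  have "Ck_on k S (\<lambda>x. frechet_derivative f (at x) v)" for v
  proof (rule Suc.IH)
    fix x assume "x \<in> S"
    from Suc.prems[OF this] show "\<exists>T. open T \<and> x \<in> T \<and> Ck_on k T (\<lambda>x. frechet_derivative f (at x) v)"
      by auto
  qed
  moreover have "f differentiable (at x)" if "x \<in> S" for x
    using Suc.prems[OF that] by auto
  ultimately show ?case by simp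
qed

lemma Ck_on_const: "Ck_on k S (\<lambda>x. c)"
  by (induction k arbitrary: c) auto

lemma Ck_on_bounded_linear: "bounded_linear L \<Longrightarrow> Ck_on k S L"
proof (cases k)
  case 0
  then show "bounded_linear L \<Longrightarrow> Ck_on k S L"
    by (auto intro: linear_continuous_on)
next
  case (Suc j)
  assume L: "bounded_linear L"
  then show "Ck_on k S L"
    using Suc bounded_linear_imp_has_derivative[OF L] frechet_derivative_eqI[of L L]
    by (auto simp: differentiable_def Ck_on_const)
qed

lemma Ck_on_add:
  assumes "open S" "Ck_on k S f" "Ck_on k S g"
  shows "Ck_on k S (\<lambda>x. f x + g x)"
  using assms(2,3)
proof (induction k arbitrary: f g)
  case 0
  then show ?case by (auto intro: continuous_intros)
next
  case (Suc k)
  have d: "((\<lambda>x. f x + g x) has_derivative (\<lambda>v. frechet_derivative f (at x) v + frechet_derivative g (at x) v)) (at x)"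
    if "x \<in> S" for x
    using Suc.prems that by (auto intro!: has_derivative_add simp: frechet_derivative_works[symmetric])
  have "Ck_on k S (\<lambda>x. frechet_derivative (\<lambda>x. f x + g x) (at x) v)" for v
  proof (rule Ck_on_cong[OF assms(1)])
    show "Ck_on k S (\<lambda>x. frechet_derivative f (at x) v + frechet_derivative g (at x) v)"
      using Suc by auto
  qed (simp add: frechet_derivative_eqI[OF d])
  then show ?case using d by (auto simp: differentiable_def)
qed

lemma Ck_on_sum:
  assumes "open S" "\<And>i. i \<in> I \<Longrightarrow> Ck_on k S (f i)"
  shows "Ck_on k S (\<lambda>x. \<Sum>i\<in>I. f i x)"
  using assms(2)
  by (induction I rule: infinite_finite_induct) (auto intro: Ck_on_const Ck_on_add[OF assms(1)])

lemma Ck_on_bilinear: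
  assumes "open S" "bounded_bilinear P" "Ck_on k S f" "Ck_on k S g"
  shows "Ck_on k S (\<lambda>x. P (f x) (g x))"
  using assms(3,4)
proof (induction k arbitrary: f g)
  case 0
  then show ?case
    using bounded_bilinear.continuous_on[OF assms(2)] by simp
next
  case (Suc k)
  have d: "((\<lambda>x. P (f x) (g x)) has_derivative
      (\<lambda>v. P (f x) (frechet_derivative g (at x) v) + P (frechet_derivative f (at x) v) (g x))) (at x)"
    if "x \<in> S" for x
    using Suc.prems that
    by (intro bounded_bilinear.FDERIV[OF assms(2)]) (auto simp: frechet_derivative_works[symmetric])
  have "Ck_on k S (\<lambda>x. frechet_derivative (\<lambda>x. P (f x) (g x)) (at x) v)" for v
  proof (rule Ck_on_cong[OF assms(1)])
    show "Ck_on k S (\<lambda>x. P (f x) (frechet_derivative g (at x) v) + P (frechet_derivative f (at x) v) (g x))"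
      using Suc.prems Ck_on_SucD[OF Suc.prems(1)] Ck_on_SucD[OF Suc.prems(2)]
      by (intro Ck_on_add assms Suc.IH) auto
  qed (simp add: frechet_derivative_eqI[OF d])
  then show ?case using d by (auto simp: differentiable_def)
qed

text \<open>\<open>Ck_on\<close> controls derivatives in fixed directions only; the expansion trades
  a direction that varies with the point for finitely many fixed ones.\<close>

lemma frechet_derivative_Basis_sum:
  fixes f :: "'a::euclidean_space \<Rightarrow> 'b::real_normed_vector"
  assumes "f differentiable (at x)"
  shows "frechet_derivative f (at x) v = (\<Sum>b\<in>Basis. (v \<bullet> b) *\<^sub>R frechet_derivative f (at x) b)"
proof -
  have "linear (frechet_derivative f (at x))"
    using assms linear_frechet_derivative by blast
  then have "frechet_derivative f (at x) (\<Sum>b\<in>Basis. (v \<bullet> b) *\<^sub>R b) =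
      (\<Sum>b\<in>Basis. (v \<bullet> b) *\<^sub>R frechet_derivative f (at x) b)"
    by (simp add: linear_sum linear_cmul)
  then show ?thesis by (simp add: euclidean_representation)
qed

text \<open>By the chain rule \<open>g\<close> is differentiated in the direction Df(x) v, which
  moves with x. After expansion in \<open>Basis\<close> each summand is a C^k coefficient times a
  derivative of \<open>g\<close> in a fixed direction, composed with \<open>f\<close>. The induction
  hypothesis applies to the latter, which is why \<open>g\<close> varies in the induction.\<close>

lemma Ck_on_compose:
  fixes f :: "'a::euclidean_space \<Rightarrow> 'b::euclidean_space" and g :: "'b \<Rightarrow> 'c::real_normed_vector"
  assumes "open S" "open T" "f ` S \<subseteq> T" "Ck_on k S f" "Ck_on k T g"
  shows "Ck_on k S (\<lambda>x. g (f x))"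
  using assms(4,5)
proof (induction k arbitrary: g)
  case 0
  then show ?case
    using assms(3) by (auto intro: continuous_on_compose2)
next
  case (Suc k)
  have fT: "f x \<in> T" if "x \<in> S" for x using assms(3) that by auto
  have d: "((\<lambda>x. g (f x)) has_derivative
      (\<lambda>v. frechet_derivative g (at (f x)) (frechet_derivative f (at x) v))) (at x)"
    if "x \<in> S" for x
  proof -
    have "(f has_derivative frechet_derivative f (at x)) (at x)"
      and "(g has_derivative frechet_derivative g (at (f x))) (at (f x))"
      using Suc.prems that fT[OF that] by (auto simp: frechet_derivative_works[symmetric])
    from diff_chain_at[OF this] show ?thesis by (simp add: o_def)
  qed
  have "Ck_on k S (\<lambda>x. frechet_derivative (\<lambda>x. g (f x)) (at x) v)" for v
  proof (rule Ck_on_cong[OF assms(1)])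
    have f: "Ck_on k S f" by (rule Ck_on_SucD[OF Suc.prems(1)])
    show "Ck_on k S (\<lambda>x. \<Sum>b\<in>Basis. (frechet_derivative f (at x) v \<bullet> b) *\<^sub>R frechet_derivative g (at (f x)) b)"
      using Suc.prems f
      by (intro Ck_on_sum assms(1) Ck_on_bilinear[OF assms(1) bounded_bilinear_scaleR]
          Ck_on_bilinear[OF assms(1) bounded_bilinear_inner] Ck_on_const
          Suc.IH[where g = "\<lambda>y. frechet_derivative g (at y) b" for b]) auto
    fix x assume x: "x \<in> S"
    then have "g differentiable (at (f x))" using Suc.prems fT by auto
    then show "(\<Sum>b\<in>Basis. (frechet_derivative f (at x) v \<bullet> b) *\<^sub>R frechet_derivative g (at (f x)) b) =
        frechet_derivative (\<lambda>x. g (f x)) (at x) v"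
      unfolding frechet_derivative_eqI[OF d[OF x]] by (rule frechet_derivative_Basis_sum[symmetric])
  qed
  then show ?case using d by (auto simp: differentiable_def)
qed

lemma smooth_on_cong:
  "open S \<Longrightarrow> (\<And>x. x \<in> S \<Longrightarrow> f x = g x) \<Longrightarrow> smooth_on S f \<Longrightarrow> smooth_on S g"
  unfolding smooth_on_def by (intro allI Ck_on_cong[of S f g]) auto

lemma smooth_on_subset: "smooth_on S f \<Longrightarrow> T \<subseteq> S \<Longrightarrow> smooth_on T f"
  unfolding smooth_on_def by (intro allI Ck_on_subset[of _ S f T]) auto

lemma smooth_on_local:
  assumes "\<And>x. x \<in> S \<Longrightarrow> \<exists>T. open T \<and> x \<in> T \<and> smooth_on T f"
  shows "smooth_on S f"
  unfolding smooth_on_def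
proof (intro allI Ck_on_local)
  fix k x assume "x \<in> S"
  then show "\<exists>T. open T \<and> x \<in> T \<and> Ck_on k T f"
    using assms[of x] unfolding smooth_on_def by blast
qed

lemma smooth_on_const: "smooth_on S (\<lambda>x. c)"
  by (simp add: smooth_on_def Ck_on_const)

lemma smooth_on_bounded_linear: "bounded_linear L \<Longrightarrow> smooth_on S L"
  by (simp add: smooth_on_def Ck_on_bounded_linear)

lemma smooth_on_add:
  "open S \<Longrightarrow> smooth_on S f \<Longrightarrow> smooth_on S g \<Longrightarrow> smooth_on S (\<lambda>x. f x + g x)"
  by (simp add: smooth_on_def Ck_on_add)

lemma smooth_on_bilinear:
  "open S \<Longrightarrow> bounded_bilinear P \<Longrightarrow> smooth_on S f \<Longrightarrow> smooth_on S g \<Longrightarrow> smooth_on S (\<lambda>x. P (f x) (g x))"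
  unfolding smooth_on_def by (rule allI, rule Ck_on_bilinear) auto

lemmas smooth_on_mult = smooth_on_bilinear[OF _ bounded_bilinear_mult]
  and smooth_on_scaleR = smooth_on_bilinear[OF _ bounded_bilinear_scaleR]
  and smooth_on_inner = smooth_on_bilinear[OF _ bounded_bilinear_inner]

lemma smooth_on_sum:
  "open S \<Longrightarrow> (\<And>i. i \<in> I \<Longrightarrow> smooth_on S (f i)) \<Longrightarrow> smooth_on S (\<lambda>x. \<Sum>i\<in>I. f i x)"
  by (simp add: smooth_on_def Ck_on_sum)

lemma smooth_on_compose:
  fixes f :: "'a::euclidean_space \<Rightarrow> 'b::euclidean_space"
  shows "open S \<Longrightarrow> open T \<Longrightarrow> f ` S \<subseteq> T \<Longrightarrow> smooth_on S f \<Longrightarrow> smooth_on T g \<Longrightarrow>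
    smooth_on S (\<lambda>x. g (f x))"
  unfolding smooth_on_def by (rule allI, rule Ck_on_compose[of S T f]) auto

lemma smooth_on_differentiable: "smooth_on S f \<Longrightarrow> x \<in> S \<Longrightarrow> f differentiable (at x)"
  unfolding smooth_on_def by (drule spec[of _ "Suc 0"]) simp

lemma smooth_on_has_derivative:
  "smooth_on S f \<Longrightarrow> x \<in> S \<Longrightarrow> (f has_derivative frechet_derivative f (at x)) (at x)"
  by (simp only: frechet_derivative_works[symmetric] smooth_on_differentiable)

text \<open>The moving direction \<open>w\<close> is what occurs when a vector field differentiates
  a function, and when the coordinates of a field are transformed by the Jacobian of a change of
  charts.\<close>

lemma smooth_on_frechet_derivative:
  fixes f :: "'a::euclidean_space \<Rightarrow> 'b::real_normed_vector"
  assumes "open S" "smooth_on S f" "smooth_on S w"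
  shows "smooth_on S (\<lambda>x. frechet_derivative f (at x) (w x))"
proof (rule smooth_on_cong[OF assms(1)])
  have "smooth_on S (\<lambda>x. frechet_derivative f (at x) b)" for b
    unfolding smooth_on_def
  proof
    fix k show "Ck_on k S (\<lambda>x. frechet_derivative f (at x) b)"
      using assms(2) unfolding smooth_on_def by (auto dest!: spec[of _ "Suc k"])
  qed
  then show "smooth_on S (\<lambda>x. \<Sum>b\<in>Basis. (w x \<bullet> b) *\<^sub>R frechet_derivative f (at x) b)"
    by (intro smooth_on_sum assms smooth_on_scaleR smooth_on_inner smooth_on_const)
  show "\<And>x. x \<in> S \<Longrightarrow> (\<Sum>b\<in>Basis. (w x \<bullet> b) *\<^sub>R frechet_derivative f (at x) b) =
      frechet_derivative f (at x) (w x)"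
    by (rule frechet_derivative_Basis_sum[symmetric, OF smooth_on_differentiable[OF assms(2)]])
qed

text \<open>The derivative is a polynomial in the function itself, so the induction on the order
  closes.\<close>

lemma smooth_on_inverse: "smooth_on {0<..} (inverse :: real \<Rightarrow> real)"
proof -
  have d: "((inverse :: real \<Rightarrow> real) has_derivative (\<lambda>v. - (inverse x * v * inverse x))) (at x)" if "x > 0" for x
    using that by (auto intro: has_derivative_inverse')
  have "Ck_on k {0<..} (inverse :: real \<Rightarrow> real)" for k
  proof (induction k)
    case 0
    show ?case by (auto intro!: continuous_intros)
  next
    case (Suc k)
    have "Ck_on k {0<..} (\<lambda>x. frechet_derivative inverse (at x) v)" for v :: real
    proof (rule Ck_on_cong)
      show "Ck_on k {0<..} (\<lambda>x::real. (- v) * (inverse x * inverse x))"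
        by (intro Ck_on_bilinear[OF _ bounded_bilinear_mult] Ck_on_const Suc) auto
      show "(- v) * (inverse x * inverse x) = frechet_derivative inverse (at x) v"
        if "x \<in> {0<..}" for x
        using frechet_derivative_eqI[OF d[of x]] that by simp
    qed auto
    then show ?case using d by (auto simp: differentiable_def)
  qed
  then show ?thesis by (simp add: smooth_on_def)
qed

text \<open>The derivative is a multiple of the inverse of the square root, of class C^k by the
  preceding lemma and the induction hypothesis. Inverse and root together normalise vectors in the
  Gram-Schmidt process.\<close>

lemma smooth_on_sqrt: "smooth_on {0<..} sqrt"
proof -
  have d: "(sqrt has_derivative (\<lambda>v. v * (inverse (sqrt x) / 2))) (at x)" if "x > 0" for x
    by (rule has_derivative_eq_rhs[OF DERIV_real_sqrt[OF that, unfolded has_field_derivative_def]])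
      (simp add: fun_eq_iff)
  have "Ck_on k {0<..} sqrt" for k
  proof (induction k)
    case 0
    show ?case by (auto intro!: continuous_intros)
  next
    case (Suc k)
    have "Ck_on k {0<..} (\<lambda>x. frechet_derivative sqrt (at x) v)" for v :: real
    proof (rule Ck_on_cong)
      have "Ck_on k {0<..} (\<lambda>x. inverse (sqrt x))"
        using smooth_on_inverse Suc
        by (auto simp: smooth_on_def intro: Ck_on_compose[where T = "{0<..}" and f = sqrt and g = inverse])
      then show "Ck_on k {0<..} (\<lambda>x::real. (v / 2) * inverse (sqrt x))"
        by (intro Ck_on_bilinear[OF _ bounded_bilinear_mult] Ck_on_const Suc) auto
      show "(v / 2) * inverse (sqrt x) = frechet_derivative sqrt (at x) v"
        if "x \<in> {0<..}" for x
        using frechet_derivative_eqI[OF d[of x]] that by simp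
    qed auto
    then show ?case using d by (auto simp: differentiable_def)
  qed
  then show ?thesis by (simp add: smooth_on_def)
qed

section \<open>Functions and vector fields on a manifold\<close>

locale smooth_mfd =
  fixes M :: "('m::{t2_space,second_countable_topology}, 'e::euclidean_space) manifold"
  assumes smooth_manifold: "smooth_manifold M"
begin

abbreviation "cd \<equiv> chart_dom M"
abbreviation "ch \<equiv> chart_map M"
abbreviation "ich \<equiv> chart_inv M"
abbreviation "tr q r x \<equiv> frechet_derivative (ch r \<circ> ich q) (at x)"

lemma mem_cd [simp, intro]: "p \<in> cd p"
  and open_cd [simp, intro]: "open (cd p)"
  and open_ch_cd: "open (ch p ` cd p)"
  and homeo: "homeomorphism (cd p) (ch p ` cd p) (ch p) (ich p)"
  and trans_smooth: "smooth_on (ch q ` (cd q \<inter> cd r)) (ch r \<circ> ich q)"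
  using smooth_manifold unfolding smooth_manifold_def by blast+

lemma ich_ch [simp]: "p \<in> cd q \<Longrightarrow> ich q (ch q p) = p"
  by (rule homeomorphism_apply1[OF homeo])

lemma ch_ich: "x \<in> ch q ` cd q \<Longrightarrow> ch q (ich q x) = x"
  by (rule homeomorphism_apply2[OF homeo])

lemma open_ch_image: "open U \<Longrightarrow> open (ch q ` (U \<inter> cd q))"
  using homeomorphism_imp_open_map[OF homeo, of q "U \<inter> cd q"] open_ch_cd[of q]
  by (auto simp: openin_open_eq open_Int)

lemma trans_has_derivative:
  assumes "p \<in> cd q" "p \<in> cd r"
  shows "((ch r \<circ> ich q) has_derivative tr q r (ch q p)) (at (ch q p))"
  using smooth_on_has_derivative[OF trans_smooth] assms by blast

text \<open>The factorisation of \<open>h \<circ> ich q\<close> through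
  \<open>ch r \<circ> ich q\<close> holds only over the overlap of the two charts; its image is
  open, so the chain rule applies there.\<close>

lemma change_of_chart:
  fixes h :: "'m \<Rightarrow> 'b::real_normed_vector"
  assumes "p \<in> cd q" "p \<in> cd r" "(h \<circ> ich r) differentiable (at (ch r p))"
  shows "frechet_derivative (h \<circ> ich q) (at (ch q p)) v =
    frechet_derivative (h \<circ> ich r) (at (ch r p)) (tr q r (ch q p) v)"
proof -
  let ?S = "ch q ` (cd r \<inter> cd q)"
  have S: "open ?S" "ch q p \<in> ?S"
    using open_ch_image[of "cd r" q] assms by auto
  have d: "((h \<circ> ich r) has_derivative frechet_derivative (h \<circ> ich r) (at (ch r p)))
      (at ((ch r \<circ> ich q) (ch q p)))"
    using assms by (simp add: frechet_derivative_works[symmetric])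
  have "frechet_derivative (h \<circ> ich q) (at (ch q p)) =
      frechet_derivative ((h \<circ> ich r) \<circ> (ch r \<circ> ich q)) (at (ch q p))"
    by (rule frechet_derivative_cong_open[OF S]) auto
  also have "\<dots> = frechet_derivative (h \<circ> ich r) (at (ch r p)) \<circ> tr q r (ch q p)"
    by (rule frechet_derivative_eqI[OF diff_chain_at[OF trans_has_derivative[OF assms(1,2)] d]])
  finally show ?thesis by simp
qed

text \<open>The case \<open>h = ch c\<close> of the change of charts. Through
  \<open>dchart_eq\<close> it relates the coordinates of one tangent vector in different
  charts.\<close>

lemma tr_cocycle:
  assumes "p \<in> cd a" "p \<in> cd b" "p \<in> cd c"
  shows "tr b c (ch b p) (tr a b (ch a p) v) = tr a c (ch a p) v"
  using change_of_chart[OF assms(1,2) differentiableI[OF trans_has_derivative[OF assms(2,3)]], of v] by simp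

lemma tr_self [simp]: "p \<in> cd a \<Longrightarrow> tr a a (ch a p) v = v"
proof -
  assume p: "p \<in> cd a"
  have "frechet_derivative (ch a \<circ> ich a) (at (ch a p)) = frechet_derivative (\<lambda>x. x) (at (ch a p))"
    using p by (intro frechet_derivative_cong_open[OF open_ch_cd[of a]]) (auto simp: ch_ich)
  then show ?thesis by simp
qed

lemma dchart_eq: "dchart M q p v = tr p q (ch p p) v"
  by (simp add: dchart_def)

lemma linear_dchart: "p \<in> cd q \<Longrightarrow> linear (dchart M q p)"
  using trans_has_derivative[of p p q] has_derivative_linear
  by (auto simp: dchart_def[abs_def])

lemma dchart_inj: "p \<in> cd q \<Longrightarrow> dchart M q p v = dchart M q p w \<Longrightarrow> v = w"
  using tr_cocycle[of p p q p] by (metis dchart_eq mem_cd tr_self)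

text \<open>The coordinate field of the chart indexed by \<open>q\<close> with constant coordinates \<open>b\<close>.\<close>

definition cfield :: "'m \<Rightarrow> 'e \<Rightarrow> 'm \<Rightarrow> 'e" where
  "cfield q b p = tr q p (ch q p) b"

lemma dchart_cfield: "p \<in> cd q \<Longrightarrow> dchart M q p (cfield q b p) = b"
  using tr_cocycle[of p q p q b] by (simp add: cfield_def dchart_eq)

lemma cfield_self [simp]: "cfield p b p = b"
  by (simp add: cfield_def)

lemma smooth_fun_cong: "open U \<Longrightarrow> (\<And>p. p \<in> U \<Longrightarrow> h p = k p) \<Longrightarrow> smooth_fun M U h \<Longrightarrow> smooth_fun M U k"
  unfolding smooth_fun_def
  by (rule allI, rule smooth_on_cong[OF open_ch_image, where f = "h \<circ> ich _"]) auto

lemma vector_field_cong: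
  "open U \<Longrightarrow> (\<And>p. p \<in> U \<Longrightarrow> X p = Y p) \<Longrightarrow> vector_field M U X \<Longrightarrow> vector_field M U Y"
  unfolding vector_field_def
  by (rule allI, rule smooth_on_cong[OF open_ch_image, where f = "\<lambda>x. dchart M _ (ich _ x) (X (ich _ x))"]) auto

lemma smooth_fun_subset: "smooth_fun M U h \<Longrightarrow> V \<subseteq> U \<Longrightarrow> smooth_fun M V h"
  unfolding smooth_fun_def by (blast intro: smooth_on_subset)

lemma vector_field_subset: "vector_field M U X \<Longrightarrow> V \<subseteq> U \<Longrightarrow> vector_field M V X"
  unfolding vector_field_def by (blast intro: smooth_on_subset)

lemma smooth_fun_local:
  assumes "\<And>p. p \<in> U \<Longrightarrow> \<exists>V. open V \<and> p \<in> V \<and> smooth_fun M V h"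
  shows "smooth_fun M U h"
  unfolding smooth_fun_def
proof (intro allI smooth_on_local)
  fix q x assume "x \<in> ch q ` (U \<inter> cd q)"
  then obtain p where p: "p \<in> U" "p \<in> cd q" "x = ch q p" by auto
  with assms obtain V where "open V" "p \<in> V" "smooth_fun M V h" by blast
  then show "\<exists>T. open T \<and> x \<in> T \<and> smooth_on T (h \<circ> ich q)"
    using p open_ch_image[of V q] unfolding smooth_fun_def by blast
qed

lemma vector_field_local:
  assumes "\<And>p. p \<in> U \<Longrightarrow> \<exists>V. open V \<and> p \<in> V \<and> vector_field M V X"
  shows "vector_field M U X"
  unfolding vector_field_def
proof (intro allI smooth_on_local)
  fix q x assume "x \<in> ch q ` (U \<inter> cd q)"
  then obtain p where p: "p \<in> U" "p \<in> cd q" "x = ch q p" by auto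
  with assms obtain V where "open V" "p \<in> V" "vector_field M V X" by blast
  then show "\<exists>T. open T \<and> x \<in> T \<and> smooth_on T (\<lambda>x. dchart M q (ich q x) (X (ich q x)))"
    using p open_ch_image[of V q] unfolding vector_field_def by blast
qed

lemma smooth_fun_chartI:
  assumes "open U" "U \<subseteq> cd q" "smooth_on (ch q ` U) (h \<circ> ich q)"
  shows "smooth_fun M U h"
  unfolding smooth_fun_def
proof
  fix r
  let ?S = "ch r ` (U \<inter> cd r)"
  have "smooth_on ?S (\<lambda>x. (h \<circ> ich q) ((ch q \<circ> ich r) x))"
  proof (rule smooth_on_compose[where T = "ch q ` U" and g = "h \<circ> ich q", OF _ _ _ _ assms(3)])
    show "open (ch q ` U)"
      using open_ch_image[OF assms(1), of q] assms(2) by (simp add: Int_absorb2)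
    show "smooth_on ?S (ch q \<circ> ich r)"
      by (rule smooth_on_subset[OF trans_smooth]) (use assms(2) in auto)
  qed (use assms open_ch_image in \<open>auto simp del: o_apply simp: o_apply[of "ch q"]\<close>)
  then show "smooth_on ?S (h \<circ> ich r)"
    by (rule smooth_on_cong[OF open_ch_image[OF assms(1)], rotated]) (use assms(2) in auto)
qed

text \<open>In any other chart the coordinates arise by applying the Jacobian of the transition map,
  itself smooth, to the given ones; so one chart whose domain contains \<open>U\<close>
  decides.\<close>

lemma vector_field_chartI:
  assumes "open U" "U \<subseteq> cd q" "smooth_on (ch q ` U) (\<lambda>x. dchart M q (ich q x) (X (ich q x)))"
  shows "vector_field M U X"
  unfolding vector_field_def
proof
  fix r
  let ?S = "ch r ` (U \<inter> cd r)" and ?T = "ch q ` (U \<inter> cd r)"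
  have T: "open ?T" using open_ch_image[of "U \<inter> cd r" q] assms(1,2) open_cd[of r]
    by (metis Int_absorb2 inf.coboundedI1 open_Int)
  have a: "smooth_on ?T (\<lambda>x. tr q r x (dchart M q (ich q x) (X (ich q x))))"
    using assms(2)
    by (intro smooth_on_frechet_derivative T smooth_on_subset[OF trans_smooth] smooth_on_subset[OF assms(3)]) auto
  have b: "smooth_on ?S (ch q \<circ> ich r)"
    by (rule smooth_on_subset[OF trans_smooth]) (use assms(2) in auto)
  have "smooth_on ?S (\<lambda>y. (\<lambda>x. tr q r x (dchart M q (ich q x) (X (ich q x)))) ((ch q \<circ> ich r) y))"
    by (rule smooth_on_compose[OF open_ch_image[OF assms(1)] T _ b a]) (use assms(2) in auto)
  then show "smooth_on ?S (\<lambda>x. dchart M r (ich r x) (X (ich r x)))"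
  proof (rule smooth_on_cong[OF open_ch_image[OF assms(1)], rotated])
    fix x assume "x \<in> ?S"
    then show "(\<lambda>x. tr q r x (dchart M q (ich q x) (X (ich q x)))) ((ch q \<circ> ich r) x) =
        dchart M r (ich r x) (X (ich r x))"
      using assms(2) tr_cocycle[of "ich r x" "ich r x" q r "X (ich r x)"] by (auto simp: dchart_eq)
  qed
qed

lemma smooth_fun_const: "smooth_fun M U (\<lambda>p. c)"
  by (simp add: smooth_fun_def o_def smooth_on_const)

lemma smooth_fun_add: "open U \<Longrightarrow> smooth_fun M U h \<Longrightarrow> smooth_fun M U k \<Longrightarrow> smooth_fun M U (\<lambda>p. h p + k p)"
  unfolding smooth_fun_def o_def by (intro allI smooth_on_add open_ch_image) auto

lemma smooth_fun_mult: "open U \<Longrightarrow> smooth_fun M U h \<Longrightarrow> smooth_fun M U k \<Longrightarrow> smooth_fun M U (\<lambda>p. h p * k p)"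
  unfolding smooth_fun_def o_def by (intro allI smooth_on_mult open_ch_image) auto

lemma smooth_fun_minus: "open U \<Longrightarrow> smooth_fun M U h \<Longrightarrow> smooth_fun M U (\<lambda>p. - h p)"
  using smooth_fun_mult[OF _ smooth_fun_const[of U "-1"]] by simp

lemma smooth_fun_sum:
  "open U \<Longrightarrow> (\<And>i. i \<in> I \<Longrightarrow> smooth_fun M U (h i)) \<Longrightarrow> smooth_fun M U (\<lambda>p. \<Sum>i\<in>I. h i p)"
  unfolding smooth_fun_def o_def by (intro allI smooth_on_sum open_ch_image) auto

lemma smooth_fun_compose:
  assumes "open U" "smooth_fun M U h" "open T" "\<And>p. p \<in> U \<Longrightarrow> h p \<in> T" "smooth_on T (k :: real \<Rightarrow> real)"
  shows "smooth_fun M U (\<lambda>p. k (h p))"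
  unfolding smooth_fun_def o_def
proof
  fix q
  have "smooth_on (ch q ` (U \<inter> cd q)) (\<lambda>x. k ((h \<circ> ich q) x))"
    by (rule smooth_on_compose[OF open_ch_image[OF assms(1)] assms(3) _ _ assms(5)])
      (use assms(2,4) in \<open>auto simp: smooth_fun_def o_def\<close>)
  then show "smooth_on (ch q ` (U \<inter> cd q)) (\<lambda>x. k (h (ich q x)))" by simp
qed

lemma vector_field_scale:
  assumes "open U" "smooth_fun M U h" "vector_field M U X"
  shows "vector_field M U (\<lambda>p. h p *\<^sub>R X p)"
  unfolding vector_field_def
proof
  fix q
  have "smooth_on (ch q ` (U \<inter> cd q)) (\<lambda>x. (h \<circ> ich q) x *\<^sub>R dchart M q (ich q x) (X (ich q x)))"
    using assms unfolding smooth_fun_def vector_field_def by (intro smooth_on_scaleR open_ch_image) (auto simp: o_def)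
  then show "smooth_on (ch q ` (U \<inter> cd q)) (\<lambda>x. dchart M q (ich q x) (h (ich q x) *\<^sub>R X (ich q x)))"
    by (rule smooth_on_cong[OF open_ch_image[OF assms(1)], rotated])
      (auto simp: linear_cmul[OF linear_dchart])
qed

lemma vector_field_add:
  assumes "open U" "vector_field M U X" "vector_field M U Y"
  shows "vector_field M U (\<lambda>p. X p + Y p)"
  unfolding vector_field_def
proof
  fix q
  have "smooth_on (ch q ` (U \<inter> cd q)) (\<lambda>x. dchart M q (ich q x) (X (ich q x)) + dchart M q (ich q x) (Y (ich q x)))"
    using assms unfolding vector_field_def by (intro smooth_on_add open_ch_image) auto
  then show "smooth_on (ch q ` (U \<inter> cd q)) (\<lambda>x. dchart M q (ich q x) (X (ich q x) + Y (ich q x)))"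
    by (rule smooth_on_cong[OF open_ch_image[OF assms(1)], rotated])
      (auto simp: linear_add[OF linear_dchart])
qed

lemma vector_field_zero: "open U \<Longrightarrow> vector_field M U (\<lambda>p. 0)"
  unfolding vector_field_def
  by (rule allI, rule smooth_on_cong[OF open_ch_image _ smooth_on_const[where c = 0]])
    (auto simp: linear_0[OF linear_dchart])

lemma vector_field_minus: "open U \<Longrightarrow> vector_field M U X \<Longrightarrow> vector_field M U (\<lambda>p. - X p)"
  using vector_field_scale[OF _ smooth_fun_const[of U "-1"]] by simp

lemma vector_field_diff:
  "open U \<Longrightarrow> vector_field M U X \<Longrightarrow> vector_field M U Y \<Longrightarrow> vector_field M U (\<lambda>p. X p - Y p)"
  using vector_field_add[OF _ _ vector_field_minus, of U X Y] by simp

lemma vector_field_sum: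
  assumes "open U" "\<And>i. i \<in> I \<Longrightarrow> vector_field M U (X i)"
  shows "vector_field M U (\<lambda>p. \<Sum>i\<in>I. X i p)"
  using assms(2)
  by (induction I rule: infinite_finite_induct)
    (auto intro: vector_field_add vector_field_zero assms(1))

lemma vector_field_cfield: "vector_field M (cd q) (cfield q b)"
proof (rule vector_field_chartI[of _ q])
  show "smooth_on (ch q ` cd q) (\<lambda>x. dchart M q (ich q x) (cfield q b (ich q x)))"
    by (rule smooth_on_cong[OF open_ch_cd _ smooth_on_const[where c = b]]) (auto simp: dchart_cfield)
qed auto

lemma smooth_fun_components:
  assumes "open U" "U \<subseteq> cd q" "vector_field M U X"
  shows "smooth_fun M U (\<lambda>p. dchart M q p (X p) \<bullet> b)"
proof (rule smooth_fun_chartI[OF assms(1,2)])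
  have "smooth_on (ch q ` U) (\<lambda>x. dchart M q (ich q x) (X (ich q x)))"
    using assms(2,3) unfolding vector_field_def by (metis Int_absorb2)
  then show "smooth_on (ch q ` U) ((\<lambda>p. dchart M q p (X p) \<bullet> b) \<circ> ich q)"
    using open_ch_image[OF assms(1), of q] assms(2)
    by (auto simp: o_def Int_absorb2 intro!: smooth_on_inner smooth_on_const)
qed

lemma cfield_expansion:
  assumes "p \<in> cd q"
  shows "v = (\<Sum>b\<in>Basis. (dchart M q p v \<bullet> b) *\<^sub>R cfield q b p)"
proof (rule dchart_inj[OF assms])
  show "dchart M q p v = dchart M q p (\<Sum>b\<in>Basis. (dchart M q p v \<bullet> b) *\<^sub>R cfield q b p)"
    by (simp add: linear_sum[OF linear_dchart[OF assms]] linear_cmul[OF linear_dchart[OF assms]]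
        dchart_cfield[OF assms] euclidean_representation)
qed

lemma smooth_fun_differentiable:
  "smooth_fun M U h \<Longrightarrow> p \<in> U \<Longrightarrow> p \<in> cd q \<Longrightarrow> (h \<circ> ich q) differentiable (at (ch q p))"
  unfolding smooth_fun_def by (blast intro: smooth_on_differentiable)

lemma smooth_fun_has_derivative:
  "smooth_fun M U h \<Longrightarrow> p \<in> U \<Longrightarrow> ((h \<circ> ich p) has_derivative dfun M h p) (at (ch p p))"
  using smooth_fun_differentiable[of U h p p]
  by (simp add: dfun_def[abs_def] frechet_derivative_works[symmetric])

lemma dfun_eqI: "((h \<circ> ich p) has_derivative d) (at (ch p p)) \<Longrightarrow> dfun M h p v = d v"
  by (simp add: dfun_def frechet_derivative_eqI)

lemma linear_dfun: "smooth_fun M U h \<Longrightarrow> p \<in> U \<Longrightarrow> linear (dfun M h p)"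
  using smooth_fun_has_derivative has_derivative_linear by blast

lemma dfun_cong:
  assumes "open U" "p \<in> U" "\<And>q. q \<in> U \<Longrightarrow> h q = k q"
  shows "dfun M h p v = dfun M k p v"
  unfolding dfun_def
  by (subst frechet_derivative_cong_open[OF open_ch_image[OF assms(1), of p]])
    (use assms in auto)

lemma dfun_const: "dfun M (\<lambda>q. c) p v = 0"
  by (rule trans[OF dfun_eqI[of _ _ "\<lambda>v. 0"]]) (auto simp: o_def)

lemma dfun_add:
  assumes "smooth_fun M U h" "smooth_fun M U k" "p \<in> U"
  shows "dfun M (\<lambda>q. h q + k q) p v = dfun M h p v + dfun M k p v"
  using has_derivative_add[OF smooth_fun_has_derivative[OF assms(1,3)] smooth_fun_has_derivative[OF assms(2,3)]]
  by (intro dfun_eqI[of "\<lambda>q. h q + k q"]) (simp add: o_def)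

lemma dfun_mult:
  assumes "smooth_fun M U h" "smooth_fun M U k" "p \<in> U"
  shows "dfun M (\<lambda>q. h q * k q) p v = h p * dfun M k p v + dfun M h p v * k p"
  using has_derivative_mult[OF smooth_fun_has_derivative[OF assms(1,3)] smooth_fun_has_derivative[OF assms(2,3)]]
  by (intro dfun_eqI[of "\<lambda>q. h q * k q"]) (simp add: o_def)

lemma dfun_minus:
  assumes "smooth_fun M U h" "p \<in> U"
  shows "dfun M (\<lambda>q. - h q) p v = - dfun M h p v"
  using dfun_mult[OF smooth_fun_const[of U "-1"] assms] by (simp add: dfun_const)

lemma dfun_diff:
  assumes "open U" "smooth_fun M U h" "smooth_fun M U k" "p \<in> U"
  shows "dfun M (\<lambda>q. h q - k q) p v = dfun M h p v - dfun M k p v"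
  using dfun_add[OF assms(2) smooth_fun_minus[OF assms(1,3)] assms(4)] dfun_minus[OF assms(3,4)] by simp

lemma dfun_inverse:
  assumes "open U" "smooth_fun M U h" "p \<in> U" "h p \<noteq> 0"
  shows "dfun M (\<lambda>q. inverse (h q)) p v = - (dfun M h p v / (h p)\<^sup>2)"
  using Deriv.has_derivative_inverse[OF _ smooth_fun_has_derivative[OF assms(2,3)]] assms(4)
  by (intro trans[OF dfun_eqI[of "\<lambda>q. inverse (h q)"]])
    (auto simp: o_def divide_simps power2_eq_square)

lemma dfun_chart:
  assumes "smooth_fun M U h" "p \<in> U" "p \<in> cd q"
  shows "dfun M h p v = frechet_derivative (h \<circ> ich q) (at (ch q p)) (dchart M q p v)"
  using change_of_chart[of p p q h v] smooth_fun_differentiable[OF assms] assms(3)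
  by (simp add: dfun_def dchart_eq)

lemma smooth_fun_dfun:
  assumes "open U" "smooth_fun M U h" "vector_field M U X"
  shows "smooth_fun M U (\<lambda>p. dfun M h p (X p))"
  unfolding smooth_fun_def
proof
  fix q
  let ?S = "ch q ` (U \<inter> cd q)"
  have "smooth_on ?S (\<lambda>x. frechet_derivative (h \<circ> ich q) (at x) (dchart M q (ich q x) (X (ich q x))))"
    using assms unfolding smooth_fun_def vector_field_def
    by (intro smooth_on_frechet_derivative open_ch_image) (auto simp: o_def)
  then show "smooth_on ?S ((\<lambda>p. dfun M h p (X p)) \<circ> ich q)"
  proof (rule smooth_on_cong[OF open_ch_image[OF assms(1)], rotated])
    fix x assume "x \<in> ?S"
    then show "frechet_derivative (h \<circ> ich q) (at x) (dchart M q (ich q x) (X (ich q x))) =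
        ((\<lambda>p. dfun M h p (X p)) \<circ> ich q) x"
      using dfun_chart[OF assms(2)] by auto
  qed
qed

lemma smooth_fun_coordinate: "smooth_fun M (cd q) (\<lambda>p. ch q p \<bullet> b)"
proof (rule smooth_fun_chartI[of _ q])
  show "smooth_on (ch q ` cd q) ((\<lambda>p. ch q p \<bullet> b) \<circ> ich q)"
    by (rule smooth_on_cong[OF open_ch_cd _ smooth_on_bounded_linear[OF bounded_linear_inner_left[of b]]])
      (auto simp: ch_ich)
qed auto

lemma dfun_coordinate: "dfun M (\<lambda>q. ch p q \<bullet> b) p v = v \<bullet> b"
proof -
  have "dfun M (\<lambda>q. ch p q \<bullet> b) p v = frechet_derivative (\<lambda>x. x \<bullet> b) (at (ch p p)) v"
    unfolding dfun_def
    by (subst frechet_derivative_cong_open[OF open_ch_cd[of p]]) (auto simp: ch_ich)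
  also have "\<dots> = v \<bullet> b"
    by (subst frechet_derivative_eqI[OF bounded_linear_imp_has_derivative[OF bounded_linear_inner_left]]) simp
  finally show ?thesis .
qed

text \<open>Tangent vectors at \<open>p\<close> are stored as coordinates in the chart indexed by
  \<open>p\<close>, so the coordinate functions of that chart separate them. This turns identities
  between derivations, such as freeness of torsion, into identities between vectors.\<close>

lemma vector_eqI_dfun:
  assumes "\<And>b. b \<in> Basis \<Longrightarrow> dfun M (\<lambda>q. ch p q \<bullet> b) p v = dfun M (\<lambda>q. ch p q \<bullet> b) p w"
  shows "v = w"
  by (rule euclidean_eqI) (use assms in \<open>simp add: dfun_coordinate\<close>)

end

section \<open>Riemannian manifolds with their Levi-Civita connection\<close>

definition field_module ::
  "('m::topological_space, 'e::euclidean_space) manifold \<Rightarrow> 'm set \<Rightarrow> (('m \<Rightarrow> 'e) \<Rightarrow> bool) \<Rightarrow> bool" where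
  "field_module M U Sec \<longleftrightarrow> open U \<and> Sec (\<lambda>q. 0) \<and> (\<forall>X. Sec X \<longrightarrow> vector_field M U X) \<and>
     (\<forall>X Y. Sec X \<longrightarrow> Sec Y \<longrightarrow> Sec (\<lambda>q. X q + Y q)) \<and>
     (\<forall>h X. smooth_fun M U h \<longrightarrow> Sec X \<longrightarrow> Sec (\<lambda>q. h q *\<^sub>R X q))"

text \<open>The third clause is locality: \<open>T\<close> receives total functions, whose values
  off \<open>U\<close> carry no meaning.\<close>

definition tensorial ::
  "('m::topological_space, 'e::euclidean_space) manifold \<Rightarrow> 'm set \<Rightarrow> (('m \<Rightarrow> 'e) \<Rightarrow> bool) \<Rightarrow> 'm \<Rightarrow>
     (('m \<Rightarrow> 'e) \<Rightarrow> 'v::real_vector) \<Rightarrow> bool" where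
  "tensorial M U Sec p T \<longleftrightarrow>
     (\<forall>X Y. Sec X \<longrightarrow> Sec Y \<longrightarrow> T (\<lambda>q. X q + Y q) = T X + T Y) \<and>
     (\<forall>h X. smooth_fun M U h \<longrightarrow> Sec X \<longrightarrow> T (\<lambda>q. h q *\<^sub>R X q) = h p *\<^sub>R T X) \<and>
     (\<forall>X Y. Sec X \<longrightarrow> Sec Y \<longrightarrow> (\<forall>q\<in>U. X q = Y q) \<longrightarrow> T X = T Y)"

lemma tensorialI:
  assumes "\<And>X Y. Sec X \<Longrightarrow> Sec Y \<Longrightarrow> T (\<lambda>q. X q + Y q) = T X + T Y"
    and "\<And>h X. smooth_fun M U h \<Longrightarrow> Sec X \<Longrightarrow> T (\<lambda>q. h q *\<^sub>R X q) = h p *\<^sub>R T X"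
    and "\<And>X Y. Sec X \<Longrightarrow> Sec Y \<Longrightarrow> (\<And>q. q \<in> U \<Longrightarrow> X q = Y q) \<Longrightarrow> T X = T Y"
  shows "tensorial M U Sec p T"
  unfolding tensorial_def using assms(1,2) by (auto intro!: assms(3))

lemma tensorial_cong:
  "tensorial M U Sec p T \<Longrightarrow> Sec X \<Longrightarrow> Sec Y \<Longrightarrow> (\<And>q. q \<in> U \<Longrightarrow> X q = Y q) \<Longrightarrow> T X = T Y"
  unfolding tensorial_def by blast

context smooth_mfd
begin

lemma field_module_vector_fields: "open U \<Longrightarrow> field_module M U (vector_field M U)"
  by (auto simp: field_module_def intro: vector_field_zero vector_field_add vector_field_scale)

lemma field_module_sum:
  assumes "field_module M U Sec" "\<And>i. i \<in> I \<Longrightarrow> smooth_fun M U (h i)" "\<And>i. i \<in> I \<Longrightarrow> Sec (X i)"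
  shows "Sec (\<lambda>q. \<Sum>i\<in>I. h i q *\<^sub>R X i q)"
  using assms(2,3)
proof (induction I rule: infinite_finite_induct)
  case (insert i I)
  have "Sec (\<lambda>q. h i q *\<^sub>R X i q)" "Sec (\<lambda>q. \<Sum>i\<in>I. h i q *\<^sub>R X i q)"
    using assms(1) insert by (auto simp: field_module_def)
  then have "Sec (\<lambda>q. h i q *\<^sub>R X i q + (\<Sum>i\<in>I. h i q *\<^sub>R X i q))"
    using assms(1) unfolding field_module_def by blast
  then show ?case using insert by simp
qed (use assms(1) in \<open>auto simp: field_module_def\<close>)

lemma tensorial_sum:
  assumes "field_module M U Sec" "tensorial M U Sec p T"
    "\<And>i. i \<in> I \<Longrightarrow> smooth_fun M U (h i)" "\<And>i. i \<in> I \<Longrightarrow> Sec (X i)"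
  shows "T (\<lambda>q. \<Sum>i\<in>I. h i q *\<^sub>R X i q) = (\<Sum>i\<in>I. h i p *\<^sub>R T (X i))"
proof -
  \<comment> \<open>The zero field is the constant function 0 times itself, so homogeneity settles
    the empty sum.\<close>
  have 0: "T (\<lambda>q. 0) = 0"
  proof -
    have "T (\<lambda>q. (\<lambda>q. 0) q *\<^sub>R (\<lambda>q. 0) q) = (\<lambda>q. 0) p *\<^sub>R T (\<lambda>q. 0)"
      using assms(1,2) smooth_fun_const[of U 0] unfolding field_module_def tensorial_def by blast
    then show ?thesis by simp
  qed
  show ?thesis
    using assms(3,4)
  proof (induction I rule: infinite_finite_induct)
    case (insert i I)
    have s: "Sec (\<lambda>q. h i q *\<^sub>R X i q)" "Sec (\<lambda>q. \<Sum>i\<in>I. h i q *\<^sub>R X i q)"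
      using assms(1) insert field_module_sum[OF assms(1), of I h X] by (auto simp: field_module_def)
    have "T (\<lambda>q. (\<lambda>q. h i q *\<^sub>R X i q) q + (\<lambda>q. \<Sum>i\<in>I. h i q *\<^sub>R X i q) q) =
        T (\<lambda>q. h i q *\<^sub>R X i q) + T (\<lambda>q. \<Sum>i\<in>I. h i q *\<^sub>R X i q)"
      using assms(2) s unfolding tensorial_def by blast
    moreover have "T (\<lambda>q. h i q *\<^sub>R X i q) = h i p *\<^sub>R T (X i)"
      using assms(2) insert unfolding tensorial_def by auto
    ultimately show ?case using insert by simp
  qed (simp_all add: 0)
qed

text \<open>The tool for passing from arbitrary fields to a frame: of the coefficient functions only
  the values at \<open>p\<close> survive.\<close>

lemma tensorial_expand:
  assumes "field_module M U Sec" "tensorial M U Sec p T" "Sec X"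
    "\<And>i. i \<in> I \<Longrightarrow> smooth_fun M U (h i)" "\<And>i. i \<in> I \<Longrightarrow> Sec (F i)"
    "\<And>q. q \<in> U \<Longrightarrow> X q = (\<Sum>i\<in>I. h i q *\<^sub>R F i q)"
  shows "T X = (\<Sum>i\<in>I. h i p *\<^sub>R T (F i))"
proof -
  have "T X = T (\<lambda>q. \<Sum>i\<in>I. h i q *\<^sub>R F i q)"
    by (rule tensorial_cong[OF assms(2,3) field_module_sum[OF assms(1,4,5)] assms(6)])
  also have "\<dots> = (\<Sum>i\<in>I. h i p *\<^sub>R T (F i))"
    by (rule tensorial_sum[OF assms(1,2,4,5)])
  finally show ?thesis .
qed

end

locale riemannian_lc =
  fixes M :: "('m::{t2_space,second_countable_topology}, 'e::euclidean_space) manifold"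
    and g :: "'m \<Rightarrow> 'e \<Rightarrow> 'e \<Rightarrow> real" and D :: "('m, 'e) connection"
  assumes riemannian: "riemannian_manifold M g" and levi_civita: "levi_civita M g D"

sublocale riemannian_lc \<subseteq> smooth_mfd M
  using riemannian by unfold_locales (simp add: riemannian_manifold_def)

context riemannian_lc
begin

lemma bilinear_g: "bilinear (g p)" and g_sym: "g p u v = g p v u"
  and g_pos: "u \<noteq> 0 \<Longrightarrow> 0 < g p u u"
  and smooth_fun_g: "open U \<Longrightarrow> vector_field M U X \<Longrightarrow> vector_field M U Y \<Longrightarrow> smooth_fun M U (\<lambda>p. g p (X p) (Y p))"
  using riemannian unfolding riemannian_manifold_def by blast+

lemma linear_g: "linear (g p u)" "linear (\<lambda>u. g p u v)"
  using bilinear_g[of p] by (auto simp: bilinear_def)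

lemmas g_linear [simp] =
  linear_add[OF linear_g(1)] linear_add[OF linear_g(2)] linear_diff[OF linear_g(1)] linear_diff[OF linear_g(2)]
  linear_cmul[OF linear_g(1)] linear_cmul[OF linear_g(2)] linear_neg[OF linear_g(1)] linear_neg[OF linear_g(2)]
  linear_sum[OF linear_g(1)] linear_sum[OF linear_g(2)] linear_0[OF linear_g(1)] linear_0[OF linear_g(2)]

lemma g_eqI:
  assumes "\<And>w. g p u w = g p v w"
  shows "u = v"
proof (rule ccontr)
  assume "u \<noteq> v"
  then have "0 < g p (u - v) (u - v)" by (intro g_pos) simp
  also have "g p (u - v) (u - v) = g p u (u - v) - g p v (u - v)" by (rule g_linear(4))
  also have "\<dots> = 0" by (simp only: assms diff_self)
  finally show False by (simp only: less_irrefl)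
qed

lemmas affine = levi_civita[unfolded levi_civita_def affine_connection_def, THEN conjunct1, rule_format]

lemma vector_field_nab: "open U \<Longrightarrow> vector_field M U X \<Longrightarrow> vector_field M U Y \<Longrightarrow> vector_field M U (nab D X Y)"
  and D_linear: "open U \<Longrightarrow> vector_field M U Y \<Longrightarrow> p \<in> U \<Longrightarrow> linear (\<lambda>v. D p v Y)"
  and D_cong: "open U \<Longrightarrow> vector_field M U Y \<Longrightarrow> (\<And>q. q \<in> U \<Longrightarrow> Z q = Y q) \<Longrightarrow> p \<in> U \<Longrightarrow> D p v Z = D p v Y"
  and D_add: "open U \<Longrightarrow> vector_field M U Y \<Longrightarrow> vector_field M U Z \<Longrightarrow> p \<in> U \<Longrightarrow>
     D p v (\<lambda>q. Y q + Z q) = D p v Y + D p v Z"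
  and D_scale: "open U \<Longrightarrow> smooth_fun M U h \<Longrightarrow> vector_field M U Y \<Longrightarrow> p \<in> U \<Longrightarrow>
     D p v (\<lambda>q. h q *\<^sub>R Y q) = dfun M h p v *\<^sub>R Y p + h p *\<^sub>R D p v Y"
  unfolding nab_def using affine[of U Y] by blast+

lemma dfun_bracket:
  "open U \<Longrightarrow> vector_field M U X \<Longrightarrow> vector_field M U Y \<Longrightarrow> smooth_fun M U h \<Longrightarrow> p \<in> U \<Longrightarrow>
     dfun M h p (nab D X Y p - nab D Y X p) =
       dfun M (\<lambda>q. dfun M h q (Y q)) p (X p) - dfun M (\<lambda>q. dfun M h q (X q)) p (Y p)"
  and dfun_g: "open U \<Longrightarrow> vector_field M U Y \<Longrightarrow> vector_field M U Z \<Longrightarrow> p \<in> U \<Longrightarrow>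
     dfun M (\<lambda>q. g q (Y q) (Z q)) p v = g p (D p v Y) (Z p) + g p (Y p) (D p v Z)"
  using levi_civita unfolding levi_civita_def torsion_free_def metric_connection_def by blast+

lemma D_zero: "D p v (\<lambda>q. 0) = 0"
  using D_scale[of UNIV "\<lambda>q. 0" "\<lambda>q. 0" p v] smooth_fun_const vector_field_zero
  by (simp add: dfun_const)

lemma D_cmul:
  assumes "open U" "vector_field M U Y" "p \<in> U"
  shows "D p v (\<lambda>q. c *\<^sub>R Y q) = c *\<^sub>R D p v Y"
  using D_scale[OF assms(1) smooth_fun_const[of U c] assms(2,3)] by (simp add: dfun_const)

lemma D_minus:
  assumes "open U" "vector_field M U Y" "p \<in> U"
  shows "D p v (\<lambda>q. - Y q) = - D p v Y"
  using D_cmul[OF assms, of v "-1"] by simp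

lemma D_diff:
  assumes "open U" "vector_field M U Y" "vector_field M U Z" "p \<in> U"
  shows "D p v (\<lambda>q. Y q - Z q) = D p v Y - D p v Z"
  using D_add[OF assms(1,2) vector_field_minus[OF assms(1,3)] assms(4)] D_minus[OF assms(1,3,4)] by simp

text \<open>The brackets are expressed by the connection itself.\<close>

lemma koszul:
  assumes "open U" "vector_field M U X" "vector_field M U Y" "vector_field M U Z" "p \<in> U"
  shows "2 * g p (nab D X Y p) (Z p) =
     dfun M (\<lambda>q. g q (Y q) (Z q)) p (X p) + dfun M (\<lambda>q. g q (X q) (Z q)) p (Y p)
       - dfun M (\<lambda>q. g q (X q) (Y q)) p (Z p)
     + g p (nab D X Y p - nab D Y X p) (Z p) - g p (nab D X Z p - nab D Z X p) (Y p)
     - g p (nab D Y Z p - nab D Z Y p) (X p)"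
  using dfun_g[OF assms(1,3,4,5), of "X p"] dfun_g[OF assms(1,2,4,5), of "Y p"] dfun_g[OF assms(1,2,3,5), of "Z p"]
  by (simp add: nab_def g_sym[of p "X p"] g_sym[of p "Y p"])

text \<open>By freeness of torsion this is the Lie bracket. Expressing it through \<open>D\<close>
  avoids coordinate formulas and inherits smoothness from \<open>nab\<close>.\<close>

definition bracket :: "('m \<Rightarrow> 'e) \<Rightarrow> ('m \<Rightarrow> 'e) \<Rightarrow> 'm \<Rightarrow> 'e" where
  "bracket X Y = (\<lambda>p. nab D X Y p - nab D Y X p)"

lemma vector_field_bracket:
  "open U \<Longrightarrow> vector_field M U X \<Longrightarrow> vector_field M U Y \<Longrightarrow> vector_field M U (bracket X Y)"
  unfolding bracket_def by (intro vector_field_diff vector_field_nab)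

text \<open>On a coordinate function h one has [A,[B,C]]h = ABCh - ACBh - BCAh + CBAh, and the
  twelve terms of the cyclic sum cancel in pairs. The chart domain is intersected with
  \<open>U\<close> because the coordinates of the chart are smooth there.\<close>

lemma bracket_jacobi:
  assumes U: "open U" "p \<in> U" and X: "vector_field M U X" and Y: "vector_field M U Y" and Z: "vector_field M U Z"
  shows "bracket X (bracket Y Z) p + bracket Y (bracket Z X) p + bracket Z (bracket X Y) p = 0"
proof (rule vector_eqI_dfun)
  fix b :: 'e
  let ?h = "\<lambda>q. ch p q \<bullet> b" and ?V = "U \<inter> cd p"
  have V: "open ?V" "p \<in> ?V" using U by auto
  have h: "smooth_fun M ?V ?h" by (rule smooth_fun_subset[OF smooth_fun_coordinate]) simp
  have f: "vector_field M ?V X" "vector_field M ?V Y" "vector_field M ?V Z"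
    using X Y Z by (auto intro: vector_field_subset)
  have *: "dfun M ?h p (bracket A (bracket B C) p) =
      dfun M (\<lambda>q. dfun M (\<lambda>q. dfun M ?h q (C q)) q (B q)) p (A p)
      - dfun M (\<lambda>q. dfun M (\<lambda>q. dfun M ?h q (B q)) q (C q)) p (A p)
      - dfun M (\<lambda>q. dfun M (\<lambda>q. dfun M ?h q (A q)) q (C q)) p (B p)
      + dfun M (\<lambda>q. dfun M (\<lambda>q. dfun M ?h q (A q)) q (B q)) p (C p)"
    if A: "vector_field M ?V A" and B: "vector_field M ?V B" and C: "vector_field M ?V C" for A B C
  proof -
    have s: "smooth_fun M ?V (\<lambda>q. dfun M ?h q (A q))" "smooth_fun M ?V (\<lambda>q. dfun M ?h q (B q))"
      "smooth_fun M ?V (\<lambda>q. dfun M ?h q (C q))"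
      using smooth_fun_dfun[OF V(1) h] A B C by auto
    have "dfun M ?h p (bracket A (bracket B C) p) =
       dfun M (\<lambda>q. dfun M ?h q (bracket B C q)) p (A p) - dfun M (\<lambda>q. dfun M ?h q (A q)) p (bracket B C p)"
      using dfun_bracket[OF V(1) A vector_field_bracket[OF V(1) B C] h V(2)] unfolding bracket_def .
    also have "dfun M (\<lambda>q. dfun M ?h q (bracket B C q)) p (A p) =
        dfun M (\<lambda>q. dfun M (\<lambda>q. dfun M ?h q (C q)) q (B q) - dfun M (\<lambda>q. dfun M ?h q (B q)) q (C q)) p (A p)"
      by (rule dfun_cong[OF V]) (use dfun_bracket[OF V(1) B C h] in \<open>simp add: bracket_def\<close>)
    also have "\<dots> = dfun M (\<lambda>q. dfun M (\<lambda>q. dfun M ?h q (C q)) q (B q)) p (A p)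
        - dfun M (\<lambda>q. dfun M (\<lambda>q. dfun M ?h q (B q)) q (C q)) p (A p)"
      by (rule dfun_diff[OF V(1) smooth_fun_dfun[OF V(1) s(3) B] smooth_fun_dfun[OF V(1) s(2) C] V(2)])
    also have "dfun M (\<lambda>q. dfun M ?h q (A q)) p (bracket B C p) =
        dfun M (\<lambda>q. dfun M (\<lambda>q. dfun M ?h q (A q)) q (C q)) p (B p)
        - dfun M (\<lambda>q. dfun M (\<lambda>q. dfun M ?h q (A q)) q (B q)) p (C p)"
      using dfun_bracket[OF V(1) B C s(1) V(2)] unfolding bracket_def .
    finally show ?thesis by simp
  qed
  have lin: "linear (dfun M ?h p)" by (rule linear_dfun[OF h V(2)])
  show "dfun M ?h p (bracket X (bracket Y Z) p + bracket Y (bracket Z X) p + bracket Z (bracket X Y) p) = dfun M ?h p 0"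
    using f by (simp add: linear_add[OF lin] linear_0[OF lin] *)
qed

subsection \<open>Curvature\<close>

definition curv :: "('m \<Rightarrow> 'e) \<Rightarrow> ('m \<Rightarrow> 'e) \<Rightarrow> ('m \<Rightarrow> 'e) \<Rightarrow> 'm \<Rightarrow> 'e" where
  "curv X Y Z = (\<lambda>p. nab2 D X Y Z p - nab2 D Y X Z p)"

lemma curv_antisym: "curv X Y Z p = - curv Y X Z p"
  by (simp add: curv_def)

text \<open>Linearity in the direction merges the two correction terms of \<open>nab2\<close> into
  one derivative along the bracket, which gives the usual curvature operator.\<close>

lemma curv_eq:
  assumes "open U" "p \<in> U" "vector_field M U X" "vector_field M U Y" "vector_field M U Z"
  shows "curv X Y Z p = nab D X (nab D Y Z) p - nab D Y (nab D X Z) p - nab D (bracket X Y) Z p"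
  using linear_diff[OF D_linear[OF assms(1,5,2)]]
  by (simp add: curv_def nab2_def bracket_def nab_def)

text \<open>The terms of the cyclic sum regroup into iterated brackets, so that this is the Jacobi
  identity.\<close>

lemma bianchi:
  assumes U: "open U" "p \<in> U" and X: "vector_field M U X" and Y: "vector_field M U Y" and Z: "vector_field M U Z"
  shows "curv X Y Z p + curv Y Z X p + curv Z X Y p = 0"
proof -
  have *: "bracket A (bracket B C) p = nab D A (nab D B C) p - nab D A (nab D C B) p - nab D (bracket B C) A p"
    if "vector_field M U A" "vector_field M U B" "vector_field M U C" for A B C
    using D_diff[OF U(1) vector_field_nab[OF U(1) that(2,3)] vector_field_nab[OF U(1) that(3,2)] U(2)]
    by (simp add: bracket_def nab_def)
  show ?thesis
    using bracket_jacobi[OF U X Y Z]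
    by (simp add: *[OF X Y Z] *[OF Y Z X] *[OF Z X Y] curv_eq[OF U X Y Z] curv_eq[OF U Y Z X] curv_eq[OF U Z X Y]
        algebra_simps)
qed

text \<open>Differentiate g(Z,W) along Y, then along X, and antisymmetrise: mixed terms such as
  g(\<nabla>_Y Z, \<nabla>_X W) drop out. The difference of the second derivatives is a derivative
  along the bracket, expanded again by compatibility with the metric.\<close>

lemma g_curv_skew:
  assumes U: "open U" "p \<in> U" and X: "vector_field M U X" and Y: "vector_field M U Y"
    and Z: "vector_field M U Z" and W: "vector_field M U W"
  shows "g p (curv X Y Z p) (W p) = - g p (Z p) (curv X Y W p)"
proof -
  let ?h = "\<lambda>q. g q (Z q) (W q)"
  have *: "dfun M (\<lambda>q. dfun M ?h q (B q)) p (A p) =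
      g p (nab D A (nab D B Z) p) (W p) + g p (nab D B Z p) (nab D A W p)
      + g p (nab D A Z p) (nab D B W p) + g p (Z p) (nab D A (nab D B W) p)"
    if A: "vector_field M U A" and B: "vector_field M U B" for A B
  proof -
    note s = smooth_fun_g[OF U(1) vector_field_nab[OF U(1) B Z] W] smooth_fun_g[OF U(1) Z vector_field_nab[OF U(1) B W]]
    have "dfun M (\<lambda>q. dfun M ?h q (B q)) p (A p) =
        dfun M (\<lambda>q. g q (nab D B Z q) (W q) + g q (Z q) (nab D B W q)) p (A p)"
      by (rule dfun_cong[OF U]) (simp add: dfun_g[OF U(1) Z W] nab_def)
    also have "\<dots> = dfun M (\<lambda>q. g q (nab D B Z q) (W q)) p (A p) + dfun M (\<lambda>q. g q (Z q) (nab D B W q)) p (A p)"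
      by (rule dfun_add[OF s U(2)])
    finally show ?thesis
      using dfun_g[OF U(1) vector_field_nab[OF U(1) B Z] W U(2)] dfun_g[OF U(1) Z vector_field_nab[OF U(1) B W] U(2)]
      by (simp add: nab_def)
  qed
  have "dfun M ?h p (bracket X Y p) = dfun M (\<lambda>q. dfun M ?h q (Y q)) p (X p) - dfun M (\<lambda>q. dfun M ?h q (X q)) p (Y p)"
    using dfun_bracket[OF U(1) X Y smooth_fun_g[OF U(1) Z W] U(2)] by (simp add: bracket_def)
  moreover have "dfun M ?h p (bracket X Y p) = g p (nab D (bracket X Y) Z p) (W p) + g p (Z p) (nab D (bracket X Y) W p)"
    using dfun_g[OF U(1) Z W U(2)] by (simp add: nab_def)
  ultimately show ?thesis
    by (simp add: *[OF X Y] *[OF Y X] curv_eq[OF U X Y Z] curv_eq[OF U X Y W])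
qed

text \<open>The octahedron argument: four cyclic instances of the Bianchi identity, combined
  linearly with the two skew symmetries, leave only the two sides.\<close>

lemma g_curv_pair_sym:
  assumes U: "open U" "p \<in> U" and f: "vector_field M U X" "vector_field M U Y" "vector_field M U Z" "vector_field M U W"
  shows "g p (curv X Y Z p) (W p) = g p (curv Z W X p) (Y p)"
proof -
  have sk: "g p (curv A B C p) (E p) = - g p (curv A B E p) (C p)"
    if "vector_field M U A" "vector_field M U B" "vector_field M U C" "vector_field M U E" for A B C E
    using g_curv_skew[OF U that] by (simp add: g_sym)
  have an: "g p (curv A B C p) v = - g p (curv B A C p) v" for A B C v
    by (subst curv_antisym) simp
  have bi: "g p (curv A B C p) (E p) + g p (curv B C A p) (E p) + g p (curv C A B p) (E p) = 0"
    if "vector_field M U A" "vector_field M U B" "vector_field M U C" "vector_field M U E" for A B C E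
    using arg_cong[OF bianchi[OF U that(1,2,3)], of "\<lambda>v. g p v (E p)"] by simp
  note bi[OF f(1,2,3,4)] bi[OF f(2,3,4,1)] bi[OF f(3,4,1,2)] bi[OF f(4,1,2,3)]
  moreover note sk[OF f(1,2,4,3)] sk[OF f(2,3,4,1)] sk[OF f(3,1,4,2)] sk[OF f(3,4,2,1)] sk[OF f(4,2,3,1)]
    sk[OF f(4,1,3,2)] sk[OF f(2,4,3,1)] sk[OF f(1,3,4,2)]  sk[OF f(1,3,2,4)] sk[OF f(2,4,1,3)]
  moreover note an[of X Y Z "W p"] an[of Y Z X "W p"] an[of Z X Y "W p"] an[of Y Z W "X p"] an[of Z W Y "X p"]
    an[of W Y Z "X p"] an[of Z W X "Y p"] an[of W X Z "Y p"] an[of X Z W "Y p"] an[of W X Y "Z p"] an[of X Y W "Z p"]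
    an[of Y W X "Z p"]
  ultimately show ?thesis by linarith
qed

subsection \<open>Orthonormal frames\<close>

lemma frame_vector_field: "orthonormal_frame M g U E \<Longrightarrow> i \<in> Basis \<Longrightarrow> vector_field M U (E i)"
  and frame_orthonormal: "orthonormal_frame M g U E \<Longrightarrow> p \<in> U \<Longrightarrow> i \<in> Basis \<Longrightarrow> j \<in> Basis \<Longrightarrow>
    g p (E i p) (E j p) = (if i = j then 1 else 0)"
  by (auto simp: orthonormal_frame_def)

lemma frame_subset: "orthonormal_frame M g U E \<Longrightarrow> V \<subseteq> U \<Longrightarrow> orthonormal_frame M g V E"
  by (auto simp: orthonormal_frame_def intro: vector_field_subset)

text \<open>Orthonormality makes the map from coefficients to combinations of the frame injective.
  The frame is indexed by \<open>Basis\<close> of the model space, so dimensions agree and the map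
  is onto.\<close>

lemma frame_expansion:
  assumes E: "orthonormal_frame M g U E" and p: "p \<in> U"
  shows "v = (\<Sum>i\<in>Basis. g p v (E i p) *\<^sub>R E i p)"
proof -
  note on = frame_orthonormal[OF E p]
  have coef: "g p (\<Sum>i\<in>Basis. c i *\<^sub>R E i p) (E j p) = c j" if "j \<in> Basis" for c j
    using that by (simp add: on sum.delta if_distrib cong: if_cong)
  let ?F = "\<lambda>c::'e. \<Sum>i\<in>Basis. (c \<bullet> i) *\<^sub>R E i p"
  have lin: "linear ?F"
    by (rule linearI) (simp_all add: inner_add_left algebra_simps sum.distrib scaleR_sum_right)
  have "inj ?F"
    unfolding linear_injective_0[OF lin]
  proof (intro allI impI)
    fix c assume "?F c = 0"
    then show "c = 0" using coef[of _ "\<lambda>i. c \<bullet> i"] by (auto intro: euclidean_eqI)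
  qed
  then have "surj ?F" using linear_injective_imp_surjective[OF lin] by blast
  then obtain c where c: "v = ?F c" by (meson surjD)
  have "(\<Sum>i\<in>Basis. g p v (E i p) *\<^sub>R E i p) = ?F c"
    by (rule sum.cong) (simp_all only: c coef[of _ "\<lambda>i. c \<bullet> i"])
  with c show ?thesis by simp
qed

lemma frame_g:
  assumes "orthonormal_frame M g U E" "p \<in> U"
  shows "g p u v = (\<Sum>i\<in>Basis. g p u (E i p) * g p v (E i p))"
  by (subst frame_expansion[OF assms, of v]) (simp add: mult.commute)

lemma tensorial_frame:
  assumes U: "open U" and E: "orthonormal_frame M g U E"
    and T: "tensorial M U (vector_field M U) p T" and X: "vector_field M U X"
  shows "T X = (\<Sum>i\<in>Basis. g p (X p) (E i p) *\<^sub>R T (E i))"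
  by (rule tensorial_expand[OF field_module_vector_fields[OF U] T X, of Basis "\<lambda>i q. g q (X q) (E i q)"])
    (auto intro!: smooth_fun_g U X frame_vector_field[OF E] frame_expansion[OF E])

text \<open>Expanding both slots in \<open>F\<close> leaves the coefficients \<Sum> g(E_i,F_j)
  g(E_i,F_k), which equal g(F_j,F_k) by Parseval for \<open>E\<close>; orthonormality of
  \<open>F\<close> selects the diagonal.\<close>

lemma trace_frame_indep:
  assumes U: "open U" "p \<in> U" and E: "orthonormal_frame M g U E" and F: "orthonormal_frame M g U F"
    and B: "\<And>Y. vector_field M U Y \<Longrightarrow> tensorial M U (vector_field M U) p (\<lambda>X. B X Y)"
      "\<And>X. vector_field M U X \<Longrightarrow> tensorial M U (vector_field M U) p (B X)"
  shows "(\<Sum>i\<in>Basis. B (E i) (E i)) = (\<Sum>i\<in>Basis. B (F i) (F i))"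
proof -
  note vE = frame_vector_field[OF E] and vF = frame_vector_field[OF F]
  have "(\<Sum>i\<in>Basis. B (E i) (E i)) =
      (\<Sum>i\<in>Basis. \<Sum>j\<in>Basis. \<Sum>k\<in>Basis. (g p (E i p) (F j p) * g p (E i p) (F k p)) *\<^sub>R B (F j) (F k))"
  proof (intro sum.cong refl)
    fix i :: 'e assume i: "i \<in> Basis"
    have "B (E i) (E i) = (\<Sum>j\<in>Basis. g p (E i p) (F j p) *\<^sub>R B (F j) (E i))"
      using tensorial_frame[OF U(1) F B(1)[OF vE[OF i]] vE[OF i]] .
    also have "\<dots> = (\<Sum>j\<in>Basis. g p (E i p) (F j p) *\<^sub>R (\<Sum>k\<in>Basis. g p (E i p) (F k p) *\<^sub>R B (F j) (F k)))"
      by (intro sum.cong refl arg_cong2[where f = scaleR] tensorial_frame[OF U(1) F B(2)] vF vE i)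
    finally show "B (E i) (E i) = (\<Sum>j\<in>Basis. \<Sum>k\<in>Basis. (g p (E i p) (F j p) * g p (E i p) (F k p)) *\<^sub>R B (F j) (F k))"
      by (simp add: scaleR_sum_right)
  qed
  also have "\<dots> = (\<Sum>j\<in>Basis. \<Sum>k\<in>Basis. \<Sum>i\<in>Basis. (g p (E i p) (F j p) * g p (E i p) (F k p)) *\<^sub>R B (F j) (F k))"
    by (subst sum.swap, rule sum.cong[OF refl], rule sum.swap)
  also have "\<dots> = (\<Sum>j\<in>Basis. \<Sum>k\<in>Basis. g p (F j p) (F k p) *\<^sub>R B (F j) (F k))"
  proof (intro sum.cong refl)
    fix j k :: 'e
    have "(\<Sum>i\<in>Basis. g p (E i p) (F j p) * g p (E i p) (F k p)) = g p (F j p) (F k p)"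
      by (subst frame_g[OF E U(2), of "F j p"]) (simp only: g_sym[of p "E _ p"])
    then show "(\<Sum>i\<in>Basis. (g p (E i p) (F j p) * g p (E i p) (F k p)) *\<^sub>R B (F j) (F k)) =
        g p (F j p) (F k p) *\<^sub>R B (F j) (F k)"
      by (simp only: scaleR_sum_left[symmetric])
  qed
  also have "\<dots> = (\<Sum>j\<in>Basis. B (F j) (F j))"
  proof (intro sum.cong refl)
    fix j :: 'e assume j: "j \<in> Basis"
    have "(\<Sum>k\<in>Basis. g p (F j p) (F k p) *\<^sub>R B (F j) (F k)) = (\<Sum>k\<in>Basis. if j = k then B (F j) (F k) else 0)"
      by (intro sum.cong refl) (simp add: frame_orthonormal[OF F U(2) j])
    also have "\<dots> = B (F j) (F j)" using j by simp
    finally show "(\<Sum>k\<in>Basis. g p (F j p) (F k p) *\<^sub>R B (F j) (F k)) = B (F j) (F j)" .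
  qed
  finally show ?thesis .
qed

text \<open>Gram-Schmidt on the coordinate fields of one chart, carried out simultaneously at all
  points of its domain.\<close>

lemma local_frame:
  obtains U E where "open U" "p \<in> U" "orthonormal_frame M g U E"
proof -
  let ?U = "cd p" and ?X = "cfield p"
  have indep: "?X j q \<notin> span ((\<lambda>i. ?X i q) ` B)"
    if "q \<in> ?U" "j \<in> Basis" "B \<subseteq> Basis" "j \<notin> B" for q j and B :: "'e set"
  proof
    assume "?X j q \<in> span ((\<lambda>i. ?X i q) ` B)"
    then have "dchart M p q (?X j q) \<in> dchart M p q ` span ((\<lambda>i. ?X i q) ` B)" by blast
    also have "\<dots> = span (dchart M p q ` (\<lambda>i. ?X i q) ` B)"
      using linear_span_image[OF linear_dchart[OF that(1)]] by blast
    also have "dchart M p q ` (\<lambda>i. ?X i q) ` B = B"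
      using that by (simp add: image_image dchart_cfield)
    finally have "j \<in> span B" by (simp add: dchart_cfield[OF that(1)])
    moreover have "independent (insert j B)"
      using independent_mono[OF independent_Basis] that by blast
    ultimately show False using that(4) by (simp add: independent_insert)
  qed
  \<comment> \<open>The span clause is the invariant that keeps the next vector nonzero: if its
    projection vanished, the new coordinate field would lie in the span of the previous ones,
    against \<open>indep\<close>.\<close>
  have "\<exists>E. (\<forall>i\<in>B. vector_field M ?U (E i)) \<and>
      (\<forall>q\<in>?U. \<forall>i\<in>B. E i q \<in> span ((\<lambda>i. ?X i q) ` B) \<and>
        (\<forall>j\<in>B. g q (E i q) (E j q) = (if i = j then 1 else 0)))"
    if "B \<subseteq> Basis" for B
    using finite_subset[OF that finite_Basis] that
  proof (induction B rule: finite_induct)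
    case empty
    then show ?case by simp
  next
    case (insert j B)
    then obtain E where E: "\<forall>i\<in>B. vector_field M ?U (E i)"
      "\<forall>q\<in>?U. \<forall>i\<in>B. E i q \<in> span ((\<lambda>i. ?X i q) ` B) \<and>
        (\<forall>j\<in>B. g q (E i q) (E j q) = (if i = j then 1 else 0))" by auto
    define Y where "Y = (\<lambda>q. ?X j q - (\<Sum>i\<in>B. g q (?X j q) (E i q) *\<^sub>R E i q))"
    define N where "N = (\<lambda>q. g q (Y q) (Y q))"
    define n where "n = (\<lambda>q. inverse (sqrt (N q)))"
    define E' where "E' = E(j := \<lambda>q. n q *\<^sub>R Y q)"
    have Y: "vector_field M ?U Y"
      unfolding Y_def using E(1)
      by (intro vector_field_diff vector_field_sum vector_field_scale smooth_fun_g vector_field_cfield) auto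
    have Yn0: "Y q \<noteq> 0" if "q \<in> ?U" for q
    proof
      assume "Y q = 0"
      then have e: "?X j q = (\<Sum>i\<in>B. g q (?X j q) (E i q) *\<^sub>R E i q)"
        by (simp add: Y_def)
      have "?X j q \<in> span ((\<lambda>i. ?X i q) ` B)"
        by (subst e) (intro span_sum span_scale, use E(2) that in blast)
      then show False using indep[OF that, of j B] insert by auto
    qed
    have Npos: "N q > 0" if "q \<in> ?U" for q
      using g_pos[OF Yn0[OF that]] by (simp add: N_def)
    have N: "smooth_fun M ?U N"
      unfolding N_def by (intro smooth_fun_g Y) auto
    have "smooth_fun M ?U (\<lambda>q. sqrt (N q))"
      by (rule smooth_fun_compose[OF _ N _ _ smooth_on_sqrt]) (auto simp: Npos)
    then have "smooth_fun M ?U n"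
      unfolding n_def by (rule smooth_fun_compose[OF _ _ _ _ smooth_on_inverse, rotated]) (auto simp: Npos)
    then have nY: "vector_field M ?U (\<lambda>q. n q *\<^sub>R Y q)"
      by (intro vector_field_scale Y) auto
    have YE: "g q (Y q) (E i q) = 0" if "q \<in> ?U" "i \<in> B" for q i
    proof -
      have "(\<Sum>k\<in>B. g q (?X j q) (E k q) * g q (E k q) (E i q)) =
          (\<Sum>k\<in>B. if k = i then g q (?X j q) (E k q) else 0)"
        by (intro sum.cong refl) (use E(2) that in auto)
      also have "\<dots> = g q (?X j q) (E i q)" using that insert.hyps by simp
      finally show ?thesis by (simp add: Y_def)
    qed
    have nn: "n q * (n q * g q (Y q) (Y q)) = 1" if "q \<in> ?U" for q
    proof -
      have s: "N q = sqrt (N q) * sqrt (N q)" "sqrt (N q) \<noteq> 0" using Npos[OF that] by simp_all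
      have "inverse s * (inverse s * N q) = 1" if "N q = s * s" "s \<noteq> 0" for s
        using that by (simp add: field_simps)
      from this[OF s] show ?thesis by (simp only: n_def N_def)
    qed
    have sp: "E i q \<in> span ((\<lambda>i. ?X i q) ` insert j B)" if "q \<in> ?U" "i \<in> B" for q i
      using E(2) that span_mono[of "(\<lambda>i. ?X i q) ` B" "(\<lambda>i. ?X i q) ` insert j B"] by auto
    have "n q *\<^sub>R Y q \<in> span ((\<lambda>i. ?X i q) ` insert j B)" if "q \<in> ?U" for q
      unfolding Y_def by (intro span_scale span_diff span_sum sp that) (auto intro: span_base)
    then have "(\<forall>i\<in>insert j B. vector_field M ?U (E' i)) \<and>
      (\<forall>q\<in>?U. \<forall>i\<in>insert j B. E' i q \<in> span ((\<lambda>i. ?X i q) ` insert j B) \<and>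
        (\<forall>k\<in>insert j B. g q (E' i q) (E' k q) = (if i = k then 1 else 0)))"
      using E sp nY YE nn insert.hyps(2) g_sym[of _ "E _ _" "Y _"] by (auto simp: E'_def)
    then show ?case by blast
  qed
  from this[OF order_refl] obtain E where "orthonormal_frame M g ?U E"
    unfolding orthonormal_frame_def by blast
  then show ?thesis using that by blast
qed

subsection \<open>The gradient\<close>

text \<open>\<open>gradient\<close> is a definite description, so existence and uniqueness are owed:
  the first comes from \<Sum> df(E_i) E_i in a local frame, the second from nondegeneracy of the
  metric.\<close>

lemma g_gradient:
  assumes "smooth_fun M U f" "p \<in> U"
  shows "g p (gradient M g f p) v = dfun M f p v"
proof -
  obtain V E where V: "open V" "p \<in> V" and E: "orthonormal_frame M g V E" by (rule local_frame)
  let ?w = "\<Sum>i\<in>Basis. dfun M f p (E i p) *\<^sub>R E i p"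
  note lin = linear_dfun[OF assms]
  have w: "\<forall>v. g p ?w v = dfun M f p v"
  proof
    fix v
    have "dfun M f p v = dfun M f p (\<Sum>i\<in>Basis. g p v (E i p) *\<^sub>R E i p)"
      using frame_expansion[OF E V(2), of v] by simp
    then show "g p ?w v = dfun M f p v"
      by (simp add: linear_sum[OF lin] linear_cmul[OF lin] g_sym[of p v] mult.commute)
  qed
  then have "\<forall>v. g p (gradient M g f p) v = dfun M f p v"
    unfolding gradient_def by (rule theI) (metis g_eqI w)
  then show ?thesis by blast
qed

lemma vector_field_gradient:
  assumes "open U" "smooth_fun M U f"
  shows "vector_field M U (gradient M g f)"
proof (rule vector_field_local)
  fix p assume p: "p \<in> U"
  obtain V E where V: "open V" "p \<in> V" and E: "orthonormal_frame M g V E" by (rule local_frame)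
  let ?V = "U \<inter> V"
  have o: "open ?V" using assms(1) V(1) by auto
  note E = frame_subset[OF E, of ?V, simplified]
  have "vector_field M ?V (\<lambda>q. \<Sum>i\<in>Basis. dfun M f q (E i q) *\<^sub>R E i q)"
    by (intro vector_field_sum vector_field_scale smooth_fun_dfun o smooth_fun_subset[OF assms(2)] frame_vector_field[OF E]) auto
  then have "vector_field M ?V (gradient M g f)"
  proof (rule vector_field_cong[OF o, rotated])
    fix q assume q: "q \<in> ?V"
    show "(\<Sum>i\<in>Basis. dfun M f q (E i q) *\<^sub>R E i q) = gradient M g f q"
      by (subst frame_expansion[OF E q, of "gradient M g f q"])
        (use q in \<open>simp add: g_gradient[OF assms(2)]\<close>)
  qed
  then show "\<exists>V. open V \<and> p \<in> V \<and> vector_field M V (gradient M g f)"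
    using o p V by blast
qed

end

section \<open>Connections in a bundle of tangent vectors\<close>

text \<open>\<open>Sec\<close> is the module of sections over \<open>U\<close> of a subbundle of the tangent bundle, \<open>C\<close> a connection
  in it and \<open>A\<close> an endomorphism field.\<close>

locale section_connection = riemannian_lc M g D
  for M :: "('m::{t2_space,second_countable_topology}, 'e::euclidean_space) manifold" and g D +
  fixes U :: "'m set" and Sec :: "('m \<Rightarrow> 'e) \<Rightarrow> bool" and C :: "('m, 'e) connection"
    and A :: "'m \<Rightarrow> 'e \<Rightarrow> 'e"
  assumes module: "field_module M U Sec"
    and Sec_nab: "vector_field M U X \<Longrightarrow> Sec W \<Longrightarrow> Sec (nab C X W)"
    and C_linear: "Sec W \<Longrightarrow> p \<in> U \<Longrightarrow> linear (\<lambda>v. C p v W)"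
    and C_cong: "Sec W \<Longrightarrow> Sec W' \<Longrightarrow> (\<And>q. q \<in> U \<Longrightarrow> W q = W' q) \<Longrightarrow> p \<in> U \<Longrightarrow> C p v W = C p v W'"
    and C_add: "Sec W \<Longrightarrow> Sec W' \<Longrightarrow> p \<in> U \<Longrightarrow> C p v (\<lambda>q. W q + W' q) = C p v W + C p v W'"
    and C_scale: "smooth_fun M U h \<Longrightarrow> Sec W \<Longrightarrow> p \<in> U \<Longrightarrow>
      C p v (\<lambda>q. h q *\<^sub>R W q) = dfun M h p v *\<^sub>R W p + h p *\<^sub>R C p v W"
    and A_linear: "linear (A p)"
    and Sec_A: "Sec W \<Longrightarrow> Sec (\<lambda>q. A q (W q))"
begin

lemma open_U: "open U" and Sec_vector_field: "Sec W \<Longrightarrow> vector_field M U W"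
  and Sec_add: "Sec W \<Longrightarrow> Sec W' \<Longrightarrow> Sec (\<lambda>q. W q + W' q)"
  and Sec_scale: "smooth_fun M U h \<Longrightarrow> Sec W \<Longrightarrow> Sec (\<lambda>q. h q *\<^sub>R W q)"
  using module unfolding field_module_def by blast+

lemma Sec_diff: "Sec W \<Longrightarrow> Sec W' \<Longrightarrow> Sec (\<lambda>q. W q - W' q)"
  using Sec_add[OF _ Sec_scale[OF smooth_fun_const[of U "-1"]], of W W'] by simp

lemmas A_simps = linear_add[OF A_linear] linear_diff[OF A_linear] linear_cmul[OF A_linear]
  linear_neg[OF A_linear] linear_0[OF A_linear] linear_sum[OF A_linear]

abbreviation "nA X \<equiv> nab_end (nab C) X (endo_of A)"

text \<open>The derivative of \<open>A\<close> in the direction of a single vector at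
  \<open>p\<close>, where \<open>nab_end\<close> takes a field; in this form linearity in the
  direction can be stated.\<close>

definition DA :: "'m \<Rightarrow> 'e \<Rightarrow> ('m \<Rightarrow> 'e) \<Rightarrow> 'e" where
  "DA p v W = C p v (\<lambda>q. A q (W q)) - A p (C p v W)"

lemma nA_eq: "nA X W p = DA p (X p) W"
  by (simp add: nab_end_def DA_def nab_def endo_of_def)

lemma DA_linear: "Sec W \<Longrightarrow> p \<in> U \<Longrightarrow> linear (\<lambda>v. DA p v W)"
  unfolding DA_def
  by (intro linear_compose_sub C_linear Sec_A linear_compose[OF C_linear A_linear, unfolded o_def])

lemma Sec_nA:
  assumes "vector_field M U X" "Sec W"
  shows "Sec (nA X W)"
  unfolding nab_end_def[abs_def] endo_of_def
  by (intro Sec_diff Sec_nab Sec_A assms)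

lemma Sec_DA: "vector_field M U X \<Longrightarrow> Sec W \<Longrightarrow> Sec (\<lambda>q. DA q (X q) W)"
  using Sec_nA[of X W] by (simp add: nA_eq[abs_def])

text \<open>The term dh(v) A W appears in the derivative of A(hW) and in A applied to the derivative
  of hW, and cancels.\<close>

lemma tensorial_DA:
  assumes p: "p \<in> U"
  shows "tensorial M U Sec p (DA p v)"
proof (rule tensorialI)
  fix W W' assume W: "Sec W" "Sec W'"
  then show "DA p v (\<lambda>q. W q + W' q) = DA p v W + DA p v W'"
    using p by (simp add: DA_def A_simps C_add Sec_A)
  show "DA p v W = DA p v W'" if "\<And>q. q \<in> U \<Longrightarrow> W q = W' q"
    unfolding DA_def using C_cong[OF W that p] C_cong[OF Sec_A[OF W(1)] Sec_A[OF W(2)] _ p] that by simp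
next
  fix h W assume "smooth_fun M U h" "Sec W"
  then show "DA p v (\<lambda>q. h q *\<^sub>R W q) = h p *\<^sub>R DA p v W"
    using p by (simp add: DA_def A_simps C_scale Sec_A algebra_simps)
qed

section \<open>Tensoriality of the second covariant derivative of an endomorphism field\<close>

abbreviation "K X Y \<equiv> nab2_end D (nab C) X Y (endo_of A)"

lemma K_eq: "K X Y W p = C p (X p) (nA Y W) - DA p (Y p) (nab C X W) - DA p (D p (X p) Y) W"
  by (simp add: nab2_end_def nab_end_def[of "nab C" X "nA Y"] nA_eq) (simp add: nab_def)

lemmas DA_add = tensorial_DA[unfolded tensorial_def, THEN conjunct1, rule_format]
  and DA_scale = tensorial_DA[unfolded tensorial_def, THEN conjunct2, THEN conjunct1, rule_format]
  and DA_cong = tensorial_cong[OF tensorial_DA]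

text \<open>Every term of \<open>K_eq\<close> sees \<open>X\<close> only through its value at
  \<open>p\<close>, except the field \<open>nab C X W\<close> under \<open>DA\<close>; there
  tensoriality of \<open>DA\<close> pulls the coefficient out.\<close>

lemma tensorial_K1:
  assumes p: "p \<in> U" and Y: "vector_field M U Y" and W: "Sec W"
  shows "tensorial M U (vector_field M U) p (\<lambda>X. K X Y W p)"
proof (rule tensorialI)
  note CL = linear_add[OF C_linear] linear_cmul[OF C_linear] linear_add[OF DA_linear] linear_cmul[OF DA_linear]
    linear_add[OF D_linear[OF open_U]] linear_cmul[OF D_linear[OF open_U]]
  note S = Sec_nA[OF Y W]
  fix X X' assume X: "vector_field M U X" "vector_field M U X'"
  have "DA p (Y p) (nab C (\<lambda>q. X q + X' q) W) = DA p (Y p) (\<lambda>q. nab C X W q + nab C X' W q)"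
    by (rule DA_cong[OF p]) (auto simp: nab_def CL W intro!: Sec_nab[unfolded nab_def] Sec_add X vector_field_add open_U W)
  also have "\<dots> = DA p (Y p) (nab C X W) + DA p (Y p) (nab C X' W)"
    by (intro DA_add p Sec_nab X W)
  finally show "K (\<lambda>q. X q + X' q) Y W p = K X Y W p + K X' Y W p"
    by (simp add: K_eq CL S W p Y)
  show "K X Y W p = K X' Y W p" if "\<And>q. q \<in> U \<Longrightarrow> X q = X' q"
  proof -
    have "DA p (Y p) (nab C X W) = DA p (Y p) (nab C X' W)"
      by (rule DA_cong[OF p Sec_nab[OF X(1) W] Sec_nab[OF X(2) W]]) (simp add: nab_def that)
    then show ?thesis by (simp add: K_eq that[OF p])
  qed
next
  note CL = linear_add[OF C_linear] linear_cmul[OF C_linear] linear_add[OF DA_linear] linear_cmul[OF DA_linear]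
    linear_add[OF D_linear[OF open_U]] linear_cmul[OF D_linear[OF open_U]]
  note S = Sec_nA[OF Y W]
  fix h X assume h: "smooth_fun M U h" and X: "vector_field M U X"
  have "DA p (Y p) (nab C (\<lambda>q. h q *\<^sub>R X q) W) = DA p (Y p) (\<lambda>q. h q *\<^sub>R nab C X W q)"
    by (rule DA_cong[OF p])
      (auto simp: nab_def CL W intro!: Sec_nab[unfolded nab_def] Sec_scale[OF h] X vector_field_scale[OF open_U h] W)
  also have "\<dots> = h p *\<^sub>R DA p (Y p) (nab C X W)"
    by (intro DA_scale p Sec_nab X W h)
  finally show "K (\<lambda>q. h q *\<^sub>R X q) Y W p = h p *\<^sub>R K X Y W p"
    by (simp add: K_eq CL S W p Y scaleR_diff_right)
qed

text \<open>For hY in place of Y, the term dh(X) (C_Y A) W arises both from differentiating h (C_Y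
  A) W along X and from D_X(hY) in the correction term, whose purpose is this cancellation.\<close>

lemma tensorial_K2:
  assumes p: "p \<in> U" and X: "vector_field M U X" and W: "Sec W"
  shows "tensorial M U (vector_field M U) p (\<lambda>Y. K X Y W p)"
proof (rule tensorialI)
  fix Y Y' assume Y: "vector_field M U Y" "vector_field M U Y'"
  note DL = linear_add[OF DA_linear[OF _ p]] linear_cmul[OF DA_linear[OF _ p]]
  have "C p (X p) (nA (\<lambda>q. Y q + Y' q) W) = C p (X p) (\<lambda>q. nA Y W q + nA Y' W q)"
    by (rule C_cong[OF _ _ _ p])
      (auto simp: nA_eq linear_add[OF DA_linear] W intro!: Sec_nA Sec_DA Sec_add Y vector_field_add open_U W)
  also have "\<dots> = C p (X p) (nA Y W) + C p (X p) (nA Y' W)"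
    by (intro C_add Sec_nA Y W p)
  finally show "K X (\<lambda>q. Y q + Y' q) W p = K X Y W p + K X Y' W p"
    by (simp add: K_eq DL W Sec_nab[OF X W] D_add[OF open_U Y p])
  show "K X Y W p = K X Y' W p" if "\<And>q. q \<in> U \<Longrightarrow> Y q = Y' q"
  proof -
    have "C p (X p) (nA Y W) = C p (X p) (nA Y' W)"
      by (rule C_cong[OF Sec_nA[OF Y(1) W] Sec_nA[OF Y(2) W] _ p]) (simp add: nA_eq that)
    moreover have "D p (X p) Y = D p (X p) Y'"
      by (rule D_cong[OF open_U Y(2) that p])
    ultimately show ?thesis by (simp add: K_eq that[OF p])
  qed
next
  fix h Y assume h: "smooth_fun M U h" and Y: "vector_field M U Y"
  note DL = linear_add[OF DA_linear[OF _ p]] linear_cmul[OF DA_linear[OF _ p]]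
  have "C p (X p) (nA (\<lambda>q. h q *\<^sub>R Y q) W) = C p (X p) (\<lambda>q. h q *\<^sub>R nA Y W q)"
    by (rule C_cong[OF _ _ _ p])
      (auto simp: nA_eq linear_cmul[OF DA_linear] W intro!: Sec_nA Sec_DA Sec_scale h Y vector_field_scale open_U W)
  also have "\<dots> = dfun M h p (X p) *\<^sub>R DA p (Y p) W + h p *\<^sub>R C p (X p) (nA Y W)"
    using C_scale[OF h Sec_nA[OF Y W] p] by (simp add: nA_eq)
  finally show "K X (\<lambda>q. h q *\<^sub>R Y q) W p = h p *\<^sub>R K X Y W p"
    by (simp add: K_eq DL W Sec_nab[OF X W] D_scale[OF open_U h Y p] algebra_simps)
qed

text \<open>Here dh(X) (C_Y A) W arises from C_X acting on h (C_Y A) W and from C_Y A acting on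
  C_X(hW), and the two contributions are subtracted.\<close>

lemma tensorial_K3:
  assumes p: "p \<in> U" and X: "vector_field M U X" and Y: "vector_field M U Y"
  shows "tensorial M U Sec p (\<lambda>W. K X Y W p)"
proof (rule tensorialI)
  fix W W' assume W: "Sec W" "Sec W'"
  have "C p (X p) (nA Y (\<lambda>q. W q + W' q)) = C p (X p) (\<lambda>q. nA Y W q + nA Y W' q)"
    by (rule C_cong[OF _ _ _ p]) (auto simp: nA_eq DA_add W intro!: Sec_nA Sec_DA Sec_add Y W)
  also have "\<dots> = C p (X p) (nA Y W) + C p (X p) (nA Y W')"
    by (intro C_add Sec_nA Y W p)
  finally have 1: "C p (X p) (nA Y (\<lambda>q. W q + W' q)) = C p (X p) (nA Y W) + C p (X p) (nA Y W')" .
  have "DA p (Y p) (nab C X (\<lambda>q. W q + W' q)) = DA p (Y p) (\<lambda>q. nab C X W q + nab C X W' q)"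
    by (rule DA_cong[OF p Sec_nab[OF X Sec_add[OF W]] Sec_add[OF Sec_nab[OF X W(1)] Sec_nab[OF X W(2)]]])
      (simp add: nab_def C_add[OF W])
  also have "\<dots> = DA p (Y p) (nab C X W) + DA p (Y p) (nab C X W')"
    by (intro DA_add p Sec_nab X W)
  finally show "K X Y (\<lambda>q. W q + W' q) p = K X Y W p + K X Y W' p"
    by (simp add: K_eq 1 DA_add[OF p W])
  show "K X Y W p = K X Y W' p" if eq: "\<And>q. q \<in> U \<Longrightarrow> W q = W' q"
  proof -
    have "C p (X p) (nA Y W) = C p (X p) (nA Y W')"
      by (rule C_cong[OF Sec_nA[OF Y W(1)] Sec_nA[OF Y W(2)] _ p])
        (simp add: nA_eq DA_cong[OF _ W eq])
    moreover have "DA p (Y p) (nab C X W) = DA p (Y p) (nab C X W')"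
      by (rule DA_cong[OF p Sec_nab[OF X W(1)] Sec_nab[OF X W(2)]])
        (simp add: nab_def C_cong[OF W eq])
    ultimately show ?thesis by (simp add: K_eq DA_cong[OF p W eq])
  qed
next
  fix h W assume h: "smooth_fun M U h" and W: "Sec W"
  have "C p (X p) (nA Y (\<lambda>q. h q *\<^sub>R W q)) = C p (X p) (\<lambda>q. h q *\<^sub>R nA Y W q)"
    by (rule C_cong[OF _ _ _ p]) (auto simp: nA_eq DA_scale W h intro!: Sec_nA Sec_DA Sec_scale h Y W)
  also have "\<dots> = dfun M h p (X p) *\<^sub>R DA p (Y p) W + h p *\<^sub>R C p (X p) (nA Y W)"
    using C_scale[OF h Sec_nA[OF Y W] p] by (simp add: nA_eq)
  finally have 1: "C p (X p) (nA Y (\<lambda>q. h q *\<^sub>R W q)) =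
    dfun M h p (X p) *\<^sub>R DA p (Y p) W + h p *\<^sub>R C p (X p) (nA Y W)" .
  have dh: "smooth_fun M U (\<lambda>q. dfun M h q (X q))" by (rule smooth_fun_dfun[OF open_U h X])
  have s1: "Sec (\<lambda>q. dfun M h q (X q) *\<^sub>R W q)" and s2: "Sec (\<lambda>q. h q *\<^sub>R nab C X W q)"
    using Sec_scale[OF dh W] Sec_scale[OF h Sec_nab[OF X W]] by simp_all
  have "DA p (Y p) (nab C X (\<lambda>q. h q *\<^sub>R W q)) =
      DA p (Y p) (\<lambda>q. dfun M h q (X q) *\<^sub>R W q + h q *\<^sub>R nab C X W q)"
    by (rule DA_cong[OF p Sec_nab[OF X Sec_scale[OF h W]] Sec_add[OF s1 s2]])
      (simp add: nab_def C_scale[OF h W])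
  also have "\<dots> = dfun M h p (X p) *\<^sub>R DA p (Y p) W + h p *\<^sub>R DA p (Y p) (nab C X W)"
    by (simp add: DA_add[OF p s1 s2] DA_scale[OF p dh W] DA_scale[OF p h Sec_nab[OF X W]])
  finally show "K X Y (\<lambda>q. h q *\<^sub>R W q) p = h p *\<^sub>R K X Y W p"
    by (simp add: K_eq 1 DA_scale[OF p h W] algebra_simps)
qed

abbreviation "tau E \<equiv> commutator (rough_laplacian_end D (nab C) E (endo_of A)) (endo_of A)"

text \<open>The minus sign of the rough Laplacian reverses the order of the commutator.\<close>

lemma tau_eq: "tau E W p = A p (\<Sum>i\<in>Basis. K (E i) (E i) W p) - (\<Sum>i\<in>Basis. K (E i) (E i) (\<lambda>q. A q (W q)) p)"
  by (simp add: commutator_def rough_laplacian_end_def endo_of_def A_simps)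

lemma trace_K_frame_indep:
  assumes "p \<in> U" "orthonormal_frame M g U E" "orthonormal_frame M g U F" "Sec W"
  shows "(\<Sum>i\<in>Basis. K (E i) (E i) W p) = (\<Sum>i\<in>Basis. K (F i) (F i) W p)"
  by (rule trace_frame_indep[OF open_U assms(1-3), where B = "\<lambda>X Y. K X Y W p"])
    (intro tensorial_K1 tensorial_K2 assms; assumption)+

lemma tau_frame_indep:
  assumes "p \<in> U" "orthonormal_frame M g U E" "orthonormal_frame M g U F" "Sec W"
  shows "tau E W p = tau F W p"
  using trace_K_frame_indep[OF assms] trace_K_frame_indep[OF assms(1-3) Sec_A[OF assms(4)]]
  by (simp add: tau_eq)

text \<open>This makes the commutator computable from its values on sections that span the bundle;
  on the warped product these are lifts.\<close>

lemma tensorial_tau: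
  assumes p: "p \<in> U" and E: "orthonormal_frame M g U E"
  shows "tensorial M U Sec p (\<lambda>W. tau E W p)"
proof (rule tensorialI)
  note v = frame_vector_field[OF E]
  note T = tensorial_K3[OF p v v, unfolded tensorial_def]
  have add: "K (E i) (E i) (\<lambda>q. W q + W' q) p = K (E i) (E i) W p + K (E i) (E i) W' p"
    if "i \<in> Basis" "Sec W" "Sec W'" for i W W' using T that by blast
  have scale: "K (E i) (E i) (\<lambda>q. h q *\<^sub>R W q) p = h p *\<^sub>R K (E i) (E i) W p"
    if "i \<in> Basis" "smooth_fun M U h" "Sec W" for i h W using T that by blast
  show "tau E (\<lambda>q. W q + W' q) p = tau E W p + tau E W' p" if "Sec W" "Sec W'" for W W'
    using that by (simp add: tau_eq A_simps add Sec_A sum.distrib)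
  show "tau E (\<lambda>q. h q *\<^sub>R W q) p = h p *\<^sub>R tau E W p" if "smooth_fun M U h" "Sec W" for h W
    using that by (simp add: tau_eq A_simps scale Sec_A scaleR_sum_right[symmetric] algebra_simps)
  show "tau E W p = tau E W' p" if W: "Sec W" "Sec W'" and eq: "\<And>q. q \<in> U \<Longrightarrow> W q = W' q" for W W'
  proof -
    have "K (E i) (E i) W p = K (E i) (E i) W' p"
      "K (E i) (E i) (\<lambda>q. A q (W q)) p = K (E i) (E i) (\<lambda>q. A q (W' q)) p" if "i \<in> Basis" for i
      using tensorial_cong[OF tensorial_K3[OF p v[OF that] v[OF that]] W eq]
        tensorial_cong[OF tensorial_K3[OF p v[OF that] v[OF that]] Sec_A[OF W(1)] Sec_A[OF W(2)]] eq by auto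
    then show ?thesis by (simp add: tau_eq)
  qed
qed

end

lemma (in riemannian_lc) section_connection_tangent:
  assumes "open U" "tensor11 M A"
  shows "section_connection M g D U (vector_field M U) D A"
proof (rule section_connection.intro[OF riemannian_lc_axioms], rule section_connection_axioms.intro)
  show "D p v W = D p v W'" if "vector_field M U W" "vector_field M U W'" "\<And>q. q \<in> U \<Longrightarrow> W q = W' q" "p \<in> U"
    for p v W W'
    using D_cong[OF assms(1) that(2,3,4)] .
  show "linear (\<lambda>v. D p v W)" if "vector_field M U W" "p \<in> U" for W p
    by (rule D_linear[OF assms(1) that])
  show "linear (A p)" for p
    using assms(2) by (simp add: tensor11_def)
qed (use assms in \<open>auto simp: tensor11_def intro: field_module_vector_fields vector_field_nab D_add D_scale\<close>)

text \<open>The connection behind \<open>nab_bar\<close>, taking single tangent vectors as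
  directions, which is the form that \<open>section_connection\<close> expects.\<close>

definition bar_connection ::
  "('m \<Rightarrow> 'e \<Rightarrow> 'e \<Rightarrow> real) \<Rightarrow> ('m, 'e) connection \<Rightarrow> ('m \<Rightarrow> 'e) \<Rightarrow> ('m, 'e::euclidean_space) connection" where
  "bar_connection g D \<xi> p v W = D p v W - g p (\<xi> p) (D p v W) *\<^sub>R \<xi> p"

lemma nab_bar_eq: "nab_bar g D \<xi> = nab (bar_connection g D \<xi>)"
  by (intro ext) (simp add: nab_bar_def nab_def bar_connection_def)

lemma (in riemannian_lc) section_connection_bar:
  assumes U: "open U" and acm: "almost_contact_metric M g \<phi> \<xi>"
  shows "section_connection M g D U (D_section M g \<xi> U) (bar_connection g D \<xi>) \<phi>"
proof (rule section_connection.intro[OF riemannian_lc_axioms], rule section_connection_axioms.intro)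
  have xi: "vector_field M U \<xi>" "g p (\<xi> p) (\<xi> p) = 1" and phi: "tensor11 M \<phi>"
    and sq: "\<phi> p (\<phi> p u) = - u + g p (\<xi> p) u *\<^sub>R \<xi> p"
    and iso: "g p (\<phi> p u) (\<phi> p v) = g p u v - g p (\<xi> p) u * g p (\<xi> p) v" for p u v
    using acm vector_field_subset[of UNIV \<xi> U] unfolding almost_contact_metric_def by auto
  \<comment> \<open>By \<open>iso\<close> the squared norm of \<phi>\<xi> is 1 - 1 = 0.\<close>
  have phixi: "\<phi> p (\<xi> p) = 0" for p
    using iso[of p "\<xi> p" "\<xi> p"] g_pos[of "\<phi> p (\<xi> p)" p] by (auto simp: xi)
  \<comment> \<open>Two evaluations of \<phi>^3 u differ by \<eta>(\<phi>u) \<xi>: \<open>sq\<close>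
    at \<open>\<phi> p u\<close>, and \<open>\<phi>\<close> applied to \<open>sq\<close> at
    \<open>u\<close>, where \<phi>\<xi> = 0.\<close>
  have etaphi: "g p (\<xi> p) (\<phi> p u) = 0" for p u
  proof -
    have "linear (\<phi> p)" using phi by (simp add: tensor11_def)
    then have "\<phi> p (\<phi> p (\<phi> p u)) = - \<phi> p u"
      by (simp add: sq[of p u] linear_diff linear_add linear_cmul linear_neg phixi)
    with sq[of p "\<phi> p u"] have "g p (\<xi> p) (\<phi> p u) *\<^sub>R \<xi> p = 0" by simp
    moreover have "\<xi> p \<noteq> 0" using xi(2)[of p] by force
    ultimately show ?thesis by simp
  qed
  show "field_module M U (D_section M g \<xi> U)"
    unfolding field_module_def D_section_def
    using U by (auto intro: vector_field_zero vector_field_add vector_field_scale)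
  fix X W W' :: "'m \<Rightarrow> 'e" and p v and h :: "'m \<Rightarrow> real"
  assume W: "D_section M g \<xi> U W"
  then have vW: "vector_field M U W" and eW: "\<And>p. p \<in> U \<Longrightarrow> g p (\<xi> p) (W p) = 0"
    by (auto simp: D_section_def)
  show "D_section M g \<xi> U (\<lambda>q. \<phi> q (W q))"
    using phi vW U etaphi by (auto simp: D_section_def tensor11_def)
  show "D_section M g \<xi> U (nab (bar_connection g D \<xi>) X W)" if X: "vector_field M U X"
  proof -
    have n: "vector_field M U (nab D X W)" by (rule vector_field_nab[OF U X vW])
    have "vector_field M U (\<lambda>p. nab D X W p - g p (\<xi> p) (nab D X W p) *\<^sub>R \<xi> p)"
      by (intro vector_field_diff vector_field_scale smooth_fun_g U n xi)
    then show ?thesis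
      by (simp add: D_section_def nab_def bar_connection_def xi)
  qed
  assume p: "p \<in> U"
  show "linear (\<lambda>v. bar_connection g D \<xi> p v W)"
    by (rule linearI) (simp_all add: bar_connection_def linear_add[OF D_linear[OF U vW p]]
        linear_cmul[OF D_linear[OF U vW p]] algebra_simps)
  \<comment> \<open>The term dh(v) W is already orthogonal to \<xi>, so the projection preserves the
    Leibniz rule.\<close>
  show "bar_connection g D \<xi> p v (\<lambda>q. h q *\<^sub>R W q) = dfun M h p v *\<^sub>R W p + h p *\<^sub>R bar_connection g D \<xi> p v W"
    if h: "smooth_fun M U h"
    by (simp add: bar_connection_def D_scale[OF U h vW p] eW[OF p] algebra_simps)
  assume W': "D_section M g \<xi> U W'"
  then have vW': "vector_field M U W'" by (auto simp: D_section_def)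
  show "bar_connection g D \<xi> p v (\<lambda>q. W q + W' q) = bar_connection g D \<xi> p v W + bar_connection g D \<xi> p v W'"
    unfolding bar_connection_def D_add[OF U vW vW' p] by (simp add: algebra_simps)
  show "bar_connection g D \<xi> p v W = bar_connection g D \<xi> p v W'" if "\<And>q. q \<in> U \<Longrightarrow> W q = W' q"
    by (simp add: bar_connection_def D_cong[OF U vW' that p])
qed (use acm in \<open>auto simp: almost_contact_metric_def tensor11_def\<close>)

section \<open>Almost Hermitian manifolds\<close>

locale almost_hermitian_lc = riemannian_lc M g D
  for M :: "('m::{t2_space,second_countable_topology}, 'e::euclidean_space) manifold" and g D +
  fixes J :: "'m \<Rightarrow> 'e \<Rightarrow> 'e"
  assumes almost_hermitian: "almost_hermitian M g J"
begin

lemma tensor_J: "tensor11 M J" and J_J [simp]: "J p (J p u) = - u" and J_iso: "g p (J p u) (J p v) = g p u v"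
  using almost_hermitian unfolding almost_hermitian_def by auto

lemma J_linear: "linear (J p)"
  and vector_field_J: "open U \<Longrightarrow> vector_field M U X \<Longrightarrow> vector_field M U (\<lambda>q. J q (X q))"
  using tensor_J unfolding tensor11_def by auto

lemmas J_simps [simp] = linear_add[OF J_linear] linear_diff[OF J_linear] linear_cmul[OF J_linear]
  linear_neg[OF J_linear] linear_0[OF J_linear]
lemmas J_sum = linear_sum[OF J_linear]

lemma J_skew: "g p (J p u) v = - g p u (J p v)"
  using J_iso[of p u "J p v"] by simp

lemma J_alternating: "g p (J p u) v = - g p (J p v) u"
  using J_skew[of p u v] g_sym[of p u "J p v"] by simp

lemma section_connection_J: "open U \<Longrightarrow> section_connection M g D U (vector_field M U) D J"
  by (rule section_connection_tangent[OF _ tensor_J])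

definition nJ :: "'m \<Rightarrow> 'e \<Rightarrow> ('m \<Rightarrow> 'e) \<Rightarrow> 'e" where
  "nJ p v W = D p v (\<lambda>q. J q (W q)) - J p (D p v W)"

abbreviation nnJ :: "('m \<Rightarrow> 'e) \<Rightarrow> ('m \<Rightarrow> 'e) \<Rightarrow> ('m, 'e) endo" where
  "nnJ X Y \<equiv> nab2_end D (nab D) X Y (endo_of J)"

lemma nab_end_J: "nab_end (nab D) X (endo_of J) W p = nJ p (X p) W"
  by (simp add: nab_end_def nJ_def nab_def endo_of_def)

text \<open>This is the derivative of J^2 = -1.\<close>

lemma nJ_J:
  assumes "open U" "vector_field M U W" "p \<in> U"
  shows "nJ p v (\<lambda>q. J q (W q)) = - J p (nJ p v W)"
  using D_minus[OF assms(1,2,3)] by (simp add: nJ_def)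

lemma D_J: "D p v (\<lambda>q. J q (W q)) = nJ p v W + J p (D p v W)"
  by (simp add: nJ_def)

lemma vector_field_nJ:
  assumes "open U" "vector_field M U X" "vector_field M U W"
  shows "vector_field M U (\<lambda>q. nJ q (X q) W)"
  using vector_field_diff[OF assms(1) vector_field_nab[OF assms(1,2) vector_field_J[OF assms(1,3)]]
      vector_field_J[OF assms(1) vector_field_nab[OF assms]]]
  by (simp add: nJ_def nab_def)

lemma nnJ_eq: "nnJ X Y W p = D p (X p) (\<lambda>q. nJ q (Y q) W) - nJ p (Y p) (nab D X W) - nJ p (D p (X p) Y) W"
  by (simp add: nab2_end_def nab_end_J[abs_def] nab_end_def[of "nab D" X "\<lambda>W p. nJ p (Y p) W"] nab_def)

lemma nJ_linear: "open U \<Longrightarrow> vector_field M U W \<Longrightarrow> p \<in> U \<Longrightarrow> linear (\<lambda>v. nJ p v W)"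
  using section_connection.DA_linear[OF section_connection_J] section_connection.DA_def[OF section_connection_J]
  by (simp add: nJ_def[abs_def])

lemma nJ_add:
  assumes "open U" "vector_field M U W" "vector_field M U W'" "p \<in> U"
  shows "nJ p v (\<lambda>q. W q + W' q) = nJ p v W + nJ p v W'"
  using D_add[OF assms] D_add[OF assms(1) vector_field_J[OF assms(1,2)] vector_field_J[OF assms(1,3)] assms(4)]
  by (simp add: nJ_def)

text \<open>Differentiating the anticommutation rule \<open>nJ_J\<close> once more; the product rule
  yields one quadratic term for each order of \<open>Z\<close> and \<open>X\<close>.\<close>

lemma nnJ_J:
  assumes U: "open U" "p \<in> U" and Z: "vector_field M U Z" and X: "vector_field M U X" and Y: "vector_field M U Y"
  shows "nnJ Z X (\<lambda>q. J q (Y q)) p =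
    - J p (nnJ Z X Y p) - nJ p (X p) (\<lambda>q. nJ q (Z q) Y) - nJ p (Z p) (\<lambda>q. nJ q (X q) Y)"
proof -
  note XY = vector_field_nJ[OF U(1) X Y] and ZY = vector_field_nJ[OF U(1) Z Y]
    and dZY = vector_field_nab[OF U(1) Z Y]
  have "D p (Z p) (\<lambda>q. nJ q (X q) (\<lambda>q. J q (Y q))) = D p (Z p) (\<lambda>q. - J q (nJ q (X q) Y))"
    by (rule D_cong[OF U(1) vector_field_minus[OF U(1) vector_field_J[OF U(1) XY]] _ U(2)])
      (simp add: nJ_J[OF U(1) Y])
  also have "\<dots> = - nJ p (Z p) (\<lambda>q. nJ q (X q) Y) - J p (D p (Z p) (\<lambda>q. nJ q (X q) Y))"
    by (simp add: D_minus[OF U(1) vector_field_J[OF U(1) XY] U(2)] D_J)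
  finally have 1: "D p (Z p) (\<lambda>q. nJ q (X q) (\<lambda>q. J q (Y q))) =
    - nJ p (Z p) (\<lambda>q. nJ q (X q) Y) - J p (D p (Z p) (\<lambda>q. nJ q (X q) Y))" .
  have "nab D Z (\<lambda>q. J q (Y q)) = (\<lambda>q. nJ q (Z q) Y + J q (nab D Z Y q))"
    by (simp add: nab_def D_J)
  then have 2: "nJ p (X p) (nab D Z (\<lambda>q. J q (Y q))) =
      nJ p (X p) (\<lambda>q. nJ q (Z q) Y) - J p (nJ p (X p) (nab D Z Y))"
    by (simp add: nJ_add[OF U(1) ZY vector_field_J[OF U(1) dZY] U(2)] nJ_J[OF U(1) dZY U(2)])
  show ?thesis
    by (simp add: nnJ_eq 1 2 nJ_J[OF U(1) Y U(2)])
qed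

text \<open>The Ricci identity for J: mixed terms such as \<nabla>_X(J \<nabla>_Y W) enter
  symmetrically in X and Y and drop out.\<close>

lemma nnJ_curv:
  assumes U: "open U" "p \<in> U" and X: "vector_field M U X" and Y: "vector_field M U Y" and W: "vector_field M U W"
  shows "nnJ X Y W p - nnJ Y X W p = curv X Y (\<lambda>q. J q (W q)) p - J p (curv X Y W p)"
proof -
  have 1: "D p v (\<lambda>q. nJ q (B q) W) = D p v (nab D B (\<lambda>q. J q (W q))) - D p v (\<lambda>q. J q (nab D B W q))"
    if B: "vector_field M U B" for B v
    unfolding nJ_def
    using D_diff[OF U(1) vector_field_nab[OF U(1) B vector_field_J[OF U(1) W]]
        vector_field_J[OF U(1) vector_field_nab[OF U(1) B W]] U(2)] by (simp add: nab_def)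
  show ?thesis
    by (simp add: nnJ_eq 1[OF X] 1[OF Y] curv_def nab2_def D_J)
      (simp add: nJ_def nab_def)
qed

text \<open>The matrix g(J E_i, E_j) that expands J E_i in the frame is skew, and transposing it
  moves J to the other slot.\<close>

lemma frame_swap_J:
  assumes U: "open U" "p \<in> U" and E: "orthonormal_frame M g U E"
    and B: "\<And>Y. vector_field M U Y \<Longrightarrow> tensorial M U (vector_field M U) p (\<lambda>X. B X Y)"
      "\<And>X. vector_field M U X \<Longrightarrow> tensorial M U (vector_field M U) p (B X)"
  shows "(\<Sum>i\<in>Basis. B (\<lambda>q. J q (E i q)) (E i)) = - (\<Sum>i\<in>Basis. B (E i) (\<lambda>q. J q (E i q)))"
proof -
  note v = frame_vector_field[OF E] and vJ = vector_field_J[OF U(1) frame_vector_field[OF E]]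
  have "(\<Sum>i\<in>Basis. B (\<lambda>q. J q (E i q)) (E i)) =
      (\<Sum>i\<in>Basis. \<Sum>j\<in>Basis. g p (J p (E i p)) (E j p) *\<^sub>R B (E j) (E i))"
    by (intro sum.cong refl tensorial_frame[OF U(1) E B(1)] v vJ)
  also have "\<dots> = (\<Sum>j\<in>Basis. \<Sum>i\<in>Basis. g p (J p (E i p)) (E j p) *\<^sub>R B (E j) (E i))"
    by (rule sum.swap)
  also have "\<dots> = (\<Sum>j\<in>Basis. - (\<Sum>i\<in>Basis. g p (J p (E j p)) (E i p) *\<^sub>R B (E j) (E i)))"
    unfolding sum_negf[symmetric] by (intro sum.cong refl, subst J_alternating) simp
  also have "\<dots> = (\<Sum>j\<in>Basis. - B (E j) (\<lambda>q. J q (E j q)))"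
    by (intro sum.cong refl arg_cong[where f = uminus] tensorial_frame[OF U(1) E B(2), symmetric] v vJ)
  finally show ?thesis by (simp add: sum_negf)
qed

end

text \<open>Together with the next lemma this allows \<open>frame_swap_J\<close> to be applied to
  the trace of R(J e_i, Z) e_i.\<close>

lemma (in riemannian_lc) tensorial_curv1:
  assumes U: "open U" "p \<in> U" and Z: "vector_field M U Z" and Y: "vector_field M U Y"
  shows "tensorial M U (vector_field M U) p (\<lambda>X. curv X Z Y p)"
proof (rule tensorialI)
  note lin = linear_add[OF D_linear[OF U(1) _ U(2)]] linear_cmul[OF D_linear[OF U(1) _ U(2)]]
  note dY = vector_field_nab[OF U(1) Z Y]
  have nabadd: "nab D Z (nab D (\<lambda>q. X q + X' q) Y) p = nab D Z (nab D X Y) p + nab D Z (nab D X' Y) p"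
    if X: "vector_field M U X" "vector_field M U X'" for X X'
  proof -
    have "D p (Z p) (nab D (\<lambda>q. X q + X' q) Y) = D p (Z p) (\<lambda>q. nab D X Y q + nab D X' Y q)"
      by (rule D_cong[OF U(1) _ _ U(2)])
        (auto simp: nab_def linear_add[OF D_linear[OF U(1) Y]]
          intro!: vector_field_add U vector_field_nab[OF U(1) X(1) Y, unfolded nab_def] vector_field_nab[OF U(1) X(2) Y, unfolded nab_def])
    then show ?thesis
      using D_add[OF U(1) vector_field_nab[OF U(1) X(1) Y] vector_field_nab[OF U(1) X(2) Y] U(2)] by (simp add: nab_def)
  qed
  show "curv (\<lambda>q. X q + X' q) Z Y p = curv X Z Y p + curv X' Z Y p"
    if X: "vector_field M U X" "vector_field M U X'" for X X'
    using nabadd[OF X] by (simp add: curv_def nab2_def) (simp add: nab_def lin Y Z dY[unfolded nab_def] D_add[OF U(1) X U(2)])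
  show "curv (\<lambda>q. h q *\<^sub>R X q) Z Y p = h p *\<^sub>R curv X Z Y p"
    if h: "smooth_fun M U h" and X: "vector_field M U X" for h X
  proof -
    have "D p (Z p) (nab D (\<lambda>q. h q *\<^sub>R X q) Y) = D p (Z p) (\<lambda>q. h q *\<^sub>R nab D X Y q)"
      by (rule D_cong[OF U(1) vector_field_scale[OF U(1) h vector_field_nab[OF U(1) X Y]] _ U(2)])
        (simp add: nab_def linear_cmul[OF D_linear[OF U(1) Y]])
    then have "nab D Z (nab D (\<lambda>q. h q *\<^sub>R X q) Y) p = dfun M h p (Z p) *\<^sub>R nab D X Y p + h p *\<^sub>R nab D Z (nab D X Y) p"
      using D_scale[OF U(1) h vector_field_nab[OF U(1) X Y] U(2)] by (simp add: nab_def)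
    then show ?thesis
      by (simp add: curv_def nab2_def)
        (simp add: nab_def lin Y Z dY[unfolded nab_def] D_scale[OF U(1) h X U(2)] algebra_simps)
  qed
  show "curv X Z Y p = curv X' Z Y p"
    if X: "vector_field M U X" "vector_field M U X'" and eq: "\<And>q. q \<in> U \<Longrightarrow> X q = X' q" for X X'
  proof -
    have "D p (Z p) (nab D X Y) = D p (Z p) (nab D X' Y)"
      by (rule D_cong[OF U(1) vector_field_nab[OF U(1) X(2) Y] _ U(2)]) (simp add: nab_def eq)
    moreover have "D p (Z p) X = D p (Z p) X'"
      by (rule D_cong[OF U(1) X(2) eq U(2)])
    ultimately show ?thesis by (simp add: curv_def nab2_def nab_def eq[OF U(2)])
  qed
qed

lemma (in riemannian_lc) tensorial_curv3:
  assumes U: "open U" "p \<in> U" and X: "vector_field M U X" and Z: "vector_field M U Z"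
  shows "tensorial M U (vector_field M U) p (\<lambda>Y. curv X Z Y p)"
proof (rule tensorialI)
  show "curv X Z (\<lambda>q. Y q + Y' q) p = curv X Z Y p + curv X Z Y' p"
    if Y: "vector_field M U Y" "vector_field M U Y'" for Y Y'
  proof -
    have "nab D A (nab D B (\<lambda>q. Y q + Y' q)) p = nab D A (nab D B Y) p + nab D A (nab D B Y') p"
      if B: "vector_field M U B" for A B
    proof -
      note n = vector_field_nab[OF U(1) B Y(1)] vector_field_nab[OF U(1) B Y(2)]
      have "D p (A p) (nab D B (\<lambda>q. Y q + Y' q)) = D p (A p) (\<lambda>q. nab D B Y q + nab D B Y' q)"
        by (rule D_cong[OF U(1) vector_field_add[OF U(1) n] _ U(2)]) (simp add: nab_def D_add[OF U(1) Y])
      then show ?thesis using D_add[OF U(1) n U(2)] by (simp add: nab_def)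
    qed
    from this[OF X] this[OF Z] show ?thesis
      by (simp add: curv_def nab2_def) (simp add: nab_def D_add[OF U(1) Y U(2)])
  qed
  show "curv X Z (\<lambda>q. h q *\<^sub>R Y q) p = h p *\<^sub>R curv X Z Y p"
    if h: "smooth_fun M U h" and Y: "vector_field M U Y" for h Y
  proof -
    have *: "nab D A (nab D B (\<lambda>q. h q *\<^sub>R Y q)) p =
        dfun M (\<lambda>q. dfun M h q (B q)) p (A p) *\<^sub>R Y p + dfun M h p (B p) *\<^sub>R nab D A Y p
        + dfun M h p (A p) *\<^sub>R nab D B Y p + h p *\<^sub>R nab D A (nab D B Y) p"
      if B: "vector_field M U B" for A B
    proof -
      note n = vector_field_nab[OF U(1) B Y] and dh = smooth_fun_dfun[OF U(1) h B]
      have "D p (A p) (nab D B (\<lambda>q. h q *\<^sub>R Y q)) = D p (A p) (\<lambda>q. dfun M h q (B q) *\<^sub>R Y q + h q *\<^sub>R nab D B Y q)"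
        by (rule D_cong[OF U(1) vector_field_add[OF U(1) vector_field_scale[OF U(1) dh Y] vector_field_scale[OF U(1) h n]] _ U(2)])
          (simp add: nab_def D_scale[OF U(1) h Y])
      then show ?thesis
        using D_add[OF U(1) vector_field_scale[OF U(1) dh Y] vector_field_scale[OF U(1) h n] U(2), of "A p"]
          D_scale[OF U(1) dh Y U(2), of "A p"] D_scale[OF U(1) h n U(2), of "A p"] by (simp add: nab_def)
    qed
    have b: "dfun M h p (nab D X Z p - nab D Z X p) = dfun M h p (nab D X Z p) - dfun M h p (nab D Z X p)"
      by (rule linear_diff[OF linear_dfun[OF h U(2)]])
    \<comment> \<open>Freeness of torsion: the iterated derivatives of h differ by a derivative
      along the bracket, which the correction terms of the curvature absorb.\<close>
    have c: "dfun M (\<lambda>q. dfun M h q (Z q)) p (X p) = dfun M (\<lambda>q. dfun M h q (X q)) p (Z p)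
        + dfun M h p (nab D X Z p) - dfun M h p (nab D Z X p)"
      using dfun_bracket[OF U(1) X Z h U(2)] b by simp
    have e: "nab D B (\<lambda>q. h q *\<^sub>R Y q) p = dfun M h p (B p) *\<^sub>R Y p + h p *\<^sub>R nab D B Y p" for B
      by (simp add: nab_def D_scale[OF U(1) h Y U(2)])
    show ?thesis
      unfolding curv_def nab2_def *[OF X] *[OF Z] e c by (simp add: algebra_simps)
  qed
  show "curv X Z Y p = curv X Z Y' p"
    if Y: "vector_field M U Y" "vector_field M U Y'" and eq: "\<And>q. q \<in> U \<Longrightarrow> Y q = Y' q" for Y Y'
  proof -
    have "D q v Y = D q v Y'" if "q \<in> U" for q v
      by (rule D_cong[OF U(1) Y(2) eq that])
    moreover have "D p v (nab D B Y) = D p v (nab D B Y')" if B: "vector_field M U B" for v B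
      by (rule D_cong[OF U(1) vector_field_nab[OF U(1) B Y(2)] _ U(2)]) (simp add: nab_def calculation)
    ultimately show ?thesis using X Z U by (simp add: curv_def nab2_def nab_def[of D X "nab D Z _"] nab_def[of D Z "nab D X _"])
       (simp add: nab_def)
  qed
qed

subsection \<open>Nearly Kaehler manifolds\<close>

context almost_hermitian_lc
begin

context
  fixes U p E
  assumes nk: "nearly_kahler M D J" and U: "open U" "p \<in> U" and E: "orthonormal_frame M g U E"
begin

abbreviation (input) "vf \<equiv> vector_field M U"

lemma nk_self: "vf X \<Longrightarrow> q \<in> U \<Longrightarrow> nJ q (X q) X = 0"
  using nk U unfolding nearly_kahler_def nab_end_J by blast

text \<open>Polarisation of the nearly Kaehler condition.\<close>

lemma nk_skew:
  assumes "vf X" "vf Y" "q \<in> U"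
  shows "nJ q (X q) Y = - nJ q (Y q) X"
proof -
  have "0 = nJ q (X q + Y q) (\<lambda>q. X q + Y q)"
    using nk_self[OF vector_field_add[OF U(1) assms(1,2)] assms(3)] by simp
  also have "\<dots> = nJ q (X q) X + nJ q (X q) Y + nJ q (Y q) X + nJ q (Y q) Y"
    by (simp add: nJ_add[OF U(1) assms] linear_add[OF nJ_linear[OF U(1) assms(1,3)]]
        linear_add[OF nJ_linear[OF U(1) assms(2,3)]])
  finally show ?thesis
    using nk_self assms by (simp add: eq_neg_iff_add_eq_0)
qed

text \<open>Skewness moves J from the direction into the argument, where \<open>nJ_J\<close>
  applies, and back.\<close>

lemma nk_nJ_J:
  assumes "vf X" "vf Y" "q \<in> U"
  shows "nJ q (J q (X q)) Y = - J q (nJ q (X q) Y)"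
  using nk_skew[OF vector_field_J[OF U(1) assms(1)] assms(2,3)] nk_skew[OF assms(2,1,3)]
    nJ_J[OF U(1) assms(1,3), of "Y q"] by simp

text \<open>The skew symmetry holds on all of \<open>U\<close> and may be differentiated; the
  correction terms for \<open>X\<close> and \<open>Y\<close> correspond to each other under the
  exchange.\<close>

lemma nk_nnJ_skew:
  assumes Z: "vf Z" and X: "vf X" and Y: "vf Y"
  shows "nnJ Z X Y p = - nnJ Z Y X p"
proof -
  have "D p (Z p) (\<lambda>q. nJ q (X q) Y) = D p (Z p) (\<lambda>q. - nJ q (Y q) X)"
    by (rule D_cong[OF U(1) vector_field_minus[OF U(1) vector_field_nJ[OF U(1) Y X]] _ U(2)])
      (rule nk_skew[OF X Y])
  also have "\<dots> = - D p (Z p) (\<lambda>q. nJ q (Y q) X)"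
    by (rule D_minus[OF U(1) vector_field_nJ[OF U(1) Y X] U(2)])
  finally show ?thesis
    using nk_skew[OF vector_field_nab[OF U(1) Z X] Y U(2)] nk_skew[OF vector_field_nab[OF U(1) Z Y] X U(2)]
    by (simp add: nnJ_eq nab_def)
qed

lemma nk_nnJ_self: "vf Z \<Longrightarrow> vf X \<Longrightarrow> nnJ Z X X p = 0"
  using nk_nnJ_skew[of Z X X] by (simp add: eq_neg_iff_add_eq_0 scaleR_2[symmetric])

text \<open>The derivative of \<open>nk_nJ_J\<close>. Its last term appears because J in the
  direction slot is differentiated too: \<nabla>_Z(JX) = (\<nabla>_Z J)X + J \<nabla>_Z X.\<close>

lemma nk_nnJ_J2:
  assumes Z: "vf Z" and X: "vf X" and Y: "vf Y"
  shows "nnJ Z (\<lambda>q. J q (X q)) Y p =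
    - nJ p (Z p) (\<lambda>q. nJ q (X q) Y) - J p (nnJ Z X Y p) - nJ p (nJ p (Z p) X) Y"
proof -
  note XY = vector_field_nJ[OF U(1) X Y]
  have "D p (Z p) (\<lambda>q. nJ q (J q (X q)) Y) = D p (Z p) (\<lambda>q. - J q (nJ q (X q) Y))"
    by (rule D_cong[OF U(1) vector_field_minus[OF U(1) vector_field_J[OF U(1) XY]] _ U(2)])
      (rule nk_nJ_J[OF X Y])
  also have "\<dots> = - nJ p (Z p) (\<lambda>q. nJ q (X q) Y) - J p (D p (Z p) (\<lambda>q. nJ q (X q) Y))"
    by (simp add: D_minus[OF U(1) vector_field_J[OF U(1) XY] U(2)] D_J)
  finally have 1: "D p (Z p) (\<lambda>q. nJ q (J q (X q)) Y) =
    - nJ p (Z p) (\<lambda>q. nJ q (X q) Y) - J p (D p (Z p) (\<lambda>q. nJ q (X q) Y))" .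
  have 2: "nJ p (D p (Z p) (\<lambda>q. J q (X q))) Y = nJ p (nJ p (Z p) X) Y - J p (nJ p (D p (Z p) X) Y)"
    using nk_nJ_J[OF vector_field_nab[OF U(1) Z X] Y U(2)]
    by (simp add: D_J linear_add[OF nJ_linear[OF U(1) Y U(2)]] nab_def)
  show ?thesis
    by (simp add: nnJ_eq 1 2 nk_nJ_J[OF X vector_field_nab[OF U(1) Z Y] U(2)])
qed

lemma nk_tau:
  assumes W: "vf W"
  shows "commutator (rough_laplacian_end D (nab D) E (endo_of J)) (endo_of J) W p = 0"
proof -
  interpret T: section_connection M g D U "vector_field M U" D J
    by (rule section_connection_J[OF U(1)])
  note v = frame_vector_field[OF E] and vJ = vector_field_J[OF U(1) frame_vector_field[OF E]]
  define L where "L = (\<lambda>Z. \<Sum>i\<in>Basis. nnJ (E i) (E i) Z p)"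
  define L' where "L' = (\<lambda>Z. \<Sum>i\<in>Basis. nnJ (E i) (\<lambda>q. J q (E i q)) Z p)"
  define S where "S = (\<lambda>Z. \<Sum>i\<in>Basis. nJ p (E i p) (\<lambda>q. nJ q (E i q) Z))"
  define Ric where "Ric = (\<lambda>Z. \<Sum>i\<in>Basis. curv Z (E i) (E i) p)"
  define R where "R = (\<lambda>Z. \<Sum>i\<in>Basis. curv (E i) (\<lambda>q. J q (E i q)) Z p)"
  \<comment> \<open>The last term of \<open>nk_nnJ_J2\<close> contains (\<nabla>J)(e_i, e_i) =
    0.\<close>
  have L': "L' Z = - S Z - J p (L Z)" if Z: "vf Z" for Z
  proof -
    have "nnJ (E i) (\<lambda>q. J q (E i q)) Z p = - nJ p (E i p) (\<lambda>q. nJ q (E i q) Z) - J p (nnJ (E i) (E i) Z p)"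
      if "i \<in> Basis" for i
      using nk_nnJ_J2[OF v[OF that] v[OF that] Z] nk_self[OF v[OF that] U(2)]
        linear_0[OF nJ_linear[OF U(1) Z U(2)]] by simp
    then show ?thesis by (simp add: L'_def L_def S_def J_sum sum_subtractf sum_negf)
  qed
  \<comment> \<open>Eliminating \<open>S\<close> by the previous identity gives L(JZ) - J(LZ) = 2
    L'Z, so it remains to show that L' vanishes.\<close>
  have LJ: "L (\<lambda>q. J q (Z q)) = - J p (L Z) - 2 *\<^sub>R S Z" if Z: "vf Z" for Z
    using nnJ_J[OF U v v Z]
    by (simp add: L_def S_def J_sum sum_subtractf sum_negf scaleR_2)
  have swap: "(\<Sum>i\<in>Basis. nnJ (\<lambda>q. J q (E i q)) (E i) Z p) = - L' Z" if Z: "vf Z" for Z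
    unfolding L'_def
    by (rule frame_swap_J[OF U E, where B = "\<lambda>X Y. nnJ X Y Z p"])
      (rule T.tensorial_K1[OF U(2) _ Z], assumption, rule T.tensorial_K2[OF U(2) _ Z], assumption)
  \<comment> \<open>In the Bianchi identity for e_i, J e_i, Z the swap of J makes the last two sums
    equal. The Ricci identity then takes J out of the curvature at the cost of second derivatives of
    J, which sum to L.\<close>
  have R: "R Z = - (2 *\<^sub>R (J p (Ric Z) + L Z))" if Z: "vf Z" for Z
  proof -
    have "(\<Sum>i\<in>Basis. curv (\<lambda>q. J q (E i q)) Z (E i) p) = - (\<Sum>i\<in>Basis. curv (E i) Z (\<lambda>q. J q (E i q)) p)"
      by (rule frame_swap_J[OF U E, where B = "\<lambda>X Y. curv X Z Y p"])
        (rule tensorial_curv1[OF U Z], assumption, rule tensorial_curv3[OF U _ Z], assumption)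
    also have "\<dots> = (\<Sum>i\<in>Basis. curv Z (E i) (\<lambda>q. J q (E i q)) p)"
      by (simp add: curv_antisym[of "E _" Z] sum_negf)
    finally have 1: "(\<Sum>i\<in>Basis. curv (\<lambda>q. J q (E i q)) Z (E i) p) = (\<Sum>i\<in>Basis. curv Z (E i) (\<lambda>q. J q (E i q)) p)" .
    have "0 = (\<Sum>i\<in>Basis. curv (E i) (\<lambda>q. J q (E i q)) Z p + curv (\<lambda>q. J q (E i q)) Z (E i) p + curv Z (E i) (\<lambda>q. J q (E i q)) p)"
      using bianchi[OF U v vJ Z] by simp
    then have "0 = R Z + (\<Sum>i\<in>Basis. curv Z (E i) (\<lambda>q. J q (E i q)) p) + (\<Sum>i\<in>Basis. curv Z (E i) (\<lambda>q. J q (E i q)) p)"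
      by (simp add: sum.distrib 1 R_def)
    moreover have "x = - (2 *\<^sub>R y)" if "0 = x + y + y" for x y :: 'e
    proof -
      have "x = (x + y + y) - 2 *\<^sub>R y" by (simp add: scaleR_2)
      also have "\<dots> = - (2 *\<^sub>R y)" unfolding that[symmetric] by simp
      finally show ?thesis .
    qed
    ultimately have "R Z = - (2 *\<^sub>R (\<Sum>i\<in>Basis. curv Z (E i) (\<lambda>q. J q (E i q)) p))"
      by blast
    moreover have "curv Z (E i) (\<lambda>q. J q (E i q)) p = J p (curv Z (E i) (E i) p) + nnJ (E i) (E i) Z p" if i: "i \<in> Basis" for i
      using nnJ_curv[OF U Z v[OF i] v[OF i]] nk_nnJ_self[OF Z v[OF i]] nk_nnJ_skew[OF v[OF i] Z v[OF i]]
      by (simp add: algebra_simps)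
    ultimately show ?thesis
      by (simp add: Ric_def L_def J_sum sum.distrib)
  qed
  \<comment> \<open>One of the two copies of L' is rewritten by \<open>swap\<close>, so that the
    Ricci identity applies to each pair e_i, J e_i.\<close>
  have L'R: "2 *\<^sub>R L' Z = R (\<lambda>q. J q (Z q)) - J p (R Z)" if Z: "vf Z" for Z
  proof -
    have "2 *\<^sub>R L' Z = (\<Sum>i\<in>Basis. nnJ (E i) (\<lambda>q. J q (E i q)) Z p - nnJ (\<lambda>q. J q (E i q)) (E i) Z p)"
      by (simp add: sum_subtractf swap[OF Z]) (simp add: L'_def scaleR_2)
    also have "\<dots> = R (\<lambda>q. J q (Z q)) - J p (R Z)"
      using nnJ_curv[OF U v vJ Z] by (simp add: R_def J_sum sum_subtractf)
    finally show ?thesis .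
  qed
  \<comment> \<open>Inserting \<open>R\<close> and L(JZ) = J(LZ) + 2 L'Z into \<open>L'R\<close>
    gives 2 L' = -2 (J Ric J + Ric) - 4 L'; the L' on the right is the origin of the factor
    3.\<close>
  have L'Ric: "3 *\<^sub>R L' Z = - (J p (Ric (\<lambda>q. J q (Z q))) + Ric Z)" if Z: "vf Z" for Z
  proof -
    let ?JZ = "\<lambda>q. J q (Z q)"
    have "2 *\<^sub>R L' Z = - (2 *\<^sub>R (J p (Ric ?JZ) + L ?JZ)) + 2 *\<^sub>R (- Ric Z + J p (L Z))"
      by (simp add: L'R[OF Z] R[OF Z] R[OF vector_field_J[OF U(1) Z]] algebra_simps)
    also have "\<dots> = - (2 *\<^sub>R (J p (Ric ?JZ) + Ric Z)) - 4 *\<^sub>R L' Z"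
    proof -
      have "4 *\<^sub>R x = x + x + x + x" for x :: 'e
        using scaleR_left_distrib[of 2 2 x] by (simp add: scaleR_2)
      then show ?thesis by (simp add: LJ[OF Z] L'[OF Z] scaleR_2 algebra_simps)
    qed
    finally have "2 *\<^sub>R L' Z + 4 *\<^sub>R L' Z = - (2 *\<^sub>R (J p (Ric ?JZ) + Ric Z))" by simp
    then have "2 *\<^sub>R (3 *\<^sub>R L' Z) = 2 *\<^sub>R (- (J p (Ric ?JZ) + Ric Z))"
      by (simp only: scaleR_left_distrib[symmetric] scaleR_scaleR scaleR_minus_right) simp
    then show ?thesis by (rule scaleR_left_imp_eq[of 2, rotated]) simp
  qed
  have Ric_sym: "g p (Ric Z) (Y p) = g p (Ric Y) (Z p)" if Z: "vf Z" and Y: "vf Y" for Z Y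
  proof -
    have "g p (curv Z (E i) (E i) p) (Y p) = g p (curv Y (E i) (E i) p) (Z p)" if i: "i \<in> Basis" for i
    proof -
      have "g p (curv Z (E i) (E i) p) (Y p) = g p (curv (E i) Y Z p) (E i p)"
        by (rule g_curv_pair_sym[OF U Z v[OF i] v[OF i] Y])
      also have "\<dots> = - g p (curv (E i) Y (E i) p) (Z p)"
        using g_curv_skew[OF U v[OF i] Y Z v[OF i]] by (simp add: g_sym)
      also have "\<dots> = g p (curv Y (E i) (E i) p) (Z p)"
        by (simp add: curv_antisym[of "E i" Y])
      finally show ?thesis .
    qed
    then show ?thesis by (simp add: Ric_def)
  qed
  have R_skew: "g p (R Z) (Y p) = - g p (Z p) (R Y)" if "vf Z" "vf Y" for Z Y
    using g_curv_skew[OF U v vJ that] by (simp add: R_def sum_negf)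
  \<comment> \<open>The form g(L'W, Y) is symmetric by \<open>L'Ric\<close>, as Ric is symmetric and
    J skew. By \<open>L'R\<close> it is also skew, because the commutator of the skew endomorphisms
    R and J is skew.\<close>
  have "L' W = 0"
  proof -
    have "g p (L' W) (Y p) = 0" if Y: "vf Y" for Y
    proof -
      note JW = vector_field_J[OF U(1) W] and JY = vector_field_J[OF U(1) Y]
      have "3 * g p (L' W) (Y p) = 3 * g p (L' Y) (W p)"
        using arg_cong[OF L'Ric[OF W], of "\<lambda>u. g p u (Y p)"] arg_cong[OF L'Ric[OF Y], of "\<lambda>u. g p u (W p)"]
          Ric_sym[OF W Y] Ric_sym[OF JW JY] by (simp add: J_skew)
      moreover have "2 * g p (L' W) (Y p) = - (2 * g p (L' Y) (W p))"
        using arg_cong[OF L'R[OF W], of "\<lambda>u. g p u (Y p)"] arg_cong[OF L'R[OF Y], of "\<lambda>u. g p u (W p)"]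
          R_skew[OF JW Y] R_skew[OF W JY] g_sym[of p "R _"] by (simp add: J_skew)
      ultimately show ?thesis by simp
    qed
    then show ?thesis
      using frame_expansion[OF E U(2), of "L' W"] v by simp
  qed
  then have "S W = - J p (L W)"
    using L'[OF W] by (metis add.inverse_inverse eq_iff_diff_eq_0)
  then have "L (\<lambda>q. J q (W q)) = J p (L W)"
    by (simp add: LJ[OF W] scaleR_2)
  then show ?thesis
    by (simp add: T.tau_eq L_def)
qed

end

lemma nearly_kahler_harmonic: "nearly_kahler M D J \<Longrightarrow> harmonic_almost_hermitian M g D J"
  unfolding harmonic_almost_hermitian_def using nk_tau by blast

end

section \<open>The product of a manifold with the real line\<close>

lemma smooth_on_linear_compose:
  fixes f :: "'a::euclidean_space \<Rightarrow> 'b::euclidean_space"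
  assumes "open S" "bounded_linear L" "smooth_on S f"
  shows "smooth_on S (\<lambda>x. L (f x))"
  by (rule smooth_on_compose[OF assms(1) open_UNIV _ assms(3) smooth_on_bounded_linear[OF assms(2)]]) simp

lemma smooth_on_Pair:
  fixes f :: "'a::euclidean_space \<Rightarrow> 'b::euclidean_space" and h :: "'a \<Rightarrow> 'c::euclidean_space"
  assumes "open S" "smooth_on S f" "smooth_on S h"
  shows "smooth_on S (\<lambda>x. (f x, h x))"
proof -
  have "bounded_linear (\<lambda>x::'b. (x, 0::'c))" "bounded_linear (\<lambda>x::'c. (0::'b, x))"
    by (auto intro!: bounded_linear_Pair bounded_linear_ident bounded_linear_zero)
  from smooth_on_add[OF assms(1) smooth_on_linear_compose[OF assms(1) this(1) assms(2)]
      smooth_on_linear_compose[OF assms(1) this(2) assms(3)]]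
  show ?thesis by simp
qed

lemma smooth_on_fst_compose:
  fixes h :: "'a::euclidean_space \<Rightarrow> 'c::real_normed_vector"
  assumes "open S" "smooth_on S h"
  shows "smooth_on (S \<times> (UNIV :: 'b::euclidean_space set)) (\<lambda>z. h (fst z))"
  by (rule smooth_on_compose[OF open_Times[OF assms(1) open_UNIV] assms(1) _ smooth_on_bounded_linear[OF bounded_linear_fst] assms(2)])
    auto

definition lift :: "('m \<Rightarrow> 'e) \<Rightarrow> 'm \<times> real \<Rightarrow> 'e::euclidean_space \<times> real" where
  "lift X z = (X (fst z), 0)"

definition dt :: "'m \<times> real \<Rightarrow> 'e::euclidean_space \<times> real" where
  "dt z = (0, 1)"

context smooth_mfd
begin

abbreviation "M' \<equiv> times_line M"

lemma line_dom: "chart_dom M' q = cd (fst q) \<times> UNIV"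
  and line_map: "chart_map M' q w = (ch (fst q) (fst w), snd w)"
  by (simp_all add: times_line_def case_prod_beta)

lemma line_image: "chart_map M' q ` (U \<times> UNIV \<inter> chart_dom M' q) = ch (fst q) ` (U \<inter> cd (fst q)) \<times> UNIV"
  by (force simp: line_dom line_map image_iff)

lemma line_image': "chart_map M' q ` chart_dom M' q = ch (fst q) ` cd (fst q) \<times> UNIV"
  using line_image[of q UNIV] by simp

text \<open>\<open>chart_inv\<close> is pinned down only on the image of the chart. Formulas on the
  product therefore hold on open sets and are transferred to derivatives by locality.\<close>

lemma line_inv:
  assumes "x \<in> ch (fst q) ` cd (fst q)"
  shows "chart_inv M' q (x, s) = (ich (fst q) x, s)"
  unfolding chart_inv_def[of M']
proof (rule inv_into_f_eq)
  show "inj_on (chart_map M' q) (chart_dom M' q)"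
    by (rule inj_on_inverseI[where g = "\<lambda>y. (ich (fst q) (fst y), snd y)"]) (auto simp: line_dom line_map)
  show "(ich (fst q) x, s) \<in> chart_dom M' q"
    using assms by (auto simp: line_dom)
  show "chart_map M' q (ich (fst q) x, s) = (x, s)"
    using assms by (simp add: line_map ch_ich)
qed

lemma smooth_manifold_line: "smooth_manifold M'"
  unfolding smooth_manifold_def
proof (intro conjI allI)
  fix q r :: "'m \<times> real"
  show "q \<in> chart_dom M' q" by (simp add: line_dom mem_Times_iff)
  show "open (chart_dom M' q)" by (simp add: line_dom open_Times)
  show "open (chart_map M' q ` chart_dom M' q)"
    unfolding line_image' by (intro open_Times open_ch_cd open_UNIV)
  show "homeomorphism (chart_dom M' q) (chart_map M' q ` chart_dom M' q) (chart_map M' q) (chart_inv M' q)"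
    unfolding homeomorphism_def
  proof (intro conjI ballI)
    show inv: "chart_inv M' q (chart_map M' q w) = w" if "w \<in> chart_dom M' q" for w
      using that by (auto simp: line_dom line_map line_inv)
    show "chart_map M' q (chart_inv M' q y) = y" if "y \<in> chart_map M' q ` chart_dom M' q" for y
      using that inv by auto
    show "chart_inv M' q ` (chart_map M' q ` chart_dom M' q) = chart_dom M' q"
      using inv by (force simp: image_iff)
    have "continuous_on (cd (fst q) \<times> UNIV) (\<lambda>w. (ch (fst q) (fst w), snd w))"
      by (intro continuous_intros continuous_on_compose2[OF homeomorphism_cont1[OF homeo]]) auto
    then show "continuous_on (chart_dom M' q) (chart_map M' q)"
      by (simp add: line_dom line_map[abs_def])
    have "continuous_on (ch (fst q) ` cd (fst q) \<times> UNIV) (\<lambda>w. (ich (fst q) (fst w), snd w))"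
      by (intro continuous_intros continuous_on_compose2[OF homeomorphism_cont2[OF homeo]]) auto
    then show "continuous_on (chart_map M' q ` chart_dom M' q) (chart_inv M' q)"
      unfolding line_image' by (rule continuous_on_cong[THEN iffD1, rotated 2]) (auto simp: line_inv)
  qed auto
  let ?S = "ch (fst q) ` (cd (fst q) \<inter> cd (fst r))"
  have S: "open ?S" using open_ch_image[of "cd (fst r)" "fst q"] by (simp add: Int_commute)
  have im: "chart_map M' q ` (chart_dom M' q \<inter> chart_dom M' r) = ?S \<times> UNIV"
    by (force simp: line_dom line_map image_iff)
  have "smooth_on (?S \<times> UNIV) (\<lambda>z. ((ch (fst r) \<circ> ich (fst q)) (fst z), snd z))"
    by (intro smooth_on_Pair smooth_on_fst_compose S trans_smooth open_Times open_UNIV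
        smooth_on_bounded_linear bounded_linear_snd)
  then show "smooth_on (chart_map M' q ` (chart_dom M' q \<inter> chart_dom M' r)) (chart_map M' r \<circ> chart_inv M' q)"
    unfolding im
    by (rule smooth_on_cong[OF open_Times[OF S open_UNIV], rotated]) (auto simp: line_map line_inv)
qed

interpretation P: smooth_mfd M' by unfold_locales (rule smooth_manifold_line)

section \<open>Differentials, functions and fields on the product\<close>

lemma dchart_line:
  assumes "fst z \<in> cd (fst q)"
  shows "dchart M' q z w = (dchart M (fst q) (fst z) (fst w), snd w)"
proof -
  let ?S = "ch (fst z) ` (cd (fst q) \<inter> cd (fst z))" and ?x = "ch (fst z) (fst z)"
  have S: "open ?S" by (rule open_ch_image) simp
  have z: "chart_map M' z z \<in> ?S \<times> UNIV" using assms by (simp add: line_map)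
  have d: "((ch (fst q) \<circ> ich (fst z)) has_derivative dchart M (fst q) (fst z)) (at (fst (chart_map M' z z)))"
    using trans_has_derivative[of "fst z" "fst z" "fst q"] assms
    by (simp add: dchart_def[abs_def] line_map)
  have "((\<lambda>y. ((ch (fst q) \<circ> ich (fst z)) (fst y), snd y)) has_derivative
      (\<lambda>w. (dchart M (fst q) (fst z) (fst w), snd w))) (at (chart_map M' z z))"
    by (intro has_derivative_Pair has_derivative_compose[where f = fst and x = "chart_map M' z z", OF _ d] bounded_linear_imp_has_derivative
        bounded_linear_fst bounded_linear_snd)
  then have "((chart_map M' q \<circ> chart_inv M' z) has_derivative
      (\<lambda>w. (dchart M (fst q) (fst z) (fst w), snd w))) (at (chart_map M' z z))"
    by (rule has_derivative_transform_within_open[OF _ open_Times[OF S open_UNIV] z])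
      (auto simp: line_map line_inv)
  then show ?thesis
    by (simp add: dchart_def[of M'] frechet_derivative_eqI)
qed

lemma dfun_fst:
  assumes "smooth_fun M U h" "fst z \<in> U"
  shows "dfun M' (\<lambda>z. h (fst z)) z w = dfun M h (fst z) (fst w)"
proof (rule P.dfun_eqI)
  let ?S = "ch (fst z) ` cd (fst z)"
  have z: "chart_map M' z z \<in> ?S \<times> UNIV" by (simp add: line_map)
  have d: "((h \<circ> ich (fst z)) has_derivative dfun M h (fst z)) (at (fst (chart_map M' z z)))"
    using smooth_fun_has_derivative[OF assms] by (simp add: line_map)
  have "((\<lambda>y. (h \<circ> ich (fst z)) (fst y)) has_derivative (\<lambda>w. dfun M h (fst z) (fst w))) (at (chart_map M' z z))"
    by (intro has_derivative_compose[where f = fst and x = "chart_map M' z z", OF _ d] bounded_linear_imp_has_derivative bounded_linear_fst)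
  then show "((\<lambda>z. h (fst z)) \<circ> chart_inv M' z has_derivative (\<lambda>w. dfun M h (fst z) (fst w))) (at (chart_map M' z z))"
    by (rule has_derivative_transform_within_open[OF _ open_Times[OF open_ch_cd open_UNIV] z])
      (auto simp: line_inv)
qed

lemma dfun_snd: "dfun M' snd z w = snd w"
proof (rule P.dfun_eqI)
  let ?S = "ch (fst z) ` cd (fst z)"
  have z: "chart_map M' z z \<in> ?S \<times> UNIV" by (simp add: line_map)
  have "(snd has_derivative snd) (at (chart_map M' z z))"
    by (intro bounded_linear_imp_has_derivative bounded_linear_snd)
  then show "(snd \<circ> chart_inv M' z has_derivative snd) (at (chart_map M' z z))"
    by (rule has_derivative_transform_within_open[OF _ open_Times[OF open_ch_cd open_UNIV] z])
      (auto simp: line_inv)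
qed

lemma smooth_fun_fst:
  assumes "open U" "smooth_fun M U h"
  shows "smooth_fun M' (U \<times> UNIV) (\<lambda>z. h (fst z))"
  unfolding smooth_fun_def line_image
proof
  fix q :: "'m \<times> real"
  let ?S = "ch (fst q) ` (U \<inter> cd (fst q))"
  have "smooth_on (?S \<times> UNIV) (\<lambda>z. (h \<circ> ich (fst q)) (fst z))"
    using assms by (intro smooth_on_fst_compose open_ch_image) (auto simp: smooth_fun_def o_def)
  then show "smooth_on (?S \<times> UNIV) ((\<lambda>z. h (fst z)) \<circ> chart_inv M' q)"
    by (rule smooth_on_cong[OF open_Times[OF open_ch_image[OF assms(1)] open_UNIV], rotated])
      (auto simp: line_inv)
qed

lemma smooth_fun_snd: "smooth_fun M' UNIV snd"
  unfolding smooth_fun_def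
proof
  fix q :: "'m \<times> real"
  have "smooth_on (ch (fst q) ` cd (fst q) \<times> UNIV) (snd :: 'e \<times> real \<Rightarrow> real)"
    by (intro smooth_on_bounded_linear bounded_linear_snd)
  then have "smooth_on (ch (fst q) ` cd (fst q) \<times> UNIV) (snd \<circ> chart_inv M' q)"
    by (rule smooth_on_cong[OF open_Times[OF open_ch_cd open_UNIV], rotated]) (auto simp: line_inv)
  then show "smooth_on (chart_map M' q ` (UNIV \<inter> chart_dom M' q)) (snd \<circ> chart_inv M' q)"
    by (simp add: line_image')
qed

lemma vector_field_lift:
  assumes "open U" "vector_field M U X"
  shows "vector_field M' (U \<times> UNIV) (lift X)"
  unfolding vector_field_def line_image
proof
  fix q :: "'m \<times> real"
  let ?S = "ch (fst q) ` (U \<inter> cd (fst q))"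
  have S: "open ?S" by (rule open_ch_image[OF assms(1)])
  have "smooth_on (?S \<times> UNIV)
      (\<lambda>z. ((\<lambda>x. dchart M (fst q) (ich (fst q) x) (X (ich (fst q) x))) (fst z), 0::real))"
    using assms(2)
    by (intro smooth_on_Pair smooth_on_fst_compose S smooth_on_const open_Times open_UNIV)
      (auto simp: vector_field_def)
  then show "smooth_on (?S \<times> UNIV) (\<lambda>x. dchart M' q (chart_inv M' q x) (lift X (chart_inv M' q x)))"
    by (rule smooth_on_cong[OF open_Times[OF S open_UNIV], rotated])
      (auto simp: line_inv dchart_line lift_def)
qed

lemma vector_field_dt: "vector_field M' UNIV dt"
  unfolding vector_field_def
proof
  fix q :: "'m \<times> real"
  let ?S = "ch (fst q) ` cd (fst q)"
  have "smooth_on (?S \<times> UNIV) (\<lambda>x. dchart M' q (chart_inv M' q x) (dt (chart_inv M' q x)))"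
    by (rule smooth_on_cong[OF open_Times[OF open_ch_cd open_UNIV] _ smooth_on_const[where c = "(0, 1)"]])
      (auto simp: line_inv dchart_line dt_def linear_0[OF linear_dchart])
  then show "smooth_on (chart_map M' q ` (UNIV \<inter> chart_dom M' q))
      (\<lambda>x. dchart M' q (chart_inv M' q x) (dt (chart_inv M' q x)))"
    by (simp add: line_image')
qed

text \<open>The charts of the product do not depend on the second entry of their index, so
  \<open>(p, 0)\<close> represents them all over \<open>p\<close>.\<close>

lemma smooth_fun_line_components:
  assumes "open N" "N \<subseteq> cd p \<times> UNIV" "vector_field M' N V"
  shows "smooth_fun M' N (\<lambda>z. dchart M p (fst z) (fst (V z)) \<bullet> b)" "smooth_fun M' N (\<lambda>z. snd (V z))"
proof -
  have N: "N \<subseteq> chart_dom M' (p, 0)" using assms(2) by (simp add: line_dom)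
  have "smooth_fun M' N (\<lambda>z. dchart M' (p, 0) z (V z) \<bullet> (b, 0))"
    by (rule P.smooth_fun_components[OF assms(1) N assms(3)])
  then show "smooth_fun M' N (\<lambda>z. dchart M p (fst z) (fst (V z)) \<bullet> b)"
    by (rule P.smooth_fun_cong[OF assms(1), rotated]) (use assms(2) in \<open>auto simp: dchart_line\<close>)
  have "smooth_fun M' N (\<lambda>z. dchart M' (p, 0) z (V z) \<bullet> (0, 1))"
    by (rule P.smooth_fun_components[OF assms(1) N assms(3)])
  then show "smooth_fun M' N (\<lambda>z. snd (V z))"
    by (rule P.smooth_fun_cong[OF assms(1), rotated]) (use assms(2) in \<open>auto simp: dchart_line\<close>)
qed

text \<open>A field on an open subset of the product need not be a lift. Locally its horizontal part
  is a combination of lifted coordinate fields, on which the tensor acts as the lift of J, and its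
  vertical part is killed.\<close>

lemma tensor11_induced_phi:
  assumes "tensor11 M J"
  shows "tensor11 M' (induced_phi J)"
  unfolding tensor11_def
proof (intro conjI allI impI)
  have J: "linear (J p)" for p using assms by (simp add: tensor11_def)
  show lin: "linear (induced_phi J z)" for z
    by (rule linearI) (simp_all add: induced_phi_def case_prod_beta linear_add[OF J] linear_cmul[OF J])
  fix U V assume U: "open U" and V: "vector_field M' U V"
  show "vector_field M' U (\<lambda>z. induced_phi J z (V z))"
  proof (rule P.vector_field_local)
    fix z0 assume z0: "z0 \<in> U"
    let ?p = "fst z0" let ?N = "U \<inter> (cd ?p \<times> UNIV)"
    have N: "open ?N" "z0 \<in> ?N" using U z0 by (auto simp: open_Int open_Times mem_Times_iff)
    have VN: "vector_field M' ?N V" by (rule P.vector_field_subset[OF V]) simp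
    have "vector_field M (cd ?p) (\<lambda>q. J q (cfield ?p b q))" for b
      using assms vector_field_cfield[of ?p b] by (auto simp: tensor11_def)
    then have "vector_field M' ?N (lift (\<lambda>q. J q (cfield ?p b q)))" for b
      by (rule P.vector_field_subset[OF vector_field_lift[OF open_cd]]) auto
    then have "vector_field M' ?N (\<lambda>z. \<Sum>b\<in>Basis. (dchart M ?p (fst z) (fst (V z)) \<bullet> b) *\<^sub>R lift (\<lambda>q. J q (cfield ?p b q)) z)"
      by (intro P.vector_field_sum P.vector_field_scale N smooth_fun_line_components VN) auto
    then have "vector_field M' ?N (\<lambda>z. induced_phi J z (V z))"
    proof (rule P.vector_field_cong[OF N(1), rotated])
      fix z assume z: "z \<in> ?N"
      then have "fst z \<in> cd ?p" by auto
      from cfield_expansion[OF this, of "fst (V z)"]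
      have "J (fst z) (fst (V z)) = J (fst z) (\<Sum>b\<in>Basis. (dchart M ?p (fst z) (fst (V z)) \<bullet> b) *\<^sub>R cfield ?p b (fst z))"
        by simp
      then show "(\<Sum>b\<in>Basis. (dchart M ?p (fst z) (fst (V z)) \<bullet> b) *\<^sub>R lift (\<lambda>q. J q (cfield ?p b q)) z) = induced_phi J z (V z)"
        by (simp add: prod_eq_iff fst_sum snd_sum lift_def induced_phi_def case_prod_beta linear_sum[OF J] linear_cmul[OF J])
    qed
    then show "\<exists>N. open N \<and> z0 \<in> N \<and> vector_field M' N (\<lambda>z. induced_phi J z (V z))"
      using N by blast
  qed
qed

end

text \<open>Smoothness of the metric is checked locally, in components with respect to the lifted
  coordinate fields and \<partial>_t.\<close>

lemma (in riemannian_lc) riemannian_warped: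
  assumes f: "smooth_fun M UNIV f" and pos: "\<And>p. 0 < f p"
  shows "riemannian_manifold M' (warped_metric g f)"
  unfolding riemannian_manifold_def
proof (intro conjI allI impI)
  interpret P: smooth_mfd M' by unfold_locales (rule smooth_manifold_line)
  show "smooth_manifold M'" by (rule smooth_manifold_line)
  fix z :: "'m \<times> real" and u v :: "'e \<times> real"
  show "bilinear (warped_metric g f z)"
    unfolding bilinear_def
    by (intro conjI allI; rule linearI) (simp_all add: warped_metric_def case_prod_beta algebra_simps)
  show "warped_metric g f z u v = warped_metric g f z v u"
    by (simp add: warped_metric_def case_prod_beta g_sym[of _ "fst u"] mult.commute)
  show "0 < warped_metric g f z u u" if "u \<noteq> 0"
  proof (cases "fst u = 0")
    case True
    then have "snd u \<noteq> 0" using that by (simp add: prod_eq_iff)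
    then show ?thesis using True pos[of "fst z"]
      by (simp add: warped_metric_def case_prod_beta power2_eq_square[symmetric])
  next
    case False
    then show ?thesis using g_pos[OF False, of "fst z"]
      by (simp add: warped_metric_def case_prod_beta power2_eq_square[symmetric] add_pos_nonneg)
  qed
next
  interpret P: smooth_mfd M' by unfold_locales (rule smooth_manifold_line)
  fix U V W assume U: "open U" and V: "vector_field M' U V" and W: "vector_field M' U W"
  show "smooth_fun M' U (\<lambda>z. warped_metric g f z (V z) (W z))"
  proof (rule P.smooth_fun_local)
    fix z0 assume z0: "z0 \<in> U"
    let ?p = "fst z0" let ?N = "U \<inter> (cd ?p \<times> UNIV)"
    have N: "open ?N" "z0 \<in> ?N" using U z0 by (auto simp: open_Int open_Times mem_Times_iff)
    have VN: "vector_field M' ?N V" "vector_field M' ?N W"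
      using V W by (auto intro: P.vector_field_subset)
    let ?c = "\<lambda>V b z. dchart M ?p (fst z) (fst (V z)) \<bullet> b"
    have gg: "smooth_fun M' ?N (\<lambda>z. g (fst z) (cfield ?p b (fst z)) (cfield ?p c (fst z)))" for b c
      by (rule P.smooth_fun_subset[OF smooth_fun_fst[OF open_cd smooth_fun_g[OF open_cd vector_field_cfield vector_field_cfield]]]) auto
    have ff: "smooth_fun M' ?N (\<lambda>z. f (fst z))"
      by (rule P.smooth_fun_subset[OF smooth_fun_fst[OF open_UNIV f]]) auto
    have "smooth_fun M' ?N (\<lambda>z. (\<Sum>b\<in>Basis. \<Sum>c\<in>Basis. (?c V b z * ?c W c z) * g (fst z) (cfield ?p b (fst z)) (cfield ?p c (fst z)))
        + (f (fst z) * f (fst z)) * (snd (V z) * snd (W z)))"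
      by (intro P.smooth_fun_add P.smooth_fun_sum P.smooth_fun_mult N gg ff smooth_fun_line_components VN) auto
    then have "smooth_fun M' ?N (\<lambda>z. warped_metric g f z (V z) (W z))"
    proof (rule P.smooth_fun_cong[OF N(1), rotated])
      fix z assume "z \<in> ?N"
      then have z: "fst z \<in> cd ?p" by auto
      have "g (fst z) (fst (V z)) (fst (W z)) =
          g (fst z) (\<Sum>b\<in>Basis. ?c V b z *\<^sub>R cfield ?p b (fst z)) (\<Sum>b\<in>Basis. ?c W b z *\<^sub>R cfield ?p b (fst z))"
        using cfield_expansion[OF z, of "fst (V z)"] cfield_expansion[OF z, of "fst (W z)"] by simp
      also have "\<dots> = (\<Sum>b\<in>Basis. \<Sum>c\<in>Basis. (?c V b z * ?c W c z) * g (fst z) (cfield ?p b (fst z)) (cfield ?p c (fst z)))"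
        by (subst sum.swap) (simp add: sum_distrib_left ac_simps)
      finally show "(\<Sum>b\<in>Basis. \<Sum>c\<in>Basis. (?c V b z * ?c W c z) * g (fst z) (cfield ?p b (fst z)) (cfield ?p c (fst z)))
        + (f (fst z) * f (fst z)) * (snd (V z) * snd (W z)) = warped_metric g f z (V z) (W z)"
        by (simp add: warped_metric_def case_prod_beta power2_eq_square)
    qed
    then show "\<exists>N. open N \<and> z0 \<in> N \<and> smooth_fun M' N (\<lambda>z. warped_metric g f z (V z) (W z))"
      using N by blast
  qed
qed

section \<open>Warped products with the real line\<close>

lemma sum_Basis_line:
  fixes h :: "'e::euclidean_space \<times> real \<Rightarrow> 'v::comm_monoid_add"
  shows "(\<Sum>i\<in>Basis. h i) = (\<Sum>b\<in>Basis. h (b, 0)) + h (0, 1)"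
  unfolding Basis_prod_def
  by (subst sum.union_disjoint) (auto simp: sum.reindex inj_on_def)

locale warped_product = almost_hermitian_lc M g D J
  for M :: "('m::{t2_space,second_countable_topology}, 'e::euclidean_space) manifold" and g D J +
  fixes f :: "'m \<Rightarrow> real" and D' :: "('m \<times> real, 'e \<times> real) connection"
  assumes smooth_f: "smooth_fun M UNIV f" and f_pos: "0 < f p"
    and levi_civita_warped: "levi_civita (times_line M) (warped_metric g f) D'"

sublocale warped_product \<subseteq> P: riemannian_lc "times_line M" "warped_metric g f" D'
  by unfold_locales (rule riemannian_warped[OF smooth_f f_pos], rule levi_civita_warped)

context warped_product
begin

abbreviation "g' \<equiv> warped_metric g f"
abbreviation "grad \<equiv> gradient M g f"
abbreviation "xi \<equiv> induced_xi f"
abbreviation "phi \<equiv> induced_phi J"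

lemma f_nz [simp]: "f p \<noteq> 0"
  using f_pos[of p] by simp

lemma warped_eq: "g' z u v = g (fst z) (fst u) (fst v) + (f (fst z))\<^sup>2 * (snd u * snd v)"
  by (simp add: warped_metric_def case_prod_beta)

lemma warped_orthogonal [simp]: "g' z (u, 0) (0, a) = 0" "g' z (0, a) (u, 0) = 0"
  by (simp_all add: warped_eq)

lemma f_inverse: "f p * f p * (inverse (f p) * inverse (f p)) = 1"
  "f p * (f p * (inverse (f p) * inverse (f p))) = 1"
  by (simp_all add: field_simps)

lemma xi_eq: "xi z = (0, inverse (f (fst z)))" and phi_eq: "phi z u = (J (fst z) (fst u), 0)"
  by (simp_all add: induced_xi_def induced_phi_def case_prod_beta divide_inverse)

lemma lift_eq: "lift X z = (X (fst z), 0)"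
  by (simp add: lift_def)

lemma open_cyl: "open U \<Longrightarrow> open (U \<times> (UNIV :: real set))"
  by (simp add: open_Times)

lemma vector_field_dt_on: "vector_field M' N dt"
  by (rule P.vector_field_subset[OF vector_field_dt]) simp

text \<open>The horizontal part is tested on coordinate functions of the base, the vertical part on
  \<open>snd\<close>, whose derivative along a lift is 0.\<close>

lemma bracket_lift:
  assumes U: "open U" "fst z \<in> U" and X: "vector_field M U X" and Y: "vector_field M U Y"
  shows "P.bracket (lift X) (lift Y) z = lift (bracket X Y) z"
proof -
  let ?p = "fst z" let ?V = "U \<inter> cd ?p"
  have V: "open ?V" "?p \<in> ?V" using U by auto
  note N = open_cyl[OF V(1)]
  have z: "z \<in> ?V \<times> UNIV" using V(2) by (simp add: mem_Times_iff)
  have v: "vector_field M ?V X" "vector_field M ?V Y" using X Y by (auto intro: vector_field_subset)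
  note l = vector_field_lift[OF V(1) v(1)] vector_field_lift[OF V(1) v(2)]
  have "fst (P.bracket (lift X) (lift Y) z) = bracket X Y ?p"
  proof (rule vector_eqI_dfun)
    fix b :: 'e
    let ?k = "\<lambda>q. ch ?p q \<bullet> b"
    have k: "smooth_fun M ?V ?k" by (rule smooth_fun_subset[OF smooth_fun_coordinate]) simp
    note k' = smooth_fun_fst[OF V(1) k]
    have *: "dfun M' (\<lambda>w. dfun M' (\<lambda>z. ?k (fst z)) w (lift B w)) z (lift A z) = dfun M (\<lambda>q. dfun M ?k q (B q)) ?p (A ?p)"
      if B: "vector_field M ?V B" for A B
    proof -
      have "dfun M' (\<lambda>w. dfun M' (\<lambda>z. ?k (fst z)) w (lift B w)) z (lift A z) =
          dfun M' (\<lambda>w. dfun M ?k (fst w) (B (fst w))) z (lift A z)"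
        by (rule P.dfun_cong[OF N z]) (auto simp: dfun_fst[OF k] lift_eq)
      then show ?thesis
        using dfun_fst[OF smooth_fun_dfun[OF V(1) k B] V(2)] by (simp add: lift_eq)
    qed
    have "dfun M ?k ?p (fst (P.bracket (lift X) (lift Y) z)) = dfun M' (\<lambda>z. ?k (fst z)) z (P.bracket (lift X) (lift Y) z)"
      by (rule dfun_fst[OF k V(2), symmetric])
    also have "\<dots> = dfun M ?k ?p (bracket X Y ?p)"
      using P.dfun_bracket[OF N l k' z] dfun_bracket[OF V(1) v k V(2)]
      by (simp add: P.bracket_def bracket_def *[OF v(1)] *[OF v(2)])
    finally show "dfun M ?k ?p (fst (P.bracket (lift X) (lift Y) z)) = dfun M ?k ?p (bracket X Y ?p)" .
  qed
  moreover have "snd (P.bracket (lift X) (lift Y) z) = 0"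
  proof -
    have "dfun M' snd z (P.bracket (lift X) (lift Y) z) = 0"
      using P.dfun_bracket[OF N l P.smooth_fun_subset[OF smooth_fun_snd] z]
      by (simp add: P.bracket_def dfun_snd lift_eq P.dfun_const)
    then show ?thesis by (simp add: dfun_snd)
  qed
  ultimately show ?thesis by (simp add: prod_eq_iff lift_eq)
qed

lemma bracket_lift_dt:
  assumes U: "open U" "fst z \<in> U" and X: "vector_field M U X"
  shows "P.bracket (lift X) dt z = 0"
proof -
  let ?p = "fst z" let ?V = "U \<inter> cd ?p"
  have V: "open ?V" "?p \<in> ?V" using U by auto
  note N = open_cyl[OF V(1)]
  have z: "z \<in> ?V \<times> UNIV" using V(2) by (simp add: mem_Times_iff)
  have v: "vector_field M ?V X" using X by (auto intro: vector_field_subset)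
  note l = vector_field_lift[OF V(1) v] vector_field_dt_on[of "?V \<times> UNIV"]
  have "fst (P.bracket (lift X) dt z) = 0"
  proof (rule vector_eqI_dfun)
    fix b :: 'e
    let ?k = "\<lambda>q. ch ?p q \<bullet> b"
    have k: "smooth_fun M ?V ?k" by (rule smooth_fun_subset[OF smooth_fun_coordinate]) simp
    note k' = smooth_fun_fst[OF V(1) k]
    have 1: "dfun M' (\<lambda>w. dfun M' (\<lambda>z. ?k (fst z)) w (dt w)) z (lift X z) = dfun M' (\<lambda>w. 0) z (lift X z)"
      by (rule P.dfun_cong[OF N z]) (auto simp: dfun_fst[OF k] dt_def linear_0[OF linear_dfun[OF k]])
    have "dfun M' (\<lambda>w. dfun M' (\<lambda>z. ?k (fst z)) w (lift X w)) z (dt z) =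
        dfun M' (\<lambda>w. dfun M ?k (fst w) (X (fst w))) z (dt z)"
      by (rule P.dfun_cong[OF N z]) (auto simp: dfun_fst[OF k] lift_eq)
    also have "\<dots> = 0"
      using dfun_fst[OF smooth_fun_dfun[OF V(1) k v] V(2)] linear_0[OF linear_dfun[OF smooth_fun_dfun[OF V(1) k v] V(2)]]
      by (simp add: dt_def)
    finally have 2: "dfun M' (\<lambda>w. dfun M' (\<lambda>z. ?k (fst z)) w (lift X w)) z (dt z) = 0" .
    have "dfun M ?k ?p (fst (P.bracket (lift X) dt z)) = dfun M' (\<lambda>z. ?k (fst z)) z (P.bracket (lift X) dt z)"
      by (rule dfun_fst[OF k V(2), symmetric])
    also have "\<dots> = 0"
      using P.dfun_bracket[OF N l k' z] by (simp add: P.bracket_def 1 2 P.dfun_const)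
    finally show "dfun M ?k ?p (fst (P.bracket (lift X) dt z)) = dfun M ?k ?p 0"
      by (simp add: linear_0[OF linear_dfun[OF k V(2)]])
  qed
  moreover have "snd (P.bracket (lift X) dt z) = 0"
  proof -
    have "dfun M' snd z (P.bracket (lift X) dt z) = 0"
      using P.dfun_bracket[OF N l P.smooth_fun_subset[OF smooth_fun_snd] z]
      by (simp add: P.bracket_def dfun_snd lift_eq dt_def P.dfun_const)
    then show ?thesis by (simp add: dfun_snd)
  qed
  ultimately show ?thesis by (simp add: prod_eq_iff)
qed

lemma dfun_warped_lift:
  assumes U: "open U" "fst z \<in> U" and X: "vector_field M U X" and Y: "vector_field M U Y"
  shows "dfun M' (\<lambda>w. g' w (lift X w) (lift Y w)) z v = dfun M (\<lambda>q. g q (X q) (Y q)) (fst z) (fst v)"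
  using dfun_fst[OF smooth_fun_g[OF U(1) X Y] U(2), of v] by (simp add: warped_eq lift_eq)

lemma smooth_f_on: "smooth_fun M U f"
  by (rule smooth_fun_subset[OF smooth_f]) simp

lemma dfun_f_square: "dfun M' (\<lambda>w. g' w (dt w) (dt w)) z v = 2 * f (fst z) * dfun M f (fst z) (fst v)"
proof -
  have "dfun M (\<lambda>q. f q * f q) p v = 2 * f p * dfun M f p v" for p v
    using dfun_mult[OF smooth_f smooth_f, of p v] by simp
  then show ?thesis
    using dfun_fst[OF smooth_fun_mult[OF open_UNIV smooth_f smooth_f], of z v]
    by (simp add: warped_eq dt_def power2_eq_square)
qed

lemma D'_dt_symm:
  assumes U: "open U" "fst z \<in> U" and X: "vector_field M U X"
  shows "D' z (dt z) (lift X) = D' z (lift X z) dt"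
  using bracket_lift_dt[OF assms] by (simp add: P.bracket_def nab_def)

text \<open>Put b(X,Y) = g'(Y, \<nabla>_X \<partial>_t). Since g'(X,Y) is independent of t and
  [X, \<partial>_t] = 0, b is skew. Since [X,Y] is horizontal and g'(Y, \<partial>_t) = 0, b is
  symmetric. Hence b = 0: the slices of constant t are totally geodesic.\<close>

lemma D'_lift_vertical:
  assumes U: "open U" "fst z \<in> U" and X: "vector_field M U X" and Y: "vector_field M U Y"
  shows "g' z (lift Y z) (D' z (lift X z) dt) = 0" "snd (D' z (lift X z) (lift Y)) = 0"
proof -
  note N = open_cyl[OF U(1)]
  have z: "z \<in> U \<times> UNIV" using U(2) by (simp add: mem_Times_iff)
  note d = vector_field_dt_on[of "U \<times> UNIV"]
  have *: "g' z (D' z (lift A z) (lift B)) (dt z) + g' z (lift B z) (D' z (lift A z) dt) = 0"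
    if B: "vector_field M U B" for A B
    using P.dfun_g[OF N vector_field_lift[OF U(1) B] d z, of "lift A z"]
    by (simp add: lift_eq[of B] dt_def P.dfun_const)
  have "0 = g' z (D' z (dt z) (lift X)) (lift Y z) + g' z (lift X z) (D' z (dt z) (lift Y))"
    using P.dfun_g[OF N vector_field_lift[OF U(1) X] vector_field_lift[OF U(1) Y] z, of "dt z"]
      dfun_warped_lift[OF U X Y, of "dt z"] linear_0[OF linear_dfun[OF smooth_fun_g[OF U(1) X Y] U(2)]]
    by (simp add: dt_def)
  then have **: "g' z (lift Y z) (D' z (lift X z) dt) + g' z (lift X z) (D' z (lift Y z) dt) = 0"
    by (simp add: D'_dt_symm[OF U X] D'_dt_symm[OF U Y] P.g_sym)
  have "D' z (lift X z) (lift Y) - D' z (lift Y z) (lift X) = lift (bracket X Y) z"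
    using bracket_lift[OF U X Y] by (simp add: P.bracket_def nab_def)
  then have "g' z (D' z (lift X z) (lift Y) - D' z (lift Y z) (lift X)) (dt z) = 0"
    by (simp only:) (simp add: warped_eq lift_eq dt_def)
  then have "g' z (D' z (lift X z) (lift Y)) (dt z) = g' z (D' z (lift Y z) (lift X)) (dt z)"
    by simp
  with *[OF Y, of X] *[OF X, of Y] ** show 1: "g' z (lift Y z) (D' z (lift X z) dt) = 0" by linarith
  with *[OF Y, of X] have "g' z (D' z (lift X z) (lift Y)) (dt z) = 0" by simp
  then show "snd (D' z (lift X z) (lift Y)) = 0" by (simp add: warped_eq dt_def)
qed

text \<open>The horizontal part vanishes by the preceding lemma; the vertical part is read off from
  the derivative of the squared length f^2 of \<partial>_t.\<close>

lemma D'_horizontal_dt: "D' z (v, 0) dt = (0, dfun M f (fst z) v / f (fst z))"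
proof -
  let ?p = "fst z"
  have c: "fst z \<in> cd ?p" and vc: "\<And>v. vector_field M (cd ?p) (cfield ?p v)"
    by (auto intro: vector_field_cfield)
  have v: "lift (cfield ?p v) z = (v, 0)" for v by (simp add: lift_eq)
  have "fst (D' z (v, 0) dt) = 0"
  proof (rule g_eqI)
    fix w
    show "g ?p (fst (D' z (v, 0) dt)) w = g ?p 0 w"
      using D'_lift_vertical(1)[OF open_cd c vc[of v] vc[of w]] by (simp add: v warped_eq g_sym)
  qed
  moreover have "2 * f ?p * dfun M f ?p v = 2 * ((f ?p)\<^sup>2 * snd (D' z (v, 0) dt))"
    using P.dfun_g[OF open_UNIV vector_field_dt vector_field_dt, of z "(v, 0)"] dfun_f_square[of z "(v, 0)"]
    by (simp add: warped_eq dt_def)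
  ultimately show ?thesis by (simp add: prod_eq_iff power2_eq_square field_simps)
qed

lemma D'_dt_lift:
  assumes U: "open U" "fst z \<in> U" and Y: "vector_field M U Y"
  shows "D' z (0, 1) (lift Y) = (0, dfun M f (fst z) (Y (fst z)) / f (fst z))"
  using D'_dt_symm[OF assms] D'_horizontal_dt[of z] by (simp add: dt_def lift_eq)

text \<open>Differentiating g'(\<partial>_t, lift) = 0 along \<partial>_t gives the horizontal part;
  the vertical part vanishes because f^2 is constant in t.\<close>

lemma D'_dt_dt: "D' z (0, 1) dt = (- (f (fst z) *\<^sub>R grad (fst z)), 0)"
proof -
  let ?p = "fst z"
  have v: "lift (cfield ?p v) z = (v, 0)" for v by (simp add: lift_eq)
  note N = open_cyl[OF open_cd[of ?p]]
  have z: "z \<in> cd ?p \<times> UNIV" by (simp add: mem_Times_iff)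
  have "fst (D' z (0, 1) dt) = - (f ?p *\<^sub>R grad ?p)"
  proof (rule g_eqI)
    fix w
    note wc = vector_field_cfield[of ?p w]
    have "g' z (D' z (0, 1) dt) (w, 0) + g' z (0, 1) (D' z (0, 1) (lift (cfield ?p w))) = 0"
      using P.dfun_g[OF N vector_field_dt_on vector_field_lift[OF open_cd wc] z, of "(0, 1)"]
      by (simp add: lift_eq dt_def P.dfun_const)
    then have "g ?p (fst (D' z (0, 1) dt)) w + f ?p * dfun M f ?p w = 0"
      by (simp add: D'_dt_lift[OF open_cd mem_cd wc] warped_eq power2_eq_square)
    then show "g ?p (fst (D' z (0, 1) dt)) w = g ?p (- (f ?p *\<^sub>R grad ?p)) w"
      using g_gradient[OF smooth_f, of ?p w] by simp
  qed
  moreover have "snd (D' z (0, 1) dt) = 0"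
    using P.dfun_g[OF open_UNIV vector_field_dt vector_field_dt, of z "(0, 1)"] dfun_f_square[of z "(0, 1)"]
      linear_0[OF linear_dfun[OF smooth_f]]
    by (simp add: warped_eq dt_def)
  ultimately show ?thesis by (simp add: prod_eq_iff)
qed

text \<open>Both connections obey the Koszul formula, and for lifts all inner products and brackets
  in it agree with those of the base.\<close>

lemma D'_horizontal_lift:
  assumes U: "open U" "fst z \<in> U" and Y: "vector_field M U Y"
  shows "D' z (v, 0) (lift Y) = (D (fst z) v Y, 0)"
proof -
  let ?p = "fst z" let ?V = "U \<inter> cd ?p"
  have V: "open ?V" "?p \<in> ?V" using U by auto
  note N = open_cyl[OF V(1)]
  have z: "z \<in> ?V \<times> UNIV" using V(2) by (simp add: mem_Times_iff)
  have vc: "vector_field M ?V (cfield ?p v)" for v by (rule vector_field_subset[OF vector_field_cfield]) simp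
  have Y: "vector_field M ?V Y" by (rule vector_field_subset[OF Y]) simp
  let ?X = "cfield ?p v"
  have v: "lift (cfield ?p v) z = (v, 0)" for v by (simp add: lift_eq)
  have "fst (D' z (v, 0) (lift Y)) = D ?p v Y"
  proof (rule g_eqI)
    fix w
    let ?Z = "cfield ?p w"
    have br: "nab D' (lift A) (lift B) z - nab D' (lift B) (lift A) z = (nab D A B ?p - nab D B A ?p, 0)"
      if "vector_field M ?V A" "vector_field M ?V B" for A B
      using bracket_lift[OF V that] by (simp add: P.bracket_def bracket_def lift_eq)
    have "2 * g' z (nab D' (lift ?X) (lift Y) z) (lift ?Z z) = 2 * g ?p (nab D ?X Y ?p) (?Z ?p)"
      unfolding koszul[OF V(1) vc Y vc V(2)]
        P.koszul[OF N vector_field_lift[OF V(1) vc] vector_field_lift[OF V(1) Y] vector_field_lift[OF V(1) vc] z]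
        br[OF vc Y] br[OF vc vc] br[OF Y vc] dfun_warped_lift[OF V Y vc] dfun_warped_lift[OF V vc vc] dfun_warped_lift[OF V vc Y]
      by (simp add: warped_eq lift_eq)
    then show "g ?p (fst (D' z (v, 0) (lift Y))) w = g ?p (D ?p v Y) w"
      by (simp add: nab_def lift_eq warped_eq)
  qed
  then show ?thesis
    using D'_lift_vertical(2)[OF V vc[of v] Y] by (simp add: prod_eq_iff v)
qed

lemma D'_lift:
  assumes U: "open U" "fst z \<in> U" and Y: "vector_field M U Y"
  shows "D' z w (lift Y) = (D (fst z) (fst w) Y, snd w * (dfun M f (fst z) (Y (fst z)) / f (fst z)))"
proof -
  have "z \<in> U \<times> UNIV" using U(2) by (simp add: mem_Times_iff)
  note lin = P.D_linear[OF open_cyl[OF U(1)] vector_field_lift[OF U(1) Y] this]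
  have "D' z ((fst w, 0) + snd w *\<^sub>R (0, 1)) (lift Y) = D' z (fst w, 0) (lift Y) + snd w *\<^sub>R D' z (0, 1) (lift Y)"
    using linear_add[OF lin] linear_cmul[OF lin] by metis
  then show ?thesis by (simp add: D'_horizontal_lift[OF assms] D'_dt_lift[OF assms])
qed

lemma D'_dt: "D' z w dt = (- ((snd w * f (fst z)) *\<^sub>R grad (fst z)), dfun M f (fst z) (fst w) / f (fst z))"
proof -
  note lin = P.D_linear[OF open_UNIV vector_field_dt UNIV_I]
  have "D' z ((fst w, 0) + snd w *\<^sub>R (0, 1)) dt = D' z (fst w, 0) dt + snd w *\<^sub>R D' z (0, 1) dt"
    using linear_add[OF lin] linear_cmul[OF lin] by metis
  then show ?thesis by (simp add: D'_horizontal_dt D'_dt_dt)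
qed

lemma smooth_inverse_f: "smooth_fun M' UNIV (\<lambda>z. inverse (f (fst z)))"
proof -
  have "smooth_fun M UNIV (\<lambda>p. inverse (f p))"
    by (rule smooth_fun_compose[OF open_UNIV smooth_f _ _ smooth_on_inverse]) (auto simp: f_pos)
  from smooth_fun_fst[OF open_UNIV this] show ?thesis by simp
qed

lemma vector_field_xi: "vector_field M' N xi"
proof -
  have "vector_field M' UNIV (\<lambda>z. inverse (f (fst z)) *\<^sub>R dt z)"
    by (rule P.vector_field_scale[OF open_UNIV smooth_inverse_f vector_field_dt])
  also have "(\<lambda>z. inverse (f (fst z)) *\<^sub>R dt z) = xi" by (auto simp: xi_eq dt_def fun_eq_iff)
  finally show ?thesis by (rule P.vector_field_subset) simp
qed

text \<open>The vertical part of the derivative of \<partial>_t cancels against the derivative of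
  1/f, as the unit length of \<xi> demands. Here \<open>snd w\<close> is \<eta>(w)/f.\<close>

lemma D'_xi: "D' z w xi = - (snd w *\<^sub>R lift grad z)"
proof -
  have e: "xi = (\<lambda>z. inverse (f (fst z)) *\<^sub>R dt z)" by (auto simp: xi_eq dt_def fun_eq_iff)
  have "dfun M' (\<lambda>z. inverse (f (fst z))) z w = - (dfun M f (fst z) (fst w) / (f (fst z))\<^sup>2)"
    using P.dfun_inverse[OF open_UNIV smooth_fun_fst[OF open_UNIV smooth_f, simplified] UNIV_I, of z w]
      dfun_fst[OF smooth_f, of z w] by simp
  then show ?thesis
    unfolding e P.D_scale[OF open_UNIV smooth_inverse_f vector_field_dt UNIV_I] D'_dt
    by (simp add: dt_def lift_eq power2_eq_square field_simps)
qed

lemma vector_field_lift_grad: "vector_field M' N (lift grad)"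
  using P.vector_field_subset[OF vector_field_lift[OF open_UNIV vector_field_gradient[OF open_UNIV smooth_f]], of N] by simp

lemma almost_contact_metric_warped: "almost_contact_metric M' g' phi xi"
  unfolding almost_contact_metric_def
  using P.riemannian tensor11_induced_phi[OF tensor_J] vector_field_xi
  by (auto simp: warped_eq xi_eq phi_eq power2_eq_square J_iso prod_eq_iff f_inverse)

lemma D_section_iff: "D_section M' g' xi N W \<longleftrightarrow> vector_field M' N W \<and> (\<forall>z\<in>N. snd (W z) = 0)"
  by (simp add: D_section_def warped_eq xi_eq)

lemma bar_connection_eq: "bar_connection g' D' xi z w W = (fst (D' z w W), 0)"
  by (simp add: bar_connection_def warped_eq xi_eq prod_eq_iff power2_eq_square f_inverse)

lemma section_connection_warped:
  "open N \<Longrightarrow> section_connection M' g' D' N (D_section M' g' xi N) (bar_connection g' D' xi) phi"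
  by (rule P.section_connection_bar[OF _ almost_contact_metric_warped])

end

subsection \<open>The equations of a harmonic almost contact structure\<close>

context warped_product
begin

lemma warped_xi: "g' z (xi z) v = f (fst z) * snd v" "g' z v (xi z) = f (fst z) * snd v"
  by (simp_all add: warped_eq xi_eq power2_eq_square field_simps)

text \<open>On tangent vectors \<open>snd\<close> is dt, so the sum is the metric dual of dt, namely
  \<partial>_t / f^2. The frame sums for \<xi> and for T(\<phi>) collapse through it.\<close>

lemma frame_snd:
  assumes N: "open N" "z \<in> N" and E: "orthonormal_frame M' g' N E"
  shows "(\<Sum>i\<in>Basis. snd (E i z) *\<^sub>R E i z) = (0, inverse ((f (fst z))\<^sup>2))"
proof -
  have "xi z = (\<Sum>i\<in>Basis. (f (fst z) * snd (E i z)) *\<^sub>R E i z)"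
    using P.frame_expansion[OF E N(2), of "xi z"] by (simp add: warped_xi)
  then have "inverse (f (fst z)) *\<^sub>R xi z = (\<Sum>i\<in>Basis. snd (E i z) *\<^sub>R E i z)"
    by (simp add: scaleR_sum_right mult.assoc[symmetric])
  then show ?thesis by (simp add: xi_eq power2_eq_square)
qed

lemma smooth_fun_snd_field:
  assumes N: "open N" and V: "vector_field M' N V"
  shows "smooth_fun M' N (\<lambda>z. snd (V z))"
proof -
  have "smooth_fun M' N (\<lambda>z. inverse (f (fst z)) * g' z (xi z) (V z))"
    by (intro P.smooth_fun_mult N P.smooth_fun_g vector_field_xi V P.smooth_fun_subset[OF smooth_inverse_f]) simp
  moreover have "inverse (f (fst z)) * g' z (xi z) (V z) = snd (V z)" for z
    by (simp add: warped_eq xi_eq power2_eq_square field_simps)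
  ultimately show ?thesis by simp
qed

lemma nab_xi: "nab D' V xi = (\<lambda>z. (- snd (V z)) *\<^sub>R lift grad z)"
  by (simp add: nab_def D'_xi fun_eq_iff)

lemma tau_xi_warped:
  assumes N: "open N" "z \<in> N" and E: "orthonormal_frame M' g' N E"
  shows "tau_xi g' D' E xi z = 0"
proof -
  let ?p = "fst z" and ?gr = "lift grad" and ?G = "g (fst z) (grad (fst z)) (grad (fst z))"
  note v = P.frame_vector_field[OF E]
  note grN = vector_field_lift_grad[of N]
  note linD = P.D_linear[OF N(1) grN N(2)]
  have Ggrad: "dfun M f ?p v = g ?p (grad ?p) v" for v
    using g_gradient[OF smooth_f] by simp
  have df: "dfun M' (\<lambda>w. f (fst w)) z w = g ?p (grad ?p) (fst w)" for w
    using dfun_fst[OF smooth_f] by (simp add: Ggrad)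
  have fN: "smooth_fun M' N (\<lambda>w. f (fst w))"
    using P.smooth_fun_subset[OF smooth_fun_fst[OF open_UNIV smooth_f], of N] by simp
  \<comment> \<open>With s = dt(E), the iterated derivative of \<xi> is -(E s) grad f - s \<nabla>_E
    grad f. The term E s cancels against the vertical part of \<nabla>_E E, which is found by
    differentiating f s = g'(\<xi>, E).\<close>
  have n2: "nab2 D' (E i) (E i) xi z =
      (2 / f ?p * (snd (E i z) * g ?p (grad ?p) (fst (E i z)))) *\<^sub>R ?gr z - snd (E i z) *\<^sub>R D' z (E i z) ?gr"
    if i: "i \<in> Basis" for i
  proof -
    let ?s = "\<lambda>w. snd (E i w)" and ?V = "D' z (E i z) (E i)"
    note s = smooth_fun_snd_field[OF N(1) v[OF i]]
    have "dfun M' (\<lambda>w. g' w (xi w) (E i w)) z (E i z) = g' z (D' z (E i z) xi) (E i z) + g' z (xi z) ?V"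
      by (rule P.dfun_g[OF N(1) vector_field_xi v[OF i] N(2)])
    also have "(\<lambda>w. g' w (xi w) (E i w)) = (\<lambda>w. f (fst w) * ?s w)"
      by (simp add: fun_eq_iff warped_eq xi_eq power2_eq_square)
    also have "g' z (D' z (E i z) xi) (E i z) = - (?s z * g ?p (grad ?p) (fst (E i z)))"
      by (simp add: D'_xi warped_eq lift_eq)
    also have "g' z (xi z) ?V = f ?p * snd ?V"
      by (simp add: warped_eq xi_eq power2_eq_square)
    also have "dfun M' (\<lambda>w. f (fst w) * ?s w) z (E i z) =
        f ?p * dfun M' ?s z (E i z) + g ?p (grad ?p) (fst (E i z)) * ?s z"
      by (simp add: P.dfun_mult[OF fN s N(2)] df)
    finally have "f ?p * snd ?V = f ?p * dfun M' ?s z (E i z) + 2 * (?s z * g ?p (grad ?p) (fst (E i z)))"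
      by simp
    then have V: "snd ?V = dfun M' ?s z (E i z) + 2 / f ?p * (?s z * g ?p (grad ?p) (fst (E i z)))"
      by (simp add: field_simps)
    have "nab D' (E i) (nab D' (E i) xi) z = - (dfun M' ?s z (E i z) *\<^sub>R ?gr z) - ?s z *\<^sub>R D' z (E i z) ?gr"
      unfolding nab_xi
      using P.D_scale[OF N(1) P.smooth_fun_minus[OF N(1) s] grN N(2), of "E i z"] P.dfun_minus[OF s N(2), of "E i z"]
      by (simp add: nab_def)
    then show ?thesis
      by (simp add: nab2_def) (simp add: nab_def D'_xi V scaleR_left_distrib)
  qed
  \<comment> \<open>The metric dual of dt is vertical, hence orthogonal to the lifted
    gradient.\<close>
  have zero: "(\<Sum>i\<in>Basis. snd (E i z) * g ?p (grad ?p) (fst (E i z))) = 0"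
  proof -
    have "(\<Sum>i\<in>Basis. snd (E i z) * g ?p (grad ?p) (fst (E i z))) = g ?p (grad ?p) (fst (\<Sum>i\<in>Basis. snd (E i z) *\<^sub>R E i z))"
      by (simp add: fst_sum)
    then show ?thesis by (simp add: frame_snd[OF N E])
  qed
  \<comment> \<open>What remains is the derivative of the lifted gradient along \<partial>_t / f^2.
    It equals (|grad f|^2 / f^2) \<xi>, and the factor is the squared norm of \<nabla>\<xi>.\<close>
  have "(\<Sum>i\<in>Basis. snd (E i z) *\<^sub>R D' z (E i z) ?gr) = D' z (\<Sum>i\<in>Basis. snd (E i z) *\<^sub>R E i z) ?gr"
    by (simp add: linear_sum[OF linD] linear_cmul[OF linD])
  also have "\<dots> = (0, ?G / (f ?p)^3)"
    using linear_0[OF D_linear[OF open_UNIV vector_field_gradient[OF open_UNIV smooth_f] UNIV_I]]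
    by (simp add: frame_snd[OF N E] D'_lift[OF open_UNIV UNIV_I vector_field_gradient[OF open_UNIV smooth_f]]
        Ggrad power2_eq_square power3_eq_cube field_simps)
  finally have D_xi_grad: "(\<Sum>i\<in>Basis. snd (E i z) *\<^sub>R D' z (E i z) ?gr) = (0, ?G / (f ?p)^3)" .
  have "(\<Sum>i\<in>Basis. nab2 D' (E i) (E i) xi z) =
      (2 / f ?p) *\<^sub>R ((\<Sum>i\<in>Basis. snd (E i z) * g ?p (grad ?p) (fst (E i z))) *\<^sub>R ?gr z)
      - (\<Sum>i\<in>Basis. snd (E i z) *\<^sub>R D' z (E i z) ?gr)"
    by (simp add: n2 sum_subtractf scaleR_sum_left scaleR_sum_right)
  then have lap: "rough_laplacian D' E xi z = (0, ?G / (f ?p)^3)"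
    by (simp add: rough_laplacian_def zero D_xi_grad)
  have "(\<Sum>i\<in>Basis. snd (E i z) * snd (E i z)) = snd (\<Sum>i\<in>Basis. snd (E i z) *\<^sub>R E i z)"
    by (simp add: snd_sum)
  then have s2: "(\<Sum>i\<in>Basis. snd (E i z) * snd (E i z)) = inverse ((f ?p)\<^sup>2)"
    by (simp add: frame_snd[OF N E])
  have "(\<Sum>i\<in>Basis. g' z (nab D' (E i) xi z) (nab D' (E i) xi z)) = (\<Sum>i\<in>Basis. (snd (E i z) * snd (E i z)) * ?G)"
    by (intro sum.cong refl) (simp add: nab_xi warped_eq lift_eq)
  also have "\<dots> = inverse ((f ?p)\<^sup>2) * ?G"
    by (simp only: sum_distrib_right[symmetric] s2)
  finally show ?thesis
    by (simp add: tau_xi_def lap xi_eq prod_eq_iff power2_eq_square power3_eq_cube field_simps)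
qed

abbreviation "bar \<equiv> bar_connection g' D' xi"

text \<open>A copy of \<open>DA\<close> for the warped product in which no open set \<open>N\<close>
  has to be fixed.\<close>

definition DAw :: "'m \<times> real \<Rightarrow> 'e \<times> real \<Rightarrow> ('m \<times> real \<Rightarrow> 'e \<times> real) \<Rightarrow> 'e \<times> real" where
  "DAw z v W = bar z v (\<lambda>w. phi w (W w)) - phi z (bar z v W)"

lemma DAw_eq:
  fixes N :: "('m \<times> real) set"
  assumes "open N"
  shows "section_connection.DA bar phi = DAw"
proof -
  interpret S: section_connection M' g' D' N "D_section M' g' xi N" bar phi
    by (rule section_connection_warped[OF assms])
  show ?thesis by (intro ext) (simp only: DAw_def S.DA_def)
qed

lemma phi_lift: "(\<lambda>z. phi z (lift W z)) = lift (\<lambda>q. J q (W q))"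
  by (simp add: fun_eq_iff phi_eq lift_eq)

lemma bar_lift:
  assumes "open U" "fst z \<in> U" "vector_field M U W"
  shows "bar z v (lift W) = (D (fst z) (fst v) W, 0)"
  by (simp add: bar_connection_eq D'_lift[OF assms])

lemma DAw_lift:
  assumes "open U" "fst z \<in> U" "vector_field M U W"
  shows "DAw z v (lift W) = (nJ (fst z) (fst v) W, 0)"
  unfolding DAw_def phi_lift bar_lift[OF assms] bar_lift[OF assms(1,2) vector_field_J[OF assms(1,3)]]
  by (simp add: phi_eq nJ_def)

lemma D_section_lift:
  assumes "open U" "vector_field M U W"
  shows "D_section M' g' xi (U \<times> UNIV) (lift W)"
  using vector_field_lift[OF assms] by (simp add: D_section_iff lift_eq)

text \<open>As \<nabla>_E \<xi> = - dt(E) grad f, the trace is minus the derivative of J along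
  \<partial>_t / f^2, applied to the lifted gradient; J is parallel on lifts in vertical
  directions.\<close>

lemma T_phi_warped:
  assumes N: "open N" "z \<in> N" and E: "orthonormal_frame M' g' N E"
  shows "T_phi g' D' E phi xi z = 0"
proof -
  interpret S: section_connection M' g' D' N "D_section M' g' xi N" bar phi
    by (rule section_connection_warped[OF N(1)])
  note v = P.frame_vector_field[OF E] and gradU = vector_field_gradient[OF open_UNIV smooth_f]
  have gr: "D_section M' g' xi N (lift grad)"
    using vector_field_lift_grad by (simp add: D_section_iff lift_eq)
  have lin: "linear (\<lambda>v. S.DA z v (lift grad))" by (rule S.DA_linear[OF gr N(2)])
  have "T_phi g' D' E phi xi z = (\<Sum>i\<in>Basis. S.DA z (E i z) (\<lambda>w. (- snd (E i w)) *\<^sub>R lift grad w))"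
    by (simp add: T_phi_def nab_bar_eq S.nA_eq nab_xi)
  also have "\<dots> = (\<Sum>i\<in>Basis. (- snd (E i z)) *\<^sub>R S.DA z (E i z) (lift grad))"
    by (intro sum.cong refl S.DA_scale N gr P.smooth_fun_minus smooth_fun_snd_field v)
  also have "\<dots> = - S.DA z (\<Sum>i\<in>Basis. snd (E i z) *\<^sub>R E i z) (lift grad)"
    by (simp add: linear_sum[OF lin] linear_cmul[OF lin] sum_negf)
  also have "\<dots> = 0"
    using linear_0[OF nJ_linear[OF open_UNIV gradU UNIV_I]]
    by (simp add: frame_snd[OF N E] DAw_eq[OF N(1)] DAw_lift[OF open_UNIV UNIV_I gradU] zero_prod_def)
  finally show ?thesis .
qed

text \<open>Indices are basis vectors of the product: \<open>(b, 0)\<close> is sent to a lift and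
  \<open>(0, 1)\<close> to \<xi>, and \<open>snd i\<close> tells them apart.\<close>

definition lift_frame :: "('e \<Rightarrow> 'm \<Rightarrow> 'e) \<Rightarrow> 'e \<times> real \<Rightarrow> 'm \<times> real \<Rightarrow> 'e \<times> real" where
  "lift_frame E i = (if snd i = 0 then lift (E (fst i)) else xi)"

lemma orthonormal_lift_frame:
  assumes U: "open U" and E: "orthonormal_frame M g U E"
  shows "orthonormal_frame M' g' (U \<times> UNIV) (lift_frame E)"
  unfolding orthonormal_frame_def
proof (intro conjI ballI)
  fix i :: "'e \<times> real" assume i: "i \<in> Basis"
  then show "vector_field M' (U \<times> UNIV) (lift_frame E i)"
    by (auto simp: lift_frame_def Basis_prod_def intro!: vector_field_xi vector_field_lift U frame_vector_field[OF E])
  fix z j assume "z \<in> U \<times> (UNIV :: real set)" and j: "j \<in> (Basis :: ('e \<times> real) set)"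
  then show "g' z (lift_frame E i z) (lift_frame E j z) = (if i = j then 1 else 0)"
    using i by (auto simp: lift_frame_def Basis_prod_def warped_eq lift_eq xi_eq frame_orthonormal[OF E]
        power2_eq_square f_inverse split: if_splits)
qed

text \<open>Along the lifts \<open>\<nabla>\<close>-bar is the connection of the base, and the \<open>\<xi>\<close>-direction contributes to the
  rough Laplacian only through \<open>\<nabla>\<^sub>\<xi> \<xi> = - grad f / f\<close>.\<close>

lemma trace_lift_frame:
  assumes U: "open U" "fst z \<in> U" and E: "orthonormal_frame M g U E" and W: "vector_field M U W"
  shows "(\<Sum>i\<in>Basis. nab2_end D' (nab bar) (lift_frame E i) (lift_frame E i) (endo_of phi) (lift W) z) =
    ((\<Sum>b\<in>Basis. nnJ (E b) (E b) W (fst z)) + inverse (f (fst z)) *\<^sub>R nJ (fst z) (grad (fst z)) W, 0)"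
proof -
  let ?N = "U \<times> (UNIV :: real set)" and ?p = "fst z"
  note N = open_cyl[OF U(1)]
  have z: "z \<in> ?N" using U(2) by (simp add: mem_Times_iff)
  interpret S: section_connection M' g' D' ?N "D_section M' g' xi ?N" bar phi
    by (rule section_connection_warped[OF N])
  note DA = DAw_eq[OF N]
  have lin: "linear (\<lambda>v. nJ q v X)" "linear (\<lambda>v. D q v X)" if "q \<in> U" "vector_field M U X" for q X
    using nJ_linear[OF U(1) that(2,1)] D_linear[OF U(1) that(2,1)] .
  have secl: "D_section M' g' xi ?N (lift X)" if "vector_field M U X" for X
    by (rule D_section_lift[OF U(1) that])
  have 1: "S.K (lift X) (lift X) (lift W) z = (nnJ X X W ?p, 0)" if X: "vector_field M U X" for X
  proof -
    note XW = vector_field_nJ[OF U(1) X W] and dXW = vector_field_nab[OF U(1) X W]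
    have X': "vector_field M' ?N (lift X)" by (rule vector_field_lift[OF U(1) X])
    \<comment> \<open>The differentiated section is known to be a lift only on \<open>?N\<close>;
      locality of the connection permits the replacement.\<close>
    have "bar z (lift X z) (S.nA (lift X) (lift W)) = bar z (lift X z) (lift (\<lambda>q. nJ q (X q) W))"
      by (rule S.C_cong[OF S.Sec_nA[OF X' secl[OF W]] secl[OF XW] _ z])
        (auto simp: S.nA_eq DA DAw_lift[OF U(1) _ W] lift_eq)
    moreover have "S.DA z (lift X z) (nab bar (lift X) (lift W)) = S.DA z (lift X z) (lift (nab D X W))"
      by (rule S.DA_cong[OF z S.Sec_nab[OF X' secl[OF W]] secl[OF dXW]])
        (auto simp: nab_def bar_lift[OF U(1) _ W] lift_eq)
    ultimately show ?thesis
      by (simp add: S.K_eq bar_lift[OF U XW] DA DAw_lift[OF U dXW] DAw_lift[OF U W] nnJ_eq)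
        (simp add: lift_eq D'_lift[OF U X])
  qed
  have 2: "S.K xi xi (lift W) z = (inverse (f ?p) *\<^sub>R nJ ?p (grad ?p) W, 0)"
  proof -
    note z0 = vector_field_zero[OF U(1)]
    have "bar z (xi z) (S.nA xi (lift W)) = bar z (xi z) (lift (\<lambda>q. 0))"
      by (rule S.C_cong[OF S.Sec_nA[OF vector_field_xi secl[OF W]] secl[OF z0] _ z])
        (auto simp: S.nA_eq DA DAw_lift[OF U(1) _ W] lift_eq xi_eq linear_0[OF lin(1)[OF _ W]])
    moreover have "S.DA z (xi z) (nab bar xi (lift W)) = S.DA z (xi z) (lift (\<lambda>q. 0))"
      by (rule S.DA_cong[OF z S.Sec_nab[OF vector_field_xi secl[OF W]] secl[OF z0]])
        (auto simp: nab_def bar_lift[OF U(1) _ W] lift_eq xi_eq linear_0[OF lin(2)[OF _ W]])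
    ultimately show ?thesis
      using linear_neg[OF lin(1)[OF U(2) W]] linear_cmul[OF lin(1)[OF U(2) W]]
      by (simp add: S.K_eq bar_lift[OF U z0] DA DAw_lift[OF U z0] DAw_lift[OF U W] D_zero D'_xi)
        (simp add: xi_eq lift_eq nJ_def D_zero linear_0[OF lin(1)[OF U(2) z0]] zero_prod_def)
  qed
  have "(\<Sum>i\<in>Basis. S.K (lift_frame E i) (lift_frame E i) (lift W) z) =
      (\<Sum>b\<in>Basis. S.K (lift (E b)) (lift (E b)) (lift W) z) + S.K xi xi (lift W) z"
    by (simp add: sum_Basis_line lift_frame_def)
  also have "\<dots> = (\<Sum>b\<in>Basis. (nnJ (E b) (E b) W ?p, 0)) + (inverse (f ?p) *\<^sub>R nJ ?p (grad ?p) W, 0)"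
    by (simp add: 1[OF frame_vector_field[OF E]] 2)
  finally show ?thesis by (simp add: prod_eq_iff fst_sum snd_sum)
qed

text \<open>The trace is evaluated at W and at JW. By \<open>nJ_J\<close> the first order term
  contributes equally in both, which makes 1/f into 2/f.\<close>

lemma tau_J_lift:
  assumes U: "open U" "fst z \<in> U" and E: "orthonormal_frame M g U E" and W: "vector_field M U W"
  shows "tau_J g' D' (lift_frame E) phi xi (lift W) z =
    (commutator (rough_laplacian_end D (nab D) E (endo_of J)) (endo_of J) W (fst z)
      + (2 / f (fst z)) *\<^sub>R J (fst z) (nab_end (nab D) grad (endo_of J) W (fst z)), 0)"
proof -
  let ?N = "U \<times> (UNIV :: real set)" and ?p = "fst z"
  interpret S: section_connection M' g' D' ?N "D_section M' g' xi ?N" bar phi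
    by (rule section_connection_warped[OF open_cyl[OF U(1)]])
  interpret T: section_connection M g D U "vector_field M U" D J
    by (rule section_connection_J[OF U(1)])
  show ?thesis
    unfolding tau_J_def nab_bar_eq S.tau_eq T.tau_eq phi_lift trace_lift_frame[OF U E W]
      trace_lift_frame[OF U E vector_field_J[OF U(1) W]] nab_end_J nJ_J[OF U(1) W U(2)]
    by (simp add: phi_eq scaleR_2[symmetric] divide_inverse)
qed

text \<open>Three reductions: \<open>N\<close> shrinks to its intersection with a cylinder carrying
  a lifted frame; the trace is the same in that frame; and the section, which may depend on t, is a
  combination of lifts, its \<xi>-coefficient being 0.\<close>

lemma tau_J_vanishes:
  assumes N: "open N" "z \<in> N" and E: "orthonormal_frame M' g' N E" and W: "D_section M' g' xi N W"
    and base: "\<And>U F X. open U \<Longrightarrow> fst z \<in> U \<Longrightarrow> orthonormal_frame M g U F \<Longrightarrow> vector_field M U X \<Longrightarrow>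
      commutator (rough_laplacian_end D (nab D) F (endo_of J)) (endo_of J) X (fst z)
      + (2 / f (fst z)) *\<^sub>R J (fst z) (nab_end (nab D) grad (endo_of J) X (fst z)) = 0"
  shows "tau_J g' D' E phi xi W z = 0"
proof -
  obtain U F where U: "open U" "fst z \<in> U" and F: "orthonormal_frame M g U F" by (rule local_frame)
  let ?V = "N \<inter> U \<times> (UNIV :: real set)"
  have V: "open ?V" "z \<in> ?V" using N U open_cyl[OF U(1)] by (auto simp: mem_Times_iff)
  interpret S: section_connection M' g' D' ?V "D_section M' g' xi ?V" bar phi
    by (rule section_connection_warped[OF V(1)])
  have E': "orthonormal_frame M' g' ?V E" and F': "orthonormal_frame M' g' ?V (lift_frame F)"
    by (rule P.frame_subset[OF E], simp, rule P.frame_subset[OF orthonormal_lift_frame[OF U(1) F]], simp)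
  have W': "D_section M' g' xi ?V W"
    using W P.vector_field_subset[of N W ?V] by (auto simp: D_section_iff)
  have lF: "D_section M' g' xi ?V (lift (F b))" if "b \<in> Basis" for b
    using D_section_lift[OF U(1) frame_vector_field[OF F that]] P.vector_field_subset[of "U \<times> UNIV" "lift (F b)" ?V]
    by (auto simp: D_section_iff)
  have exp: "W w = (\<Sum>b\<in>Basis. g' w (W w) (lift (F b) w) *\<^sub>R lift (F b) w)" if w: "w \<in> ?V" for w
  proof -
    have "g' w (W w) (xi w) = 0"
      using W' w by (simp add: D_section_def P.g_sym)
    then show ?thesis
      using P.frame_expansion[OF F' w, of "W w"] by (simp add: sum_Basis_line lift_frame_def)
  qed
  have "tau_J g' D' E phi xi W z = S.tau (lift_frame F) W z"
    unfolding tau_J_def nab_bar_eq by (rule S.tau_frame_indep[OF V(2) E' F' W'])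
  also have "\<dots> = (\<Sum>b\<in>Basis. g' z (W z) (lift (F b) z) *\<^sub>R S.tau (lift_frame F) (lift (F b)) z)"
    by (rule P.tensorial_expand[OF S.module S.tensorial_tau[OF V(2) F'] W', where h = "\<lambda>b w. g' w (W w) (lift (F b) w)"])
      (use lF W' exp in \<open>auto intro!: P.smooth_fun_g V(1) simp: D_section_iff\<close>)
  also have "\<dots> = 0"
  proof (rule sum.neutral, rule ballI)
    fix b :: 'e assume b: "b \<in> Basis"
    have "S.tau (lift_frame F) (lift (F b)) z = 0"
      using tau_J_lift[OF U F frame_vector_field[OF F b]] base[OF U F frame_vector_field[OF F b]]
      unfolding tau_J_def nab_bar_eq by (simp add: zero_prod_def)
    then show "g' z (W z) (lift (F b) z) *\<^sub>R S.tau (lift_frame F) (lift (F b)) z = 0" by simp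
  qed
  finally show ?thesis .
qed

lemma harmonic_warped_iff:
  "harmonic_almost_contact M' g' D' phi xi \<longleftrightarrow>
    (\<forall>U E W. open U \<longrightarrow> orthonormal_frame M g U E \<longrightarrow> vector_field M U W \<longrightarrow>
      (\<forall>p\<in>U. commutator (rough_laplacian_end D (nab D) E (endo_of J)) (endo_of J) W p
        + (2 / f p) *\<^sub>R J p (nab_end (nab D) grad (endo_of J) W p) = 0))"
  (is "?L \<longleftrightarrow> ?R")
proof
  assume L: ?L
  show ?R
  proof (intro allI impI ballI)
    fix U E W p assume U: "open U" and E: "orthonormal_frame M g U E" and W: "vector_field M U W" and p: "p \<in> U"
    have "\<forall>z\<in>U \<times> UNIV. tau_J g' D' (lift_frame E) phi xi (lift W) z = 0"
      using L open_cyl[OF U] orthonormal_lift_frame[OF U E] D_section_lift[OF U W]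
      unfolding harmonic_almost_contact_def by blast
    \<comment> \<open>Lifts, the lifted frame and \<xi> are constant in t, so the slice t = 0
      represents the base.\<close>
    then have "tau_J g' D' (lift_frame E) phi xi (lift W) (p, 0) = 0" using p by simp
    then show "commutator (rough_laplacian_end D (nab D) E (endo_of J)) (endo_of J) W p
        + (2 / f p) *\<^sub>R J p (nab_end (nab D) grad (endo_of J) W p) = 0"
      using tau_J_lift[OF U _ E W, of "(p, 0)"] p by (simp add: zero_prod_def)
  qed
next
  assume R: ?R
  show ?L
    unfolding harmonic_almost_contact_def
  proof (intro conjI allI impI ballI)
    show "almost_contact_metric M' g' phi xi" by (rule almost_contact_metric_warped)
    fix N E z assume N: "open N" and E: "orthonormal_frame M' g' N E"
    show "tau_xi g' D' E xi z + (1/2) *\<^sub>R phi z (T_phi g' D' E phi xi z) = 0" if "z \<in> N" for z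
      using tau_xi_warped[OF N that E] T_phi_warped[OF N that E] by (simp add: phi_eq zero_prod_def)
    show "tau_J g' D' E phi xi W z = 0" if "D_section M' g' xi N W" "z \<in> N" for W z
      by (rule tau_J_vanishes[OF N that(2) E that(1)]) (use R in blast)
  qed
qed

end

section \<open>Kaehler structures and Kaehler null fields\<close>

context almost_hermitian_lc
begin

lemma kahler_nJ: "kahler M D J \<Longrightarrow> open U \<Longrightarrow> vector_field M U X \<Longrightarrow> vector_field M U W \<Longrightarrow> p \<in> U \<Longrightarrow> nJ p (X p) W = 0"
  unfolding kahler_def nab_end_J by blast

lemma kahler_harmonic:
  assumes k: "kahler M D J" and U: "open U" "p \<in> U" and E: "orthonormal_frame M g U E" and W: "vector_field M U W"
  shows "commutator (rough_laplacian_end D (nab D) E (endo_of J)) (endo_of J) W p = 0"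
proof -
  interpret T: section_connection M g D U "vector_field M U" D J
    by (rule section_connection_J[OF U(1)])
  have "nnJ X X Z p = 0" if X: "vector_field M U X" and Z: "vector_field M U Z" for X Z
  proof -
    have "D p (X p) (\<lambda>q. nJ q (X q) Z) = D p (X p) (\<lambda>q. 0)"
      by (rule D_cong[OF U(1) vector_field_zero[OF U(1)] kahler_nJ[OF k U(1) X Z] U(2)])
    then show ?thesis
      using kahler_nJ[OF k U(1) X vector_field_nab[OF U(1) X Z] U(2)]
        kahler_nJ[OF k U(1) vector_field_nab[OF U(1) X X] Z U(2)]
      by (simp add: nnJ_eq D_zero nab_def)
  qed
  then show ?thesis
    using W vector_field_J[OF U(1) W] frame_vector_field[OF E] by (simp add: T.tau_eq)
qed

text \<open>The equation in (i) refers to open sets that carry an orthonormal frame,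
  \<open>kahler_null\<close> to all open sets; around each point a local frame bridges the two after
  shrinking \<open>U\<close>.\<close>

lemma kahler_null_iff_frame:
  "kahler_null M D J X \<longleftrightarrow> (\<forall>U E W. open U \<longrightarrow> orthonormal_frame M g U E \<longrightarrow> vector_field M U W \<longrightarrow>
     (\<forall>p\<in>U. nab_end (nab D) X (endo_of J) W p = 0))" (is "?L \<longleftrightarrow> ?R")
proof
  assume R: ?R
  show ?L
    unfolding kahler_null_def
  proof (intro allI impI ballI)
    fix U W p assume U: "open U" and W: "vector_field M U W" and p: "p \<in> U"
    obtain V E where V: "open V" "p \<in> V" and E: "orthonormal_frame M g V E" by (rule local_frame)
    have "open (U \<inter> V)" "p \<in> U \<inter> V" using U V p by auto
    moreover have "orthonormal_frame M g (U \<inter> V) E" by (rule frame_subset[OF E]) simp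
    moreover have "vector_field M (U \<inter> V) W" by (rule vector_field_subset[OF W]) simp
    ultimately show "nab_end (nab D) X (endo_of J) W p = 0" using R by blast
  qed
qed (auto simp: kahler_null_def)

end

theorem theorem3p2:
  fixes M :: "('m::{t2_space,second_countable_topology}, 'e::euclidean_space) manifold"
    and g :: "'m \<Rightarrow> 'e \<Rightarrow> 'e \<Rightarrow> real"
    and J :: "'m \<Rightarrow> 'e \<Rightarrow> 'e"
    and D :: "('m, 'e) connection"
    and f :: "'m \<Rightarrow> real"
    and D' :: "('m \<times> real, 'e \<times> real) connection"
  assumes "almost_hermitian M g J"
    and "levi_civita M g D"
    and "smooth_fun M UNIV f"
    and "\<forall>p. 0 < f p"
    and "levi_civita (times_line M) (warped_metric g f) D'"
  shows "let harmonic_warped = harmonic_almost_contact (times_line M) (warped_metric g f) D'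
                                 (induced_phi J) (induced_xi f)
    in
      (harmonic_warped \<longleftrightarrow>
        (\<forall>U E W. open U \<longrightarrow> orthonormal_frame M g U E \<longrightarrow> vector_field M U W \<longrightarrow>
           (\<forall>p\<in>U. commutator (rough_laplacian_end D (nab D) E (endo_of J)) (endo_of J) W p
              + (2 / f p) *\<^sub>R J p (nab_end (nab D) (gradient M g f) (endo_of J) W p) = 0))) \<and>
      (kahler M D J \<longrightarrow> harmonic_warped) \<and>
      (harmonic_almost_hermitian M g D J \<longrightarrow>
        (harmonic_warped \<longleftrightarrow> kahler_null M D J (gradient M g f))) \<and>
      (nearly_kahler M D J \<longrightarrow> harmonic_almost_hermitian M g D J)"
proof -
  interpret warped_product M g D J f D'
    by unfold_locales (use assms in \<open>auto simp: almost_hermitian_def\<close>)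
  have 2: "harmonic_almost_contact M' g' D' phi xi" if k: "kahler M D J"
    unfolding harmonic_warped_iff
  proof (intro allI impI ballI)
    fix U E W p assume U: "open U" and E: "orthonormal_frame M g U E" and W: "vector_field M U W" and p: "p \<in> U"
    show "commutator (rough_laplacian_end D (nab D) E (endo_of J)) (endo_of J) W p
        + (2 / f p) *\<^sub>R J p (nab_end (nab D) grad (endo_of J) W p) = 0"
      using kahler_harmonic[OF k U p E W] kahler_nJ[OF k U vector_field_gradient[OF U smooth_f_on] W p]
      by (simp add: nab_end_J)
  qed
  \<comment> \<open>As 2/f is positive, injectivity of J makes the first order term vanish exactly
    when the derivative of J along grad f does.\<close>
  have J_0: "J p v = 0 \<longleftrightarrow> v = 0" for p v
    using J_J[of p v] by (metis J_simps(5) neg_equal_0_iff_equal)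
  have 3: "harmonic_almost_contact M' g' D' phi xi \<longleftrightarrow> kahler_null M D J grad" if h: "harmonic_almost_hermitian M g D J"
  proof -
    have "commutator (rough_laplacian_end D (nab D) E (endo_of J)) (endo_of J) W p
        + (2 / f p) *\<^sub>R J p (nab_end (nab D) grad (endo_of J) W p) = 0 \<longleftrightarrow>
        nab_end (nab D) grad (endo_of J) W p = 0"
      if "open U" "orthonormal_frame M g U E" "vector_field M U W" "p \<in> U" for U E W p
    proof -
      have "commutator (rough_laplacian_end D (nab D) E (endo_of J)) (endo_of J) W p = 0"
        using h that unfolding harmonic_almost_hermitian_def by blast
      then show ?thesis by (simp add: J_0)
    qed
    then show ?thesis
      unfolding harmonic_warped_iff kahler_null_iff_frame by blast
  qed
  show ?thesis
    unfolding Let_def using harmonic_warped_iff 2 3 nearly_kahler_harmonic by blast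
qed

end
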